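(* Let $X=\{X_t\}_{t\ge 0}$ be a spectrally positive Lévy process with Laplace exponent $\phi$ and right inverse $\psi$, and let $\{\mathcal{Q}_t\}_{t\ge0}$ be the associated workload process. Suppose $T_1,\dots,T_n$ are $n$ independent exponentially distributed random variables, independent of $X$, with distinct parameters $q_1,\dots,q_n$. Then, for $\alpha_1,\dots,\alpha_n\ge 0$ and $x\ge 0$, $$\mathbb{E}_x e^{-\alpha_1\mathcal{Q}_{T_1}-\alpha_2\mathcal{Q}_{T_1+T_2}-\cdots-\alpha_n\mathcal{Q}_{T_1+T_2+\cdots+T_n}}=\prod_{i=1}^n\frac{q_i}{q_i-\phi(\alpha_i+\cdots+\alpha_n)}\,e^{-(\alpha_1+\cdots+\alpha_n)x}+\sum_{l=1}^n\sum_{j=1}^{2^{n-l}}L^{(n)}_{(2^lj-2^{l-1}+1,\,l)}(\bar q,\bar\alpha)\,e^{-(\alpha_1+\cdots+\alpha_{l-1}+\psi(q_l))x},$$ where $\bar q=(q_1,\dots,q_n)$, $\bar\alpha=(\alpha_1,\dots,\alpha_n)$ and, for $l=1,\dots,n$, $j=1,\dots,2^{n-l}$ and $p=2^lj-2^{l-1}+1$, $$L^{(n)}_{(p,l)}(\bar q,\bar\alpha)=c^{(p,n)}\prod_{i=1}^n\frac{q_i}{q_i-\phi(\alpha_i+d^{(i,p)})}\prod_{i=l}^n\frac{\alpha_i+d^{(i,p)}}{d^{(i-1,p)}},$$ with the signs $c^{(p,n)}$ and the quantities $d^{(i,p)}$ as defined in the context.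
   Context: A Lévy process $X$ is spectrally positive if it has no negative jumps. Its Laplace exponent is $\phi(\alpha)=\log\mathbb{E}e^{-\alpha X_1}$, $\alpha\ge0$, and the right inverse of $\phi$ is $\psi(q)=\sup\{\alpha\ge0:\phi(\alpha)=q\}$. The workload process is the reflection of $X$ at zero: $\mathcal{Q}_t=X_t+\max\{\mathcal{Q}_0,\mathcal{L}_t\}$ with $\mathcal{L}_t=\sup_{0\le s\le t}(-X_s)=-\inf_{0\le s\le t}X_s$. $\mathbb{E}_x$ denotes expectation given the initial workload $\mathcal{Q}_0=x$. Signs: for $p=1,\dots,2^n$, write $p-1=b_0 2^0+b_1 2^1+\cdots+b_{n-1}2^{n-1}$ in binary; then $c^{(p,n)}=1$ if the number of 1's among $b_0,\dots,b_{n-1}$ is even, and $c^{(p,n)}=-1$ if it is odd. Quantities $d^{(i,p)}$: for $p=2^lj-2^{l-1}+1$ with $1\le l\le n$, $1\le j\le 2^{n-l}$, set $d^{(n,p)}=0$ and, recursively for $i=n-1,n-2,\dots,0$, $$d^{(i,p)}=\begin{cases}\alpha_{i+1}+d^{(i+1,p)} & \text{if } \lceil p/2^i\rceil \text{ is odd},\\ \psi(q_{i+1}) & \text{if } \lceil p/2^i\rceil\text{ is even}.\end{cases}$$ For $l=1$ the sum $\alpha_1+\cdots+\alpha_{l-1}$ is empty, so the exponent is $-\psi(q_1)x$.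
   Formalization: X is assumed not to be a subordinator (otherwise ψ(q) is a supremum over the empty set); where a denominator on the right-hand side vanishes (e.g. q_i = φ(α_i+…+α_n), or α_n/d = 0/0), the identity is read as the limit over nearby nonsingular α. *)

theory Defs
  imports "HOL-Probability.Probability"
begin

text \<open>A real-valued Levy process on the time axis \<open>[0, \<infinity>)\<close>; the values \<open>X t\<close> for \<open>t < 0\<close> are irrelevant.\<close>

locale levy_process = prob_space M for M :: "'w measure" +
  fixes X :: "real \<Rightarrow> 'w \<Rightarrow> real"
  assumes measurable_process: "\<And>t. 0 \<le> t \<Longrightarrow> X t \<in> borel_measurable M"
    and start_zero: "AE \<omega> in M. X 0 \<omega> = 0"
    and independent_increments:
      "\<And>(m::nat) (t :: nat \<Rightarrow> real). 0 \<le> t 0 \<Longrightarrow> (\<And>k. k < m \<Longrightarrow> t k \<le> t (Suc k)) \<Longrightarrow>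
         indep_vars (\<lambda>_. borel) (\<lambda>k \<omega>. X (t (Suc k)) \<omega> - X (t k) \<omega>) {..<m}"
    and stationary_increments:
      "\<And>s h. 0 \<le> s \<Longrightarrow> 0 \<le> h \<Longrightarrow>
         distr M borel (\<lambda>\<omega>. X (s + h) \<omega> - X s \<omega>) = distr M borel (X h)"
    and right_continuous_paths:
      "AE \<omega> in M. \<forall>t\<ge>0. ((\<lambda>s. X s \<omega>) \<longlongrightarrow> X t \<omega>) (at_right t)"
    and left_limits:
      "AE \<omega> in M. \<forall>t>0. \<exists>l. ((\<lambda>s. X s \<omega>) \<longlongrightarrow> l) (at_left t)"

locale spectrally_positive_levy_process = levy_process +
  assumes no_negative_jumps: "AE \<omega> in M. \<forall>t>0. Lim (at_left t) (\<lambda>s. X s \<omega>) \<le> X t \<omega>"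

text \<open>A subordinator also has no negative jumps, but its Laplace exponent is nonpositive on
  \<open>[0, \<infinity>)\<close>, so that for \<open>q > 0\<close> the supremum defining the right inverse at \<open>q\<close> would
  range over the empty set.\<close>

definition subordinator :: "'w measure \<Rightarrow> (real \<Rightarrow> 'w \<Rightarrow> real) \<Rightarrow> bool" where
  "subordinator M X \<longleftrightarrow> levy_process M X \<and> (AE \<omega> in M. mono_on {0..} (\<lambda>t. X t \<omega>))"

definition laplace_exponent :: "'w measure \<Rightarrow> (real \<Rightarrow> 'w \<Rightarrow> real) \<Rightarrow> real \<Rightarrow> real" where
  "laplace_exponent M X a = ln (\<integral>\<omega>. exp (- a * X 1 \<omega>) \<partial>M)"

definition right_inverse :: "(real \<Rightarrow> real) \<Rightarrow> real \<Rightarrow> real" where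
  "right_inverse \<phi> q = Sup {a. 0 \<le> a \<and> \<phi> a = q}"

definition workload :: "(real \<Rightarrow> 'w \<Rightarrow> real) \<Rightarrow> real \<Rightarrow> real \<Rightarrow> 'w \<Rightarrow> real" where
  "workload X x t \<omega> = X t \<omega> + max x (SUP s\<in>{0..t}. - X s \<omega>)"

text \<open>The path properties above, and nonnegativity of exponential random variables, hold only
  almost surely, so the integrand below is determined only up to a null set of \<open>M\<close> and need
  not be \<open>M\<close>-measurable. It is therefore integrated against the completion of \<open>M\<close>, which
  agrees with integration against \<open>M\<close> for every \<open>M\<close>-measurable integrand.\<close>

definition joint_transform ::
  "'w measure \<Rightarrow> (real \<Rightarrow> 'w \<Rightarrow> real) \<Rightarrow> (nat \<Rightarrow> 'w \<Rightarrow> real) \<Rightarrow> nat \<Rightarrow> (nat \<Rightarrow> real) \<Rightarrow> real \<Rightarrow> real" where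
  "joint_transform M X T n \<alpha> x =
     (\<integral>\<omega>. exp (- (\<Sum>i=1..n. \<alpha> i * workload X x (\<Sum>k=1..i. T k \<omega>) \<omega>)) \<partial>completion M)"

definition sign_coeff :: "nat \<Rightarrow> nat \<Rightarrow> real" where
  "sign_coeff n p = (if even (card {k. k < n \<and> bit (p - 1) k}) then 1 else - 1)"

function d_coeff ::
  "(real \<Rightarrow> real) \<Rightarrow> (nat \<Rightarrow> real) \<Rightarrow> (nat \<Rightarrow> real) \<Rightarrow> nat \<Rightarrow> nat \<Rightarrow> nat \<Rightarrow> real" where
  "d_coeff \<psi> q \<alpha> n i p =
     (if n \<le> i then 0
      else if odd \<lceil>real p / 2 ^ i\<rceil> then \<alpha> (Suc i) + d_coeff \<psi> q \<alpha> n (Suc i) p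
      else \<psi> (q (Suc i)))"
  by pat_completeness auto
termination
  by (relation "Wellfounded.measure (\<lambda>(\<psi>, q, \<alpha>, n, i, p). n - i)") auto

declare d_coeff.simps [simp del]

definition L_coeff ::
  "(real \<Rightarrow> real) \<Rightarrow> (real \<Rightarrow> real) \<Rightarrow> (nat \<Rightarrow> real) \<Rightarrow> (nat \<Rightarrow> real) \<Rightarrow> nat \<Rightarrow> nat \<Rightarrow> nat \<Rightarrow> real" where
  "L_coeff \<phi> \<psi> q \<alpha> n p l =
     sign_coeff n p
     * (\<Prod>i=1..n. q i / (q i - \<phi> (\<alpha> i + d_coeff \<psi> q \<alpha> n i p)))
     * (\<Prod>i=l..n. (\<alpha> i + d_coeff \<psi> q \<alpha> n i p) / d_coeff \<psi> q \<alpha> n (i - 1) p)"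

definition transform_formula ::
  "(real \<Rightarrow> real) \<Rightarrow> (real \<Rightarrow> real) \<Rightarrow> (nat \<Rightarrow> real) \<Rightarrow> nat \<Rightarrow> (nat \<Rightarrow> real) \<Rightarrow> real \<Rightarrow> real" where
  "transform_formula \<phi> \<psi> q n \<alpha> x =
     (\<Prod>i=1..n. q i / (q i - \<phi> (\<Sum>k=i..n. \<alpha> k))) * exp (- (\<Sum>k=1..n. \<alpha> k) * x)
     + (\<Sum>l=1..n. \<Sum>j=1..2 ^ (n - l).
          L_coeff \<phi> \<psi> q \<alpha> n (2 ^ l * j - 2 ^ (l - 1) + 1) l
          * exp (- ((\<Sum>k=1..<l. \<alpha> k) + \<psi> (q l)) * x))"

text \<open>The nonnegative parameters at which no denominator occurring in \<open>transform_formula\<close>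
  vanishes. At the remaining nonnegative parameters some quotient is of the form \<open>0 / 0\<close> (for
  instance \<open>\<alpha> n / d\<close> with \<open>d = \<alpha> n = 0\<close>) or there are poles that cancel in the total, and the
  formula is to be read as its continuous extension.\<close>

definition regular_params ::
  "(real \<Rightarrow> real) \<Rightarrow> (real \<Rightarrow> real) \<Rightarrow> (nat \<Rightarrow> real) \<Rightarrow> nat \<Rightarrow> (nat \<Rightarrow> real) set" where
  "regular_params \<phi> \<psi> q n =
     {\<alpha>. (\<forall>i\<in>{1..n}. 0 \<le> \<alpha> i)
       \<and> (\<forall>i\<in>{1..n}. q i - \<phi> (\<Sum>k=i..n. \<alpha> k) \<noteq> 0)
       \<and> (\<forall>l\<in>{1..n}. \<forall>j\<in>{1..2 ^ (n - l)}. let p = 2 ^ l * j - 2 ^ (l - 1) + 1 in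
            (\<forall>i\<in>{1..n}. q i - \<phi> (\<alpha> i + d_coeff \<psi> q \<alpha> n i p) \<noteq> 0)
            \<and> (\<forall>i\<in>{l..n}. d_coeff \<psi> q \<alpha> n (i - 1) p \<noteq> 0))}"

end

theory Submission
  imports Defs "HOL-Real_Asymp.Real_Asymp"
begin

text \<open>Sample the process on the grid of mesh \<open>h = 1 / 2 ^ m\<close> and round the exponential times up to
  the grid. The sampled workload is a reflected random walk (Lindley's recursion) and the rounded
  times are geometric, so the joint transform of the sampled process is an iterated resolvent of
  the one-step Lindley operator.

  One step maps \<open>exp (- a y)\<close> to \<open>exp (h * \<phi> a) * exp (- a y) - b a y\<close>, where \<open>b a y\<close> is the mean of
  \<open>exp (a z) - 1\<close> with \<open>z\<close> the part of the step below zero. Because there are no negative jumps,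
  overshoots \<open>z > \<delta>\<close> have total weight \<open>o(h)\<close>, whence \<open>b a\<close> and \<open>(a / \<psi> q) * b (\<psi> q)\<close> agree up to
  negligible terms. Choosing \<open>a = \<psi> q\<close>, for which the exponential factor cancels the killing,
  identifies the resolvent of \<open>b (\<psi> q)\<close>; hence the resolvent sends \<open>exp (- a y)\<close> to
  \<open>q / (q - \<phi> a) * (exp (- a y) - (a / \<psi> q) * exp (- \<psi> q y))\<close> in the limit, uniformly in \<open>y\<close>.
  Iterating doubles the number of terms at every exponential time, and the binary digits of
  \<open>p - 1\<close> record which of the two terms was chosen.

  The exponential moments of the process are finite because the characteristic function of a step
  differs from 1 by \<open>O(h)\<close>, while \<open>exp (- a y) - 1\<close>, cut off below \<open>-1\<close>, is at most
  \<open>A * (1 - cos y) - a * sin y\<close>.\<close>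

section \<open>Paths without negative jumps\<close>

text \<open>The order 2 ^ (-m) decides everything: the resolvent at mesh \<open>1 / 2 ^ m\<close>
  divides by a quantity of that order, so errors must be o(h), not merely small. The o(h) weight of
  deep undershoots comes from path regularity: almost surely all \<open>2 ^ m\<close> increments
  over [0, 1] are eventually at least -\<delta>, so the probability (1 - p) ^ (2 ^ m) that none
  falls below -\<delta> tends to 1, which forces 2 ^ m * p to 0. A second-moment estimate upgrades p
  to the exponentially weighted tail. Rounding times up, not down, lets right-continuity alone carry
  the sampled workload to the continuous one. Uniformity in y survives iteration because resolvents
  are sup-norm contractions. No sign condition on q - \<phi> a enters, since all transforms stay
  bounded by 1, so no analytic continuation is needed. At parameters where a denominator vanishes,
  the joint transform is still continuous, and regular parameters accumulate along the diagonal
  through \<alpha>; this gives the continuous extension.\<close>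

text \<open>Feeds both compactness arguments below, with tolerance 1 for boundedness and
  \<open>\<delta> / 2\<close> for increments. At u = 0 there is no left limit: \<open>l\<close> is
  then arbitrary and the range 0 \<le> s < u is empty.\<close>

lemma one_sided_limits_oscillation:
  fixes f :: "real \<Rightarrow> real"
  assumes right: "(f \<longlongrightarrow> f u) (at_right u)" and left: "0 < u \<Longrightarrow> (f \<longlongrightarrow> l) (at_left u)"
    and u: "0 \<le> u" and \<eta>: "0 < \<eta>"
  shows "\<exists>e>0. (\<forall>s\<in>ball u e. u \<le> s \<longrightarrow> \<bar>f s - f u\<bar> < \<eta>)
    \<and> (\<forall>s\<in>ball u e. 0 \<le> s \<longrightarrow> s < u \<longrightarrow> \<bar>f s - l\<bar> < \<eta>)"
proof -
  have "eventually (\<lambda>s. dist (f s) (f u) < \<eta>) (at_right u)" by (rule tendstoD[OF right \<eta>])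
  then obtain c where c: "c > u" "\<And>s. u < s \<Longrightarrow> s < c \<Longrightarrow> dist (f s) (f u) < \<eta>"
    by (auto simp: eventually_at_right_field)
  have "\<exists>c'<u. \<forall>s. c' < s \<longrightarrow> s < u \<longrightarrow> 0 \<le> s \<longrightarrow> dist (f s) l < \<eta>"
  proof (cases "u = 0")
    case True then show ?thesis by (intro exI[of _ "-1"]) auto
  next
    case False
    then have "eventually (\<lambda>s. dist (f s) l < \<eta>) (at_left u)" using u by (intro tendstoD[OF left \<eta>]) simp
    then show ?thesis by (auto simp: eventually_at_left_field)
  qed
  then obtain c' where c': "c' < u" "\<And>s. c' < s \<Longrightarrow> s < u \<Longrightarrow> 0 \<le> s \<Longrightarrow> dist (f s) l < \<eta>" by auto
  have "\<bar>f s - f u\<bar> < \<eta>" if "u \<le> s" "s \<in> ball u (min (c - u) (u - c'))" for s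
    using c(2)[of s] that \<eta> by (cases "s = u") (auto simp: dist_real_def)
  moreover have "\<bar>f s - l\<bar> < \<eta>" if "0 \<le> s" "s < u" "s \<in> ball u (min (c - u) (u - c'))" for s
    using c'(2)[of s] that by (auto simp: dist_real_def)
  moreover have "0 < min (c - u) (u - c')" using c c' by simp
  ultimately show ?thesis by blast
qed

text \<open>Each point has a neighbourhood in which f stays near two values, and finitely many of
  these cover the interval. Boundedness is what makes the \<open>SUP\<close> in
  \<open>workload\<close> a true supremum.\<close>

lemma cadlag_bounded_on_interval:
  fixes f :: "real \<Rightarrow> real"
  assumes right: "\<And>t. t \<ge> 0 \<Longrightarrow> (f \<longlongrightarrow> f t) (at_right t)"
    and left: "\<And>t. t > 0 \<Longrightarrow> \<exists>l. (f \<longlongrightarrow> l) (at_left t)"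
  shows "bounded (f ` {0..b})"
proof -
  have loc: "\<exists>e>0. bounded (f ` ({0..b} \<inter> ball u e))" if u: "u \<in> {0..b}" for u
  proof -
    have u0: "0 \<le> u" using u by simp
    obtain l where l: "0 < u \<Longrightarrow> (f \<longlongrightarrow> l) (at_left u)" using left[of u] by blast
    obtain e where e: "0 < e" "\<forall>s\<in>ball u e. u \<le> s \<longrightarrow> \<bar>f s - f u\<bar> < 1"
        "\<forall>s\<in>ball u e. 0 \<le> s \<longrightarrow> s < u \<longrightarrow> \<bar>f s - l\<bar> < 1"
      using one_sided_limits_oscillation[OF right[OF u0] l u0 zero_less_one] by blast
    have "f s \<in> ball (f u) 1 \<union> ball l 1" if "s \<in> {0..b} \<inter> ball u e" for s
    proof (cases "u \<le> s")
      case True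
      then have "\<bar>f s - f u\<bar> < 1" using e(2) that by blast
      then show ?thesis by (simp add: dist_real_def abs_minus_commute)
    next
      case False
      then have "\<bar>f s - l\<bar> < 1" using e(3) that by (simp add: not_le)
      then show ?thesis by (simp add: dist_real_def abs_minus_commute)
    qed
    then have "f ` ({0..b} \<inter> ball u e) \<subseteq> ball (f u) 1 \<union> ball l 1" by (rule image_subsetI)
    then have "bounded (f ` ({0..b} \<inter> ball u e))" by (rule bounded_subset[rotated]) simp
    then show ?thesis using e(1) by blast
  qed
  then obtain e where e: "\<And>u. u \<in> {0..b} \<Longrightarrow> e u > 0"
    "\<And>u. u \<in> {0..b} \<Longrightarrow> bounded (f ` ({0..b} \<inter> ball u (e u)))"
    by metis
  obtain D where D: "D \<subseteq> {0..b}" "finite D" "{0..b} \<subseteq> (\<Union>u\<in>D. ball u (e u))"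
  proof (rule compactE_image[of "{0..b}" "{0..b}" "\<lambda>u. ball u (e u)"])
    show "{0..b} \<subseteq> (\<Union>u\<in>{0..b}. ball u (e u))" using e(1) by force
  qed auto
  have "bounded (\<Union>u\<in>D. f ` ({0..b} \<inter> ball u (e u)))"
    using D e by (intro bounded_UN) auto
  then show ?thesis
    by (rule bounded_subset) (use D in blast)
qed

text \<open>Crossing u from left to right moves f from near l to near f u, and l \<le> f u, so only
  upward moves can be large: a one-sided uniform continuity. A Lebesgue number of the cover makes e
  independent of the point.\<close>

lemma no_negative_jumps_increment_bound:
  fixes f :: "real \<Rightarrow> real"
  assumes right: "\<And>t. t \<ge> 0 \<Longrightarrow> (f \<longlongrightarrow> f t) (at_right t)"
    and left: "\<And>t. t > 0 \<Longrightarrow> \<exists>l\<le>f t. (f \<longlongrightarrow> l) (at_left t)"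
    and \<delta>: "\<delta> > 0"
  obtains e where "e > 0"
    "\<And>s t. 0 \<le> s \<Longrightarrow> s \<le> t \<Longrightarrow> t \<le> b \<Longrightarrow> t - s < e \<Longrightarrow> f t - f s \<ge> - \<delta>"
proof -
  have loc: "\<exists>e>0. \<forall>s t. s \<in> {0..b} \<inter> ball u e \<longrightarrow> t \<in> ball u e \<longrightarrow> s \<le> t \<longrightarrow> f t - f s \<ge> - \<delta>"
    if u: "u \<in> {0..b}" for u
  proof -
    have u0: "0 \<le> u" using u by simp
    have "\<exists>l\<le>f u. 0 < u \<longrightarrow> (f \<longlongrightarrow> l) (at_left u)"
      using left[of u] by (cases "0 < u") auto
    then obtain l where l: "l \<le> f u" "0 < u \<Longrightarrow> (f \<longlongrightarrow> l) (at_left u)" by blast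
    obtain e where e: "0 < e" and R: "\<forall>s\<in>ball u e. u \<le> s \<longrightarrow> \<bar>f s - f u\<bar> < \<delta> / 2"
        and L: "\<forall>s\<in>ball u e. 0 \<le> s \<longrightarrow> s < u \<longrightarrow> \<bar>f s - l\<bar> < \<delta> / 2"
      using one_sided_limits_oscillation[OF right[OF u0] l(2) u0 half_gt_zero[OF \<delta>]] by blast
    have "f t - f s \<ge> - \<delta>" if s: "s \<in> {0..b} \<inter> ball u e" and t: "t \<in> ball u e" and st: "s \<le> t" for s t
    proof -
      consider "s \<ge> u" | "t < u" | "s < u" "t \<ge> u" by linarith
      then show ?thesis
      proof cases
        case 1
        then have "\<bar>f s - f u\<bar> < \<delta>/2" "\<bar>f t - f u\<bar> < \<delta>/2" using R s t st by auto
        then show ?thesis unfolding abs_less_iff by linarith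
      next
        case 2
        then have "\<bar>f s - l\<bar> < \<delta>/2" "\<bar>f t - l\<bar> < \<delta>/2" using L s t st by auto
        then show ?thesis unfolding abs_less_iff by linarith
      next
        case 3
        then have "\<bar>f s - l\<bar> < \<delta>/2" "\<bar>f t - f u\<bar> < \<delta>/2" using L R s t st by auto
        then show ?thesis using l(1) unfolding abs_less_iff by linarith
      qed
    qed
    then show ?thesis using e by blast
  qed
  then obtain e where e: "\<And>u. u \<in> {0..b} \<Longrightarrow> e u > 0"
    "\<And>u s t. u \<in> {0..b} \<Longrightarrow> s \<in> {0..b} \<inter> ball u (e u) \<Longrightarrow> t \<in> ball u (e u) \<Longrightarrow> s \<le> t \<Longrightarrow> f t - f s \<ge> - \<delta>"
    by metis
  obtain d where d: "d > 0" "\<And>x. x \<in> {0..b} \<Longrightarrow> \<exists>G\<in>(\<lambda>u. ball u (e u)) ` {0..b}. ball x d \<subseteq> G"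
  proof (rule Heine_Borel_lemma[of "{0..b}" "(\<lambda>u. ball u (e u)) ` {0..b}"])
    show "{0..b} \<subseteq> \<Union>((\<lambda>u. ball u (e u)) ` {0..b})" using e(1) by force
  qed auto
  show thesis
  proof (rule that[OF d(1)])
    fix s t assume st: "0 \<le> s" "s \<le> t" "t \<le> b" "t - s < d"
    then obtain u where "u \<in> {0..b}" "ball s d \<subseteq> ball u (e u)" using d(2)[of s] by auto
    moreover have "s \<in> ball s d" "t \<in> ball s d" using st d(1) by (auto simp: dist_real_def)
    ultimately have "u \<in> {0..b}" "s \<in> ball u (e u)" "t \<in> ball u (e u)" by blast+
    then show "f t - f s \<ge> - \<delta>" by (intro e(2)[of u s t]) (use st in auto)
  qed
qed

text \<open>Since \<open>j m\<close> rounds t up, right-continuity alone gives the limit of f. For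
  the running maximum, a near-optimal s is itself rounded up to the grid; conversely, grid points
  beyond t lie so close to t that f is almost f t there.\<close>

lemma workload_grid_approximation:
  fixes f :: "real \<Rightarrow> real" and j :: "nat \<Rightarrow> nat"
  assumes right: "\<And>t. t \<ge> 0 \<Longrightarrow> (f \<longlongrightarrow> f t) (at_right t)"
    and bdd: "bounded (f ` {0..t})" and t: "t \<ge> 0"
    and j_ge: "\<And>m. t \<le> real (j m) / 2 ^ m" and j_lim: "(\<lambda>m. real (j m) / 2 ^ m) \<longlonglongrightarrow> t"
  shows "(\<lambda>m. f (real (j m) / 2 ^ m) + max x (MAX i\<in>{..j m}. - f (real i / 2 ^ m)))
           \<longlonglongrightarrow> f t + max x (SUP s\<in>{0..t}. - f s)"
proof -
  define Z where "Z = (SUP s\<in>{0..t}. - f s)"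
  obtain B where "\<forall>y\<in>f ` {0..t}. norm y \<le> B"
    using bdd bounded_iff by blast
  then have ba: "bdd_above ((\<lambda>s. - f s) ` {0..t})"
    by (intro bdd_aboveI2[of _ _ B]) force
  have Zup: "- f s \<le> Z" if "0 \<le> s" "s \<le> t" for s
    unfolding Z_def by (rule cSUP_upper[OF _ ba]) (use that in auto)
  have from_right: "(\<lambda>m. f (a m)) \<longlonglongrightarrow> f s" if "s \<ge> 0" "\<And>m. s \<le> a m" "a \<longlonglongrightarrow> s" for s and a :: "nat \<Rightarrow> real"
  proof (rule LIMSEQ_I)
    fix e :: real assume "e > 0"
    then have "eventually (\<lambda>u. dist (f u) (f s) < e) (at_right s)"
      using right[OF that(1)] by (auto simp: tendsto_iff)
    then obtain c where c: "c > s" "\<And>u. s < u \<Longrightarrow> u < c \<Longrightarrow> dist (f u) (f s) < e"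
      by (auto simp: eventually_at_right_field)
    have "eventually (\<lambda>m. a m < c) sequentially" by (rule order_tendstoD(2)[OF that(3) c(1)])
    then have "eventually (\<lambda>m. norm (f (a m) - f s) < e) sequentially"
    proof eventually_elim
      case (elim m)
      then show ?case using c(2)[of "a m"] that(2)[of m] \<open>e > 0\<close>
        by (cases "a m = s") (auto simp: dist_norm)
    qed
    then show "\<exists>no. \<forall>n\<ge>no. norm (f (a n) - f s) < e" by (simp add: eventually_sequentially)
  qed
  have flim: "(\<lambda>m. f (real (j m) / 2 ^ m)) \<longlonglongrightarrow> f t"
    by (rule from_right[OF t j_ge j_lim])
  have maxlim: "(\<lambda>m. MAX i\<in>{..j m}. - f (real i / 2 ^ m)) \<longlonglongrightarrow> Z"
  proof (rule order_tendstoI)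
    fix y assume "y < Z"
    then obtain s where s: "0 \<le> s" "s \<le> t" "y < - f s"
      using less_cSUP_iff[of "{0..t}" "\<lambda>s. - f s" y] ba t by (auto simp: Z_def)
    define a where "a m = real (nat \<lceil>s * 2 ^ m\<rceil>) / 2 ^ m" for m :: nat
    have rn: "real (nat \<lceil>s * 2 ^ m\<rceil>) = of_int \<lceil>s * 2 ^ m\<rceil>" for m :: nat
      using s(1) by simp
    have a1: "s \<le> a m" for m
      unfolding a_def rn by (simp add: pos_le_divide_eq)
    have a2: "a m \<le> s + 1 / 2 ^ m" for m
    proof -
      have "of_int \<lceil>s * 2 ^ m\<rceil> \<le> s * 2 ^ m + 1" by linarith
      then show ?thesis unfolding a_def rn by (simp add: field_simps)
    qed
    have "a \<longlonglongrightarrow> s"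
    proof (rule tendsto_sandwich[of "\<lambda>_. s" _ _ "\<lambda>m. s + 1 / 2 ^ m"])
      show "(\<lambda>m. s + 1 / 2 ^ m) \<longlonglongrightarrow> s" by real_asymp
    qed (use a1 a2 in auto)
    from from_right[OF s(1) a1 this] have "(\<lambda>m. - f (a m)) \<longlonglongrightarrow> - f s" by (rule tendsto_minus)
    from order_tendstoD(1)[OF this s(3)]
    show "eventually (\<lambda>m. y < (MAX i\<in>{..j m}. - f (real i / 2 ^ m))) sequentially"
    proof eventually_elim
      case (elim m)
      \<comment> \<open>The rounded-up s stays among the indices up to \<open>j m\<close>, because s
        \<le> t and t is rounded up too.\<close>
      have "s * 2 ^ m \<le> t * 2 ^ m" using s(2) by (intro mult_right_mono) auto
      also have "\<dots> \<le> real (j m)" using j_ge[of m] by (simp add: pos_le_divide_eq)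
      finally have "nat \<lceil>s * 2 ^ m\<rceil> \<le> j m" by linarith
      then have "- f (a m) \<le> (MAX i\<in>{..j m}. - f (real i / 2 ^ m))"
        unfolding a_def by (intro Max_ge) auto
      then show ?case using elim by linarith
    qed
  next
    fix y assume y: "Z < y"
    define e where "e = y - Z"
    have "e > 0" using y by (simp add: e_def)
    then have "eventually (\<lambda>u. dist (f u) (f t) < e) (at_right t)"
      using right[OF t] by (auto simp: tendsto_iff)
    then obtain c where c: "c > t" "\<And>u. t < u \<Longrightarrow> u < c \<Longrightarrow> dist (f u) (f t) < e"
      by (auto simp: eventually_at_right_field)
    have "eventually (\<lambda>m. real (j m) / 2 ^ m < c) sequentially" by (rule order_tendstoD(2)[OF j_lim c(1)])
    then show "eventually (\<lambda>m. (MAX i\<in>{..j m}. - f (real i / 2 ^ m)) < y) sequentially"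
    proof eventually_elim
      case (elim m)
      have "- f (real i / 2 ^ m) < y" if i: "i \<le> j m" for i
      proof (cases "real i / 2 ^ m \<le> t")
        case True
        then show ?thesis using Zup[of "real i / 2 ^ m"] y by auto
      next
        case False
        have "real i / 2 ^ m \<le> real (j m) / 2 ^ m" using i by (simp add: divide_right_mono)
        then have "dist (f (real i / 2 ^ m)) (f t) < e" using c(2)[of "real i / 2 ^ m"] False elim by auto
        then show ?thesis using Zup[of t] t by (auto simp: dist_real_def e_def)
      qed
      then show ?case by (subst Max_less_iff) auto
    qed
  qed
  show ?thesis unfolding Z_def[symmetric]
    by (intro tendsto_add flim tendsto_max maxlim tendsto_const)
qed

section \<open>Lindley's recursion for the sampled workload\<close>

text \<open>Steps are consumed from the front so that integrating out the first one produces
  \<open>lindley_operator\<close>. Clamping is postponed: \<open>max 0 x + \<xi> 0\<close> may be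
  negative and is reflected by the next call.\<close>

fun lindley_walk :: "real \<Rightarrow> (nat \<Rightarrow> real) \<Rightarrow> nat \<Rightarrow> real" where
  "lindley_walk x \<xi> 0 = max 0 x"
| "lindley_walk x \<xi> (Suc k) = lindley_walk (max 0 x + \<xi> 0) (\<lambda>i. \<xi> (Suc i)) k"

lemma lindley_walk_nonneg: "0 \<le> lindley_walk x \<xi> k"
  by (induction k arbitrary: x \<xi>) auto

lemma lindley_walk_Suc': "lindley_walk x \<xi> (Suc k) = max 0 (lindley_walk x \<xi> k + \<xi> k)"
proof (induction k arbitrary: x \<xi>)
  case (Suc k)
  show ?case
    by (subst (1 2) lindley_walk.simps(2)) (rule Suc)
qed simp

text \<open>Discrete Skorokhod reflection: the right-hand side is \<open>workload\<close> for a path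
  seen only at grid points.\<close>

lemma lindley_walk_increments:
  assumes "S 0 = 0" "x \<ge> 0"
  shows "lindley_walk x (\<lambda>k. S (Suc k) - S k) k = S k + max x (MAX i\<in>{..k}. - S i)"
proof (induction k)
  case 0 then show ?case using assms by simp
next
  case (Suc k)
  have "(MAX i\<in>{..Suc k}. - S i) = max (- S (Suc k)) (MAX i\<in>{..k}. - S i)"
    by (simp add: atMost_Suc)
  then show ?case unfolding lindley_walk_Suc' Suc by (auto simp: max_def)
qed

section \<open>Exponential moments of the increments\<close>

lemma norm_exp_minus_one_le:
  fixes z :: complex
  shows "cmod (exp z - 1) \<le> cmod z * exp (cmod z)"
proof -
  have "cmod (exp z - exp 0) \<le> exp (cmod z) * cmod (z - 0)"
  proof (rule field_differentiable_bound[of "cball 0 (cmod z)" exp exp])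
    show "cmod (exp w) \<le> exp (cmod z)" if "w \<in> cball 0 (cmod z)" for w
      using that norm_exp[of w] by (simp add: order_trans)
  qed (auto intro!: derivative_eq_intros)
  then show ?thesis by (simp add: mult.commute)
qed

text \<open>Once w is near 1, every \<open>w (Suc m)\<close> has positive real part, so doubling its
  principal argument does not leave the branch and \<open>Ln\<close> halves exactly from one index
  to the next. Thus w is exp (L / 2 ^ j) for a fixed L, at distance of order 2 ^ (-m) from 1.
  Applied to characteristic functions, this replaces the existence of a characteristic
  exponent.\<close>

lemma dyadic_square_roots_bound:
  fixes w :: "nat \<Rightarrow> complex"
  assumes sq: "\<And>m. w m = (w (Suc m))\<^sup>2" and lim: "w \<longlonglongrightarrow> 1"
  shows "\<exists>C. eventually (\<lambda>m. 2 ^ m * cmod (1 - w m) \<le> C) sequentially"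
proof -
  have "eventually (\<lambda>m. dist (w m) 1 < 1/2) sequentially"
    by (rule tendstoD[OF lim]) simp
  then obtain m0 where m0: "\<And>m. m \<ge> m0 \<Longrightarrow> dist (w m) 1 < 1/2"
    by (auto simp: eventually_sequentially)
  have pos: "Re (w m) > 0" if "m \<ge> m0" for m
  proof -
    have "\<bar>Re (w m - 1)\<bar> < 1/2" using m0[OF that] abs_Re_le_cmod[of "w m - 1"]
      by (simp add: dist_norm)
    then show ?thesis by (simp add: abs_if split: if_splits)
  qed
  have Ln_double: "Ln (w m) = 2 * Ln (w (Suc m))" if "m \<ge> m0" for m
  proof (rule Ln_unique)
    have p: "Re (w (Suc m)) > 0" using that by (intro pos) auto
    then have "w (Suc m) \<noteq> 0" by auto
    then show "exp (2 * Ln (w (Suc m))) = w m"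
      by (simp add: exp_double sq[of m])
    show "- pi < Im (2 * Ln (w (Suc m)))" "Im (2 * Ln (w (Suc m))) \<le> pi"
      using Re_Ln_pos_lt_imp[OF p] by (auto simp: abs_if split: if_splits)
  qed
  define L where "L = Ln (w m0)"
  have Ln_pow: "Ln (w (m0 + j)) = L / 2 ^ j" for j
  proof (induction j)
    case (Suc j)
    then show ?case using Ln_double[of "m0 + j"] by (simp add: field_simps)
  qed (simp add: L_def)
  have "2 ^ m * cmod (1 - w m) \<le> 2 ^ m0 * cmod L * exp (cmod L)" if m: "m \<ge> m0" for m
  proof -
    obtain j where j: "m = m0 + j" using m le_Suc_ex by blast
    have "w m \<noteq> 0" using pos[OF m] by auto
    then have w: "w m = exp (L / 2 ^ j)" using Ln_pow[of j] j by (metis exp_Ln)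
    have nj: "cmod (L / 2 ^ j) = cmod L / 2 ^ j" by (simp add: norm_divide norm_power)
    have "cmod (1 - w m) \<le> cmod L / 2 ^ j * exp (cmod L / 2 ^ j)"
      using norm_exp_minus_one_le[of "L / 2 ^ j"] by (simp add: w nj norm_minus_commute)
    also have "\<dots> \<le> cmod L / 2 ^ j * exp (cmod L)"
      by (intro mult_left_mono) (auto simp: divide_le_eq mult_le_cancel_left1 intro: order_trans[OF _ one_le_power])
    finally have "2 ^ m * cmod (1 - w m) \<le> 2 ^ m * (cmod L / 2 ^ j * exp (cmod L))"
      by (intro mult_left_mono) auto
    then show ?thesis by (simp add: j power_add)
  qed
  then show ?thesis by (auto simp: eventually_sequentially)
qed

lemma one_minus_cos_ge:
  fixes y :: real
  assumes "\<bar>y\<bar> \<le> 1"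
  shows "1 - cos y \<ge> y\<^sup>2 / 4"
proof -
  have *: "1 - cos y \<ge> y\<^sup>2 / 4" if "0 \<le> y" "y \<le> 1" for y :: real
  proof -
    have "sin x \<ge> x / 2" if "0 \<le> x" "x \<le> 1" for x :: real
    proof -
      have "(\<lambda>x. sin x - x / 2) 0 \<le> (\<lambda>x. sin x - x / 2) x"
      proof (rule DERIV_nonneg_imp_nondecreasing[OF that(1)])
        fix u assume u: "0 \<le> u" "u \<le> x"
        \<comment> \<open>Here u \<le> 1 < pi / 3, where the cosine is 1 / 2; integrating twice
          produces the constant 1 / 4.\<close>
        have "cos u \<ge> cos (pi/3)"
          using u that pi_gt3 by (intro cos_monotone_0_pi_le) auto
        then have "cos u - 1/2 \<ge> 0" by (simp add: cos_60)
        moreover have "((\<lambda>x. sin x - x / 2) has_real_derivative (cos u - 1/2)) (at u)"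
          by (auto intro!: derivative_eq_intros)
        ultimately show "\<exists>y. ((\<lambda>x. sin x - x / 2) has_real_derivative y) (at u) \<and> 0 \<le> y" by blast
      qed
      then show ?thesis by simp
    qed
    note s = this
    have "(\<lambda>x. 1 - cos x - x\<^sup>2 / 4) 0 \<le> (\<lambda>x. 1 - cos x - x\<^sup>2 / 4) y"
    proof (rule DERIV_nonneg_imp_nondecreasing[OF that(1)])
      fix u assume u: "0 \<le> u" "u \<le> y"
      have "((\<lambda>x. 1 - cos x - x\<^sup>2 / 4) has_real_derivative (sin u - u / 2)) (at u)"
        by (auto intro!: derivative_eq_intros)
      then show "\<exists>y. ((\<lambda>x. 1 - cos x - x\<^sup>2 / 4) has_real_derivative y) (at u) \<and> 0 \<le> y"
        using s[of u] u that by (intro exI[of _ "sin u - u / 2"]) auto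
    qed
    then show ?thesis by simp
  qed
  show ?thesis using *[of "\<bar>y\<bar>"] assms by simp
qed

lemma exp_taylor_bound:
  fixes z :: real
  shows "\<bar>exp z - 1 - z\<bar> \<le> z\<^sup>2 * exp \<bar>z\<bar>"
proof (cases "z = 0")
  case False
  obtain t where t: "\<bar>t\<bar> \<le> \<bar>z\<bar>"
    "exp z = (\<Sum>m<2. (z ^ m / fact m)) + (exp t / fact 2) * z ^ 2"
    using Maclaurin_exp_le[of z 2] by auto
  have "\<bar>exp z - 1 - z\<bar> = exp t / 2 * z\<^sup>2"
    using t(2) by (simp add: numeral_2_eq_2)
  also have "\<dots> \<le> exp \<bar>z\<bar> * z\<^sup>2"
    proof (intro mult_right_mono)
    have "exp t \<le> exp \<bar>z\<bar>" using t(1) by simp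
    then show "exp t / 2 \<le> exp \<bar>z\<bar>" using exp_gt_zero[of t] by linarith
  qed simp
  finally show ?thesis by (simp add: mult.commute)
qed auto

lemma sin_taylor_bound:
  fixes y :: real
  shows "\<bar>sin y - y\<bar> \<le> y\<^sup>2"
proof -
  obtain t where "sin y = (\<Sum>m<2. sin_coeff m * y ^ m) + (sin (t + 1/2 * real 2 * pi) / fact 2) * y ^ 2"
    using Maclaurin_sin_expansion[of y 2] by auto
  then have "\<bar>sin y - y\<bar> = \<bar>sin (t + pi)\<bar> / 2 * y\<^sup>2"
    by (simp add: numeral_2_eq_2 sin_coeff_def abs_mult)
  also have "\<dots> \<le> 1 * y\<^sup>2"
    by (intro mult_right_mono) (simp_all add: order_trans[OF abs_sin_le_one])
  finally show ?thesis by simp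
qed

text \<open>The right-hand side is built from the real and imaginary parts of exp (i y), so its mean
  is controlled by the characteristic function at 1. Near 0 the linear terms - a y and - a sin y
  cancel and 1 - cos y beats the quadratic remainder; away from 0 the left-hand side is negative,
  which for y < -1 is the effect of the truncation.\<close>

lemma truncated_exp_le_trigonometric:
  fixes a :: real
  assumes a: "a \<ge> 0"
  shows "\<exists>A\<ge>0. \<forall>y. (if y \<ge> - 1 then exp (- a * y) else 0) - 1 \<le> A * (1 - cos y) - a * sin y"
proof (cases "a = 0")
  case True
  then show ?thesis by (intro exI[of _ 0]) auto
next
  case False
  then have a: "a > 0" using a by simp
  define \<kappa> where "\<kappa> = 1 - exp (- a)"
  have \<kappa>: "0 < \<kappa>" "\<kappa> \<le> 1" using a by (auto simp: \<kappa>_def)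
  \<comment> \<open>The first entry is the least coefficient for which completing the square in sin
    (y/2) and cos (y/2) yields \<open>far\<close>. The second dominates the Taylor remainders of exp
    and sin on [-1, 1], its factor 4 compensating 1 - cos y \<ge> y^2 / 4.\<close>
  define A where "A = max (a\<^sup>2 / (2 * \<kappa>)) (4 * (a\<^sup>2 * exp a + a))"
  have A0: "A \<ge> 0" unfolding A_def using \<kappa> by (intro max.coboundedI1) simp
  \<comment> \<open>The right-hand side is periodic, so the bound is proved for all y at once; for
    \<bar>y\<bar> > 1 the left-hand side is at most -\<kappa>.\<close>
  have far: "- \<kappa> \<le> A * (1 - cos y) - a * sin y" for y
  proof -
    define s c where "s = sin (y/2)" and "c = cos (y/2)"
    have "sin y = 2 * s * c" using sin_double[of "y/2"] by (simp add: s_def c_def)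
    moreover have "1 - cos y = 2 * s\<^sup>2" using cos_double_sin[of "y/2"] by (simp add: s_def)
    moreover have "A * (2 * s\<^sup>2) \<ge> a\<^sup>2 / (2 * \<kappa>) * (2 * s\<^sup>2)"
      by (intro mult_right_mono) (auto simp: A_def)
    moreover have "a\<^sup>2 / (2 * \<kappa>) * (2 * s\<^sup>2) - a * (2 * s * c) + \<kappa> = (a * s - \<kappa> * c)\<^sup>2 / \<kappa> + \<kappa> * (1 - c\<^sup>2)"
      using \<kappa> by (simp add: field_simps power2_eq_square)
    moreover have "(a * s - \<kappa> * c)\<^sup>2 / \<kappa> + \<kappa> * (1 - c\<^sup>2) \<ge> 0"
      using \<kappa> by (intro add_nonneg_nonneg mult_nonneg_nonneg divide_nonneg_pos)
        (auto simp: c_def abs_square_le_1)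
    ultimately show ?thesis by (simp add: mult.assoc)
  qed
  have "(if y \<ge> - 1 then exp (- a * y) else 0) - 1 \<le> A * (1 - cos y) - a * sin y" for y
  proof -
    consider "y < -1" | "y > 1" | "\<bar>y\<bar> \<le> 1" by linarith
    then show ?thesis
    proof cases
      case 1 then show ?thesis using far[of y] \<kappa> by simp
    next
      case 2
      then have "exp (- a * y) \<le> exp (- a)" using a by simp
      moreover have "(if y \<ge> - 1 then exp (- a * y) else 0) = exp (- a * y)" using 2 by simp
      ultimately show ?thesis using far[of y] unfolding \<kappa>_def by linarith
    next
      case 3
      have 1: "exp (- a * y) - 1 + a * y \<le> (a * y)\<^sup>2 * exp \<bar>a * y\<bar>"
        using exp_taylor_bound[of "- a * y"] by simp
      have "exp \<bar>a * y\<bar> \<le> exp a"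
        using 3 a by (simp add: abs_mult mult_left_le)
      then have 2: "(a * y)\<^sup>2 * exp \<bar>a * y\<bar> \<le> (a * y)\<^sup>2 * exp a" by (intro mult_left_mono) auto
      have "a * (sin y - y) \<le> a * y\<^sup>2" using sin_taylor_bound[of y] a by (intro mult_left_mono) auto
      then have "a * sin y - a * y \<le> a * y\<^sup>2" by (simp add: algebra_simps)
      moreover have "A * (1 - cos y) \<ge> 4 * (a\<^sup>2 * exp a + a) * (y\<^sup>2 / 4)"
        using one_minus_cos_ge[OF 3] a A0 by (intro mult_mono) (auto simp: A_def)
      ultimately show ?thesis using 1 2 3 by (simp add: algebra_simps power_mult_distrib abs_le_iff)
    qed
  qed
  then show ?thesis using A0 by blast
qed

section \<open>Increments over the dyadic grid and their common law\<close>

context levy_process begin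

definition increment :: "nat \<Rightarrow> nat \<Rightarrow> 'w \<Rightarrow> real" where
  "increment m k \<omega> = X (real (Suc k) / 2 ^ m) \<omega> - X (real k / 2 ^ m) \<omega>"

definition step_law :: "nat \<Rightarrow> real measure" where
  "step_law m = distr M borel (X (1 / 2 ^ m))"

lemma measurable_increment [measurable]: "increment m k \<in> borel_measurable M"
  unfolding increment_def[abs_def]
  by (intro borel_measurable_diff measurable_process) auto

lemma sets_step_law [simp, measurable_cong]: "sets (step_law m) = sets borel"
  by (simp add: step_law_def)

lemma space_step_law [simp]: "space (step_law m) = UNIV"
  by (simp add: step_law_def)

lemma prob_space_step_law: "prob_space (step_law m)"
  unfolding step_law_def by (intro prob_space_distr measurable_process) auto

lemma distr_increment: "distr M borel (increment m k) = step_law m"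
proof -
  have "real (Suc k) / 2 ^ m = real k / 2 ^ m + 1 / 2 ^ m" by (simp add: add_divide_distrib)
  then show ?thesis
    unfolding increment_def[abs_def] step_law_def
    using stationary_increments[of "real k / 2 ^ m" "1 / 2 ^ m"] by simp
qed

lemma indep_vars_increment_finite: "indep_vars (\<lambda>_. borel) (increment m) {..<K}"
  unfolding increment_def[abs_def]
  by (rule independent_increments[of "\<lambda>k. real k / 2 ^ m" K]) (auto intro: divide_right_mono)

text \<open>Independence of a family concerns finite subfamilies only, and each of these lies in an
  initial segment.\<close>

lemma indep_vars_increment: "indep_vars (\<lambda>_. borel) (increment m) UNIV"
  unfolding indep_vars_def2
proof (intro conjI)
  show "indep_sets (\<lambda>i. {increment m i -` A \<inter> space M |A. A \<in> sets borel}) UNIV"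
  proof (subst indep_sets_finite_index_sets, intro allI impI)
    fix J :: "nat set" assume "finite J"
    then obtain K where "J \<subseteq> {..<K}" using finite_nat_iff_bounded by auto
    then have "indep_vars (\<lambda>_. borel) (increment m) J"
      by (rule indep_vars_subset[OF indep_vars_increment_finite])
    then show "indep_sets (\<lambda>i. {increment m i -` A \<inter> space M |A. A \<in> sets borel}) J"
      by (simp add: indep_vars_def2)
  qed
qed auto

lemma AE_sum_increment: "AE \<omega> in M. \<forall>K. X (real K / 2 ^ m) \<omega> = (\<Sum>k<K. increment m k \<omega>)"
  using start_zero
proof eventually_elim
  case (elim \<omega>)
  have "(\<Sum>k<K. increment m k \<omega>) = X (real K / 2 ^ m) \<omega> - X (real 0 / 2 ^ m) \<omega>" for K
    unfolding increment_def by (rule sum_lessThan_telescope)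
  then show ?case using elim by simp
qed

lemma nn_integral_prod_increment:
  assumes [measurable]: "f \<in> borel_measurable borel"
  shows "(\<integral>\<^sup>+\<omega>. (\<Prod>k<K. f (increment m k \<omega>)) \<partial>M) = (\<integral>\<^sup>+y. f y \<partial>step_law m) ^ K"
proof -
  have "indep_vars (\<lambda>_. borel) (\<lambda>k \<omega>. f (increment m k \<omega>)) {..<K}"
    by (rule indep_vars_compose2[OF indep_vars_increment_finite]) auto
  then have "(\<integral>\<^sup>+\<omega>. (\<Prod>k<K. f (increment m k \<omega>)) \<partial>M) = (\<Prod>k<K. \<integral>\<^sup>+\<omega>. f (increment m k \<omega>) \<partial>M)"
    by (intro indep_vars_nn_integral) auto
  also have "\<dots> = (\<Prod>k<K. \<integral>\<^sup>+y. f y \<partial>distr M borel (increment m k))"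
    by (intro prod.cong) (auto simp: nn_integral_distr)
  finally show ?thesis by (simp add: distr_increment)
qed

text \<open>A step is the sum of two independent steps of half the length. The identity is almost
  sure because X starts at 0 only almost surely.\<close>

lemma char_step_law_Suc: "char (step_law m) 1 = (char (step_law (Suc m)) 1)\<^sup>2"
proof -
  have "step_law m = distr M borel (\<lambda>\<omega>. \<Sum>k<2. increment (Suc m) k \<omega>)"
    unfolding step_law_def
  proof (rule distr_cong_AE)
    show "AE \<omega> in M. X (1 / 2 ^ m) \<omega> = (\<Sum>k<2. increment (Suc m) k \<omega>)"
      using AE_sum_increment[of "Suc m"] by eventually_elim (auto dest: spec[of _ 2])
  qed (auto intro: measurable_process)
  then have "char (step_law m) 1 = (\<Prod>k<2::nat. char (distr M borel (increment (Suc m) k)) 1)"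
    using char_distr_sum[OF indep_vars_increment_finite[of "Suc m" 2], of 1] by simp
  then show ?thesis by (simp add: distr_increment)
qed

lemma char_step_law_tendsto: "(\<lambda>m. char (step_law m) 1) \<longlonglongrightarrow> 1"
proof -
  have "(\<lambda>m. \<integral>\<omega>. iexp (X (1 / 2 ^ m) \<omega>) \<partial>M) \<longlonglongrightarrow> (\<integral>\<omega>. 1 \<partial>M)"
  proof (rule integral_dominated_convergence[where w = "\<lambda>_. 1"])
    show "AE \<omega> in M. (\<lambda>m. iexp (X (1 / 2 ^ m) \<omega>)) \<longlonglongrightarrow> 1"
      using right_continuous_paths start_zero
    proof eventually_elim
      case (elim \<omega>)
      then have "((\<lambda>s. X s \<omega>) \<longlongrightarrow> 0) (at_right 0)" by force
      moreover have "filterlim (\<lambda>m::nat. 1 / 2 ^ m :: real) (at_right 0) sequentially"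
        by real_asymp
      ultimately have "(\<lambda>m. X (1 / 2 ^ m) \<omega>) \<longlonglongrightarrow> 0" by (rule filterlim_compose)
      then have "(\<lambda>m. iexp (X (1 / 2 ^ m) \<omega>)) \<longlonglongrightarrow> iexp 0"
        by (intro tendsto_intros)
      then show ?case by simp
    qed
    show "(\<lambda>\<omega>. iexp (X (1 / 2 ^ m) \<omega>)) \<in> borel_measurable M" for m
      using measurable_process[of "1 / 2 ^ m"] by simp
  qed auto
  moreover have "char (step_law m) 1 = (\<integral>\<omega>. iexp (X (1 / 2 ^ m) \<omega>) \<partial>M)" for m
    unfolding char_def step_law_def
    using measurable_process[of "1 / 2 ^ m"] by (subst integral_distr) auto
  ultimately show ?thesis by (simp add: prob_space)
qed

text \<open>The exponent \<open>2 ^ m\<close> is the number of steps in [0, 1]. By the trigonometric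
  bound the mean of one truncated exponential exceeds 1 by at most (A + a) * cmod (1 - w), w the
  characteristic function of the step at 1, and this is of order 2 ^ (-m).\<close>

lemma truncated_exp_step_law_bound:
  assumes a: "a \<ge> 0"
  shows "\<exists>C. eventually (\<lambda>m. (\<integral>\<^sup>+y. ennreal (if y \<ge> - 1 then exp (- a * y) else 0) \<partial>step_law m) ^ (2 ^ m)
           \<le> ennreal C) sequentially"
proof -
  obtain A where A: "A \<ge> 0"
    "\<And>y. (if y \<ge> - 1 then exp (- a * y) else 0) - 1 \<le> A * (1 - cos y) - a * sin y"
    using truncated_exp_le_trigonometric[OF a] by blast
  obtain C where C: "eventually (\<lambda>m. 2 ^ m * cmod (1 - char (step_law m) 1) \<le> C) sequentially"
    using dyadic_square_roots_bound[OF char_step_law_Suc char_step_law_tendsto] by blast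
  have "eventually (\<lambda>m. (\<integral>\<^sup>+y. ennreal (if y \<ge> - 1 then exp (- a * y) else 0) \<partial>step_law m) ^ (2 ^ m)
           \<le> ennreal (exp ((A + a) * C))) sequentially"
    using C
  proof eventually_elim
    case (elim m)
    interpret \<mu>: prob_space "step_law m" by (rule prob_space_step_law)
    define w where "w = char (step_law m) 1"
    have int_iexp: "integrable (step_law m) (\<lambda>y. iexp y)"
      by (rule \<mu>.integrable_const_bound[where B = 1]) auto
    have int_cos: "integrable (step_law m) (\<lambda>y. cos y)"
      by (rule \<mu>.integrable_const_bound[where B = 1]) auto
    have int_sin: "integrable (step_law m) (\<lambda>y. sin y)"
      by (rule \<mu>.integrable_const_bound[where B = 1]) auto
    have w: "w = (\<integral>y. iexp y \<partial>step_law m)" by (simp add: w_def char_def)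
    have Re_w: "Re w = (\<integral>y. cos y \<partial>step_law m)"
      unfolding w using int_iexp by (subst integral_Re[symmetric]) (auto simp: Re_exp)
    have Im_w: "Im w = (\<integral>y. sin y \<partial>step_law m)"
      unfolding w using int_iexp by (subst integral_Im[symmetric]) (auto simp: Im_exp)
    have "(\<integral>\<^sup>+y. ennreal (if y \<ge> - 1 then exp (- a * y) else 0) \<partial>step_law m)
        \<le> (\<integral>\<^sup>+y. ennreal (1 + (A * (1 - cos y) - a * sin y)) \<partial>step_law m)"
      using A(2) by (intro nn_integral_mono ennreal_leI) (smt (verit))
    also have "\<dots> = ennreal (\<integral>y. 1 + (A * (1 - cos y) - a * sin y) \<partial>step_law m)"
    proof (intro nn_integral_eq_integral AE_I2)
      show "0 \<le> 1 + (A * (1 - cos y) - a * sin y)" for y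
        using A(2)[of y] exp_ge_zero[of "- a * y"] by (smt (verit))
    qed (intro Bochner_Integration.integrable_add Bochner_Integration.integrable_diff
           integrable_mult_right int_cos int_sin \<mu>.integrable_const)
    also have "(\<integral>y. 1 + (A * (1 - cos y) - a * sin y) \<partial>step_law m) = 1 + (A * (1 - Re w) - a * Im w)"
      using int_cos int_sin \<mu>.prob_space by (simp add: Re_w Im_w)
    also have "\<dots> \<le> 1 + (A + a) * C / 2 ^ m"
    proof -
      have "A * (1 - Re w) \<le> A * cmod (1 - w)"
        using A(1) complex_Re_le_cmod[of "1 - w"] by (intro mult_left_mono) auto
      moreover have "a * (- Im w) \<le> a * cmod (1 - w)"
        using a abs_Im_le_cmod[of "1 - w"] by (intro mult_left_mono) auto
      moreover have "(A + a) * cmod (1 - w) \<le> (A + a) * (C / 2 ^ m)"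
        using a A(1) elim by (intro mult_left_mono) (auto simp: w_def field_simps)
      ultimately show ?thesis by (simp add: algebra_simps)
    qed
    also have "\<dots> \<le> exp ((A + a) * C / 2 ^ m)" by simp
    finally have "(\<integral>\<^sup>+y. ennreal (if y \<ge> - 1 then exp (- a * y) else 0) \<partial>step_law m)
        \<le> ennreal (exp ((A + a) * C / 2 ^ m))" by (simp add: ennreal_leI)
    then have "(\<integral>\<^sup>+y. ennreal (if y \<ge> - 1 then exp (- a * y) else 0) \<partial>step_law m) ^ (2 ^ m)
        \<le> ennreal (exp ((A + a) * C / 2 ^ m)) ^ (2 ^ m)" by (rule power_mono) simp
    also have "\<dots> = ennreal (exp ((A + a) * C / 2 ^ m) ^ (2 ^ m))" by (simp add: ennreal_power)
    also have "exp ((A + a) * C / 2 ^ m) ^ (2 ^ m) = exp ((A + a) * C)"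
      by (subst exp_of_nat_mult[symmetric]) simp
    finally show ?case .
  qed
  then show ?thesis by blast
qed

end

section \<open>Exponential moments and lower tails of one step\<close>

lemma prod_ennreal_exp:
  "finite A \<Longrightarrow> (\<Prod>k\<in>A. ennreal (exp (c * f k))) = ennreal (exp (c * sum f A))"
  by (simp add: prod_ennreal exp_sum sum_distrib_left)

context spectrally_positive_levy_process begin

lemma AE_increments_ge:
  "AE \<omega> in M. \<forall>\<delta>>0. eventually (\<lambda>m. \<forall>k<2 ^ m. - \<delta> \<le> increment m k \<omega>) sequentially"
  using right_continuous_paths left_limits no_negative_jumps
proof eventually_elim
  case (elim \<omega>)
  show ?case
  proof (intro allI impI)
    fix \<delta> :: real assume \<delta>: "\<delta> > 0"
    have left: "\<exists>l\<le>X t \<omega>. ((\<lambda>s. X s \<omega>) \<longlongrightarrow> l) (at_left t)" if "t > 0" for t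
    proof -
      obtain l where l: "((\<lambda>s. X s \<omega>) \<longlongrightarrow> l) (at_left t)" using elim(2) \<open>t > 0\<close> by blast
      \<comment> \<open>\<open>Lim\<close> is a definite description; existence of the left limit is
        what identifies it with l.\<close>
      then have "Lim (at_left t) (\<lambda>s. X s \<omega>) = l" by (intro tendsto_Lim) auto
      then show ?thesis using elim(3) \<open>t > 0\<close> l by metis
    qed
    obtain e where e: "e > 0"
      "\<And>s t. 0 \<le> s \<Longrightarrow> s \<le> t \<Longrightarrow> t \<le> 1 \<Longrightarrow> t - s < e \<Longrightarrow> X t \<omega> - X s \<omega> \<ge> - \<delta>"
      using no_negative_jumps_increment_bound[of "\<lambda>t. X t \<omega>" \<delta> 1] elim(1) left \<delta> by blast
    have "(\<lambda>m::nat. 1 / 2 ^ m :: real) \<longlonglongrightarrow> 0" by real_asymp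
    then have "eventually (\<lambda>m::nat. 1 / 2 ^ m < e) sequentially"
      using e(1) by (rule order_tendstoD(2))
    then show "eventually (\<lambda>m. \<forall>k<2 ^ m. - \<delta> \<le> increment m k \<omega>) sequentially"
    proof eventually_elim
      case (elim m)
      show ?case
      proof (intro allI impI)
        fix k :: nat assume "k < 2 ^ m"
        then have "Suc k \<le> 2 ^ m" by simp
        then have "real (Suc k) \<le> 2 ^ m" by (metis of_nat_le_iff of_nat_numeral of_nat_power)
        then show "- \<delta> \<le> increment m k \<omega>"
          unfolding increment_def using elim
          by (intro e(2)) (auto simp: divide_simps)
      qed
    qed
  qed
qed

text \<open>The truncation disappears in the limit: for almost every path all increments over [0, 1]
  are eventually at least -1, and then the product of truncated exponentials equals exp (- a X 1).
  Fatou's lemma transfers the bound that is uniform in m.\<close>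

lemma nn_integral_exp_finite:
  assumes a: "a \<ge> 0"
  shows "(\<integral>\<^sup>+\<omega>. ennreal (exp (- a * X 1 \<omega>)) \<partial>M) < \<infinity>"
proof -
  define f where "f y = ennreal (if y \<ge> - 1 then exp (- a * y) else 0)" for y :: real
  have [measurable]: "f \<in> borel_measurable borel" unfolding f_def[abs_def] by measurable
  obtain C where C: "eventually (\<lambda>m. (\<integral>\<^sup>+y. f y \<partial>step_law m) ^ (2 ^ m) \<le> ennreal C) sequentially"
    using truncated_exp_step_law_bound[OF a] unfolding f_def by blast
  have AE_sum: "AE \<omega> in M. \<forall>m K. X (real K / 2 ^ m) \<omega> = (\<Sum>k<K. increment m k \<omega>)"
    unfolding AE_all_countable using AE_sum_increment[unfolded AE_all_countable] by blast
  have "AE \<omega> in M. ennreal (exp (- a * X 1 \<omega>)) = liminf (\<lambda>m. \<Prod>k<2 ^ m. f (increment m k \<omega>))"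
    using AE_increments_ge AE_sum
  proof eventually_elim
    case (elim \<omega>)
    from elim(1) have "eventually (\<lambda>m. \<forall>k<2 ^ m. - 1 \<le> increment m k \<omega>) sequentially" by simp
    then have "eventually (\<lambda>m. (\<Prod>k<2 ^ m. f (increment m k \<omega>)) = ennreal (exp (- a * X 1 \<omega>))) sequentially"
    proof eventually_elim
      case (elim m)
      have "(\<Prod>k<2 ^ m. f (increment m k \<omega>)) = (\<Prod>k<2 ^ m. ennreal (exp (- a * increment m k \<omega>)))"
        using elim by (intro prod.cong) (auto simp: f_def)
      also have "\<dots> = ennreal (exp (- a * (\<Sum>k<2 ^ m. increment m k \<omega>)))"
        by (rule prod_ennreal_exp) simp
      also have "(\<Sum>k<2 ^ m. increment m k \<omega>) = X 1 \<omega>"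
        using \<open>\<forall>m K. X (real K / 2 ^ m) \<omega> = (\<Sum>k<K. increment m k \<omega>)\<close>[rule_format, of "2 ^ m" m] by simp
      finally show ?case .
    qed
    then have "(\<lambda>m. \<Prod>k<2 ^ m. f (increment m k \<omega>)) \<longlonglongrightarrow> ennreal (exp (- a * X 1 \<omega>))"
      by (rule tendsto_eventually)
    then show ?case by (intro lim_imp_Liminf[symmetric]) auto
  qed
  then have "(\<integral>\<^sup>+\<omega>. ennreal (exp (- a * X 1 \<omega>)) \<partial>M)
      = (\<integral>\<^sup>+\<omega>. liminf (\<lambda>m. \<Prod>k<2 ^ m. f (increment m k \<omega>)) \<partial>M)"
    by (rule nn_integral_cong_AE)
  also have "\<dots> \<le> liminf (\<lambda>m. \<integral>\<^sup>+\<omega>. (\<Prod>k<2 ^ m. f (increment m k \<omega>)) \<partial>M)"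
    by (intro nn_integral_liminf) measurable
  also have "\<dots> = liminf (\<lambda>m. (\<integral>\<^sup>+y. f y \<partial>step_law m) ^ (2 ^ m))"
    by (simp add: nn_integral_prod_increment)
  also have "\<dots> \<le> ennreal C"
    using C by (intro Liminf_le) auto
  finally show ?thesis by (rule order_le_less_trans) simp
qed

lemma integrable_exp_X1:
  assumes "a \<ge> 0"
  shows "integrable M (\<lambda>\<omega>. exp (- a * X 1 \<omega>))"
  using nn_integral_exp_finite[OF assms] measurable_process[of 1]
  by (intro integrableI_nonneg) auto

text \<open>Stated in \<open>ennreal\<close> because integrability for a single step is not yet
  known; it follows from this identity and finiteness at time 1.\<close>

lemma nn_integral_exp_step_law_power:
  "(\<integral>\<^sup>+y. ennreal (exp (- a * y)) \<partial>step_law m) ^ (2 ^ m) = (\<integral>\<^sup>+\<omega>. ennreal (exp (- a * X 1 \<omega>)) \<partial>M)"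
proof -
  have "(\<integral>\<^sup>+y. ennreal (exp (- a * y)) \<partial>step_law m) ^ (2 ^ m)
      = (\<integral>\<^sup>+\<omega>. (\<Prod>k<2 ^ m. ennreal (exp (- a * increment m k \<omega>))) \<partial>M)"
    by (subst nn_integral_prod_increment) auto
  also have "\<dots> = (\<integral>\<^sup>+\<omega>. ennreal (exp (- a * X 1 \<omega>)) \<partial>M)"
  proof (rule nn_integral_cong_AE)
    show "AE \<omega> in M. (\<Prod>k<2 ^ m. ennreal (exp (- a * increment m k \<omega>))) = ennreal (exp (- a * X 1 \<omega>))"
      using AE_sum_increment[of m]
    proof eventually_elim
      case (elim \<omega>)
      have "(\<Prod>k<2 ^ m. ennreal (exp (- a * increment m k \<omega>))) = ennreal (exp (- a * (\<Sum>k<2 ^ m. increment m k \<omega>)))"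
        by (rule prod_ennreal_exp) simp
      then show ?case using elim[rule_format, of "2 ^ m"] by simp
    qed
  qed
  finally show ?thesis .
qed

lemma integrable_exp_step_law:
  assumes a: "a \<ge> 0"
  shows "integrable (step_law m) (\<lambda>y. exp (- a * y))"
proof (rule integrableI_nonneg)
  have "(\<integral>\<^sup>+y. ennreal (exp (- a * y)) \<partial>step_law m) ^ (2 ^ m) < \<infinity>"
    using nn_integral_exp_finite[OF a] by (simp only: nn_integral_exp_step_law_power)
  then show "(\<integral>\<^sup>+y. ennreal (exp (- a * y)) \<partial>step_law m) < \<infinity>"
    by (simp add: power_less_top_ennreal)
qed auto

lemma laplace_transform_pos:
  assumes a: "a \<ge> 0"
  shows "(\<integral>\<omega>. exp (- a * X 1 \<omega>) \<partial>M) > 0"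
proof -
  have "(\<integral>\<omega>. 0 \<partial>M) < (\<integral>\<omega>. exp (- a * X 1 \<omega>) \<partial>M)"
    by (intro integral_less_AE_space integrable_exp_X1[OF a]) (auto simp: emeasure_space_1)
  then show ?thesis by simp
qed

lemma exp_laplace_exponent:
  assumes a: "a \<ge> 0"
  shows "exp (laplace_exponent M X a) = (\<integral>\<omega>. exp (- a * X 1 \<omega>) \<partial>M)"
  unfolding laplace_exponent_def using laplace_transform_pos[OF a] by simp

lemma integral_exp_step_law:
  assumes a: "a \<ge> 0"
  shows "(\<integral>y. exp (- a * y) \<partial>step_law m) = exp (laplace_exponent M X a / 2 ^ m)"
proof -
  define I where "I = (\<integral>y. exp (- a * y) \<partial>step_law m)"
  interpret \<mu>: prob_space "step_law m" by (rule prob_space_step_law)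
  have "(\<integral>y. 0 \<partial>step_law m) < I" unfolding I_def
    by (intro \<mu>.integral_less_AE_space integrable_exp_step_law[OF a])
      (auto simp: \<mu>.emeasure_space_1[simplified])
  then have I: "I > 0" by simp
  have "(\<integral>\<^sup>+y. ennreal (exp (- a * y)) \<partial>step_law m) = ennreal I"
    unfolding I_def by (rule nn_integral_eq_integral[OF integrable_exp_step_law[OF a]]) simp
  moreover have "(\<integral>\<^sup>+\<omega>. ennreal (exp (- a * X 1 \<omega>)) \<partial>M) = ennreal (exp (laplace_exponent M X a))"
    unfolding exp_laplace_exponent[OF a] by (rule nn_integral_eq_integral[OF integrable_exp_X1[OF a]]) simp
  ultimately have "ennreal (I ^ (2 ^ m)) = ennreal (exp (laplace_exponent M X a))"
    using nn_integral_exp_step_law_power[where a = a and m = m] I by (simp add: ennreal_power)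
  then have "I ^ (2 ^ m) = exp (laplace_exponent M X a)" using I by (subst (asm) ennreal_inj) auto
  also have "\<dots> = exp (laplace_exponent M X a / 2 ^ m) ^ (2 ^ m)"
    by (subst exp_of_nat_mult[symmetric]) simp
  finally show ?thesis unfolding I_def[symmetric] using I by (intro power_eq_imp_eq_base[of I "2 ^ m"]) auto
qed

text \<open>With p the probability of one step below -\<delta>, independence makes (1 - p) ^ (2 ^ m)
  the probability that no step in [0, 1] is that low. It tends to 1 by dominated convergence, and 2
  ^ m * p is at most minus its logarithm.\<close>

lemma step_law_tail:
  assumes \<delta>: "\<delta> > 0"
  shows "(\<lambda>m. 2 ^ m * measure (step_law m) {..< - \<delta>}) \<longlonglongrightarrow> 0"
proof -
  define p where "p m = measure (step_law m) {..< - \<delta>}" for m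
  have p01: "0 \<le> p m" "p m \<le> 1" for m
    using prob_space.prob_le_1[OF prob_space_step_law[of m]] by (auto simp: p_def)
  have "(\<lambda>m. \<integral>\<^sup>+\<omega>. (\<Prod>k<2 ^ m. indicator {- \<delta>..} (increment m k \<omega>)) \<partial>M) \<longlonglongrightarrow> (\<integral>\<^sup>+\<omega>. 1 \<partial>M)"
  proof (rule nn_integral_dominated_convergence[where w = "\<lambda>_. 1"])
    show "AE \<omega> in M. (\<lambda>m. \<Prod>k<2 ^ m. indicator {- \<delta>..} (increment m k \<omega>)) \<longlonglongrightarrow> (1::ennreal)"
      using AE_increments_ge
    proof eventually_elim
      case (elim \<omega>)
      then have "eventually (\<lambda>m. \<forall>k<2 ^ m. - \<delta> \<le> increment m k \<omega>) sequentially" using \<delta> by auto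
      then have "eventually (\<lambda>m. (\<Prod>k<2 ^ m. indicator {- \<delta>..} (increment m k \<omega>)) = (1::ennreal)) sequentially"
        by eventually_elim (auto intro!: prod.neutral)
      then show ?case by (rule tendsto_eventually)
    qed
    show "AE \<omega> in M. (\<Prod>k<2 ^ m. indicator {- \<delta>..} (increment m k \<omega>)) \<le> (1::ennreal)" for m
      by (intro AE_I2 prod_le_1) (auto simp: indicator_def)
  qed (auto simp: emeasure_space_1)
  moreover have "(\<integral>\<^sup>+\<omega>. (\<Prod>k<2 ^ m. indicator {- \<delta>..} (increment m k \<omega>)) \<partial>M) = ennreal ((1 - p m) ^ (2 ^ m))" for m
  proof -
    interpret \<mu>: prob_space "step_law m" by (rule prob_space_step_law)
    have "measure (step_law m) {- \<delta>..} = 1 - p m"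
      using \<mu>.prob_compl[of "{..< - \<delta>}"] by (simp add: p_def Compl_eq_Diff_UNIV[symmetric])
    then have "emeasure (step_law m) {- \<delta>..} = ennreal (1 - p m)"
      by (simp add: \<mu>.emeasure_eq_measure)
    then show ?thesis
      using p01[of m] by (subst nn_integral_prod_increment) (auto simp: ennreal_power)
  qed
  ultimately have "(\<lambda>m. ennreal ((1 - p m) ^ (2 ^ m))) \<longlonglongrightarrow> ennreal 1"
    by (simp add: emeasure_space_1)
  then have u: "(\<lambda>m. (1 - p m) ^ (2 ^ m)) \<longlonglongrightarrow> 1"
    using p01 by (subst (asm) tendsto_ennreal_iff) auto
  show ?thesis unfolding p_def[symmetric]
  proof (rule tendsto_sandwich[of "\<lambda>_. 0" _ _ "\<lambda>m. - ln ((1 - p m) ^ (2 ^ m))"])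
    show "(\<lambda>m. - ln ((1 - p m) ^ 2 ^ m)) \<longlonglongrightarrow> 0"
      using tendsto_minus[OF tendsto_ln[OF u]] by simp
    have "eventually (\<lambda>m. 0 < (1 - p m) ^ (2 ^ m)) sequentially"
      by (rule order_tendstoD(1)[OF u]) simp
    then show "eventually (\<lambda>m. 2 ^ m * p m \<le> - ln ((1 - p m) ^ 2 ^ m)) sequentially"
    proof eventually_elim
      case (elim m)
      have "(1 - p m) ^ (2 ^ m) \<le> exp (- p m) ^ (2 ^ m)"
        using p01[of m] exp_ge_add_one_self[of "- p m"] by (intro power_mono) auto
      also have "\<dots> = exp (- (2 ^ m * p m))"
        by (subst exp_of_nat_mult[symmetric]) simp
      finally have "ln ((1 - p m) ^ 2 ^ m) \<le> ln (exp (- (2 ^ m * p m)))"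
        using elim by (subst ln_le_cancel_iff) auto
      then show ?case by simp
    qed
  qed (use p01 in \<open>auto intro!: always_eventually\<close>)
qed

text \<open>The inequality 2 u \<le> s u^2 + 1 / s trades the exponential weight u for a second
  moment and a probability. The second moment of exp (- K y) - 1 is only O(2 ^ (-m)), but its share
  is made small by the choice of s; the probability is o(2 ^ (-m)), so its large factor 1 / s is
  harmless.\<close>

lemma step_law_exp_tail:
  assumes \<delta>: "\<delta> > 0" and K: "K > 0"
  shows "(\<lambda>m. 2 ^ m * (\<integral>y. exp (- K * y) * indicator {..< - \<delta>} y \<partial>step_law m)) \<longlonglongrightarrow> 0"
proof -
  define \<phi> where "\<phi> = laplace_exponent M X"
  define b where "b m = 2 ^ m * (\<integral>y. (exp (- K * y) - 1)\<^sup>2 \<partial>step_law m)" for m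
  define p where "p m = measure (step_law m) {..< - \<delta>}" for m
  \<comment> \<open>For y < -\<delta> the weight u = exp (- K y) exceeds exp (K \<delta>), and c is
    the constant for which u \<le> c (u - 1) there.\<close>
  define c where "c = 1 / (1 - exp (- K * \<delta>))"
  have "exp (- K * \<delta>) < 1" using K \<delta> by simp
  then have c: "c > 0" by (simp add: c_def)
  have sq: "(exp (- K * y) - 1)\<^sup>2 = exp (- (2 * K) * y) - 2 * exp (- K * y) + 1" for y
    by (simp add: power2_eq_square algebra_simps mult_exp_exp)
  have int1: "integrable (step_law m) (\<lambda>y. exp (- (2 * K) * y))" "integrable (step_law m) (\<lambda>y. exp (- K * y))"
    "integrable (step_law m) (\<lambda>y. 1 :: real)" for m
    by (rule integrable_exp_step_law, use K in simp)+
       (intro finite_measure.integrable_const prob_space.finite_measure prob_space_step_law)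
  have int2: "integrable (step_law m) (\<lambda>y. (exp (- K * y) - 1)\<^sup>2)" for m
    unfolding sq by (intro Bochner_Integration.integrable_add Bochner_Integration.integrable_diff integrable_mult_right int1)
  have b_eq: "b m = 2 ^ m * (exp (\<phi> (2 * K) / 2 ^ m) - 2 * exp (\<phi> K / 2 ^ m) + 1)" for m
  proof -
    have "(\<integral>y. (exp (- K * y) - 1)\<^sup>2 \<partial>step_law m)
        = (\<integral>y. exp (- (2 * K) * y) \<partial>step_law m) - 2 * (\<integral>y. exp (- K * y) \<partial>step_law m) + (\<integral>y. 1 \<partial>step_law m)"
      unfolding sq using int1[of m] by (simp only: Bochner_Integration.integral_add Bochner_Integration.integral_diff
          Bochner_Integration.integrable_diff integrable_mult_right integral_mult_right_zero)
    also have "(\<integral>y. 1 \<partial>step_law m) = (1::real)"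
      using prob_space.prob_space[OF prob_space_step_law[of m]] by simp
    finally show ?thesis using K by (simp only: b_def \<phi>_def integral_exp_step_law)
  qed
  \<comment> \<open>The constants 1 - 2 + 1 cancel, so the first-order terms in 2 ^ (-m)
    survive.\<close>
  have b_lim: "b \<longlonglongrightarrow> \<phi> (2 * K) - 2 * \<phi> K"
    unfolding b_eq[abs_def] by real_asymp
  have bound: "2 ^ m * (\<integral>y. exp (- K * y) * indicator {..< - \<delta>} y \<partial>step_law m)
      \<le> s * c\<^sup>2 / 2 * b m + 1 / (2 * s) * (2 ^ m * p m)" if s: "s > 0" for s m
  proof -
    have pt: "exp (- K * y) * indicator {..< - \<delta>} y
        \<le> s * c\<^sup>2 / 2 * (exp (- K * y) - 1)\<^sup>2 + 1 / (2 * s) * indicator {..< - \<delta>} y" for y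
    proof (cases "y < - \<delta>")
      case True
      define u where "u = exp (- K * y)"
      have "exp (- K * \<delta>) * u \<ge> 1"
        using mult_left_mono[of y "- \<delta>" K] True K by (simp add: u_def mult_exp_exp)
      then have "u \<le> c * (u - 1)"
        using \<open>exp (- K * \<delta>) < 1\<close> by (simp add: c_def field_simps)
      moreover have "u > 0" by (simp add: u_def)
      ultimately have "u\<^sup>2 \<le> (c * (u - 1))\<^sup>2" by (intro power_mono) auto
      then have "s * u\<^sup>2 \<le> s * (c\<^sup>2 * (u - 1)\<^sup>2)" using s by (simp add: power_mult_distrib)
      moreover have "s * u\<^sup>2 + 1 / s - 2 * u = (s * u - 1)\<^sup>2 / s"
        using s by (simp add: field_simps power2_eq_square)
      then have "2 * u \<le> s * u\<^sup>2 + 1 / s" using s by (smt (verit) divide_nonneg_pos zero_le_power2)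
      ultimately show ?thesis using True by (simp add: u_def)
    next
      case False
      then show ?thesis using s by simp
    qed
    have ind: "integrable (step_law m) (indicator {..< - \<delta>} :: real \<Rightarrow> real)"
      using prob_space_step_law[of m] by (intro finite_measure.integrable_const_bound[where B=1])
        (auto simp: prob_space_def indicator_def)
    have "(\<integral>y. exp (- K * y) * indicator {..< - \<delta>} y \<partial>step_law m)
        \<le> (\<integral>y. s * c\<^sup>2 / 2 * (exp (- K * y) - 1)\<^sup>2 + 1 / (2 * s) * indicator {..< - \<delta>} y \<partial>step_law m)"
      by (intro integral_mono pt integrable_real_mult_indicator int1 Bochner_Integration.integrable_add
          integrable_mult_right int2 ind) auto
    also have "\<dots> = s * c\<^sup>2 / 2 * (\<integral>y. (exp (- K * y) - 1)\<^sup>2 \<partial>step_law m) + 1 / (2 * s) * p m"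
      using int2[of m] ind
      by (subst Bochner_Integration.integral_add) (auto simp: p_def simp del: mult_minus_left)
    finally have "2 ^ m * (\<integral>y. exp (- K * y) * indicator {..< - \<delta>} y \<partial>step_law m)
       \<le> 2 ^ m * (s * c\<^sup>2 / 2 * (\<integral>y. (exp (- K * y) - 1)\<^sup>2 \<partial>step_law m) + 1 / (2 * s) * p m)"
      by (intro mult_left_mono) auto
    then show ?thesis by (simp add: b_def algebra_simps)
  qed
  show ?thesis
  proof (rule order_tendstoI)
    fix e :: real assume e: "0 < e"
    \<comment> \<open>B bounds the limit of \<open>b\<close>, with 1 added to keep it positive; the
      s below then limits the second-moment share to e / 2.\<close>
    define B where "B = \<bar>\<phi> (2 * K) - 2 * \<phi> K\<bar> + 1"
    define s where "s = e / (c\<^sup>2 * B)"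
    have B: "B > 0" by (simp add: B_def)
    have s: "s > 0" using e c B by (simp add: s_def)
    have "(\<lambda>m. s * c\<^sup>2 / 2 * b m + 1 / (2 * s) * (2 ^ m * p m))
        \<longlonglongrightarrow> s * c\<^sup>2 / 2 * (\<phi> (2 * K) - 2 * \<phi> K) + 1 / (2 * s) * 0"
      unfolding p_def by (intro tendsto_intros b_lim step_law_tail[OF \<delta>])
    moreover have "s * c\<^sup>2 / 2 * (\<phi> (2 * K) - 2 * \<phi> K) + 1 / (2 * s) * 0 < e"
    proof -
      have "s * c\<^sup>2 / 2 * (\<phi> (2 * K) - 2 * \<phi> K) \<le> s * c\<^sup>2 / 2 * B"
        using s by (intro mult_left_mono) (auto simp: B_def)
      also have "\<dots> = e / 2" using c B by (simp add: s_def)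
      finally show ?thesis using e by simp
    qed
    ultimately have "eventually (\<lambda>m. s * c\<^sup>2 / 2 * b m + 1 / (2 * s) * (2 ^ m * p m) < e) sequentially"
      by (rule order_tendstoD(2))
    then show "eventually (\<lambda>m. 2 ^ m * (\<integral>y. exp (- K * y) * indicator {..< - \<delta>} y \<partial>step_law m) < e) sequentially"
      by eventually_elim (use bound[OF s] in \<open>meson order_le_less_trans\<close>)
  next
    fix e :: real assume e: "e < 0"
    have "0 \<le> (\<integral>y. exp (- K * y) * indicator {..< - \<delta>} y \<partial>step_law m)" for m
      by (intro integral_nonneg_AE AE_I2) auto
    then have "e < 2 ^ m * (\<integral>y. exp (- K * y) * indicator {..< - \<delta>} y \<partial>step_law m)" for m
      using e by (meson mult_nonneg_nonneg order_less_le_trans zero_le_numeral zero_le_power)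
    then show "eventually (\<lambda>m. e < 2 ^ m * (\<integral>y. exp (- K * y) * indicator {..< - \<delta>} y \<partial>step_law m)) sequentially"
      by (intro always_eventually allI)
  qed
qed

end

section \<open>The Laplace exponent and its right inverse\<close>

lemma (in spectrally_positive_levy_process) laplace_exponent_0: "laplace_exponent M X 0 = 0"
  by (simp add: laplace_exponent_def prob_space)

lemma (in spectrally_positive_levy_process) continuous_on_laplace_exponent:
  "continuous_on {0..} (laplace_exponent M X)"
proof -
  have "continuous_on {0..B} (\<lambda>a. \<integral>\<omega>. exp (- a * X 1 \<omega>) \<partial>M)" if "B \<ge> 0" for B
  proof (unfold continuous_on_sequentially, intro allI ballI impI, unfold comp_def)
    fix u a assume ua: "a \<in> {0..B}" "(\<forall>n. u n \<in> {0..B}) \<and> u \<longlonglongrightarrow> a"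
    show "(\<lambda>n. \<integral>\<omega>. exp (- u n * X 1 \<omega>) \<partial>M) \<longlonglongrightarrow> (\<integral>\<omega>. exp (- a * X 1 \<omega>) \<partial>M)"
    proof (rule integral_dominated_convergence[where w = "\<lambda>\<omega>. 1 + exp (- B * X 1 \<omega>)"])
      show "integrable M (\<lambda>\<omega>. 1 + exp (- B * X 1 \<omega>))"
        using \<open>B \<ge> 0\<close> by (intro Bochner_Integration.integrable_add integrable_exp_X1) auto
      show "AE \<omega> in M. (\<lambda>n. exp (- u n * X 1 \<omega>)) \<longlonglongrightarrow> exp (- a * X 1 \<omega>)"
        using ua by (intro AE_I2 tendsto_intros) auto
      \<comment> \<open>A bound common to all c in [0, B]: 1 serves z \<ge> 0 and exp (- B z) serves
        z < 0.\<close>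
      have pt: "exp (- c * z) \<le> 1 + exp (- B * z)" if "c \<in> {0..B}" for c z :: real
      proof (cases "z \<ge> 0")
        case True
        then have "exp (- c * z) \<le> 1" using that by simp
        then show ?thesis using exp_ge_zero[of "- B * z"] by linarith
      next
        case False
        then have "- c * z \<le> - B * z" using that by (simp add: mult_right_mono_neg)
        then have "exp (- c * z) \<le> exp (- B * z)" by (subst exp_le_cancel_iff)
        then show ?thesis by linarith
      qed
      show "AE \<omega> in M. norm (exp (- u n * X 1 \<omega>)) \<le> 1 + exp (- B * X 1 \<omega>)" for n
        using pt ua by (intro AE_I2) (simp del: mult_minus_left)
    qed (use measurable_process[of 1] in auto)
  qed
  then have "continuous_on {0..B} (laplace_exponent M X)" if "B \<ge> 0" for B
    unfolding laplace_exponent_def[abs_def]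
  proof (intro continuous_on_ln ballI)
    fix a assume "a \<in> {0..B}"
    then show "(\<integral>\<omega>. exp (- a * X 1 \<omega>) \<partial>M) \<noteq> 0" using laplace_transform_pos[of a] by simp
  qed (use that in blast)
  then have *: "continuous_on {0..<B} (laplace_exponent M X)" if "B > 0" for B
    by (rule continuous_on_subset[of "{0..B}"]) (use that less_imp_le in auto)
  \<comment> \<open>Composing with max 0 extends the exponent continuously to the left of 0, so the
    half-open intervals become open sets and 0 needs no separate treatment.\<close>
  have "isCont (\<lambda>x. laplace_exponent M X (max 0 x)) a" for a
  proof -
    have "continuous_on {0..<max 0 a + 1} (laplace_exponent M X)" by (rule *) simp
    then have "continuous_on {..<max 0 a + 1} (\<lambda>x. laplace_exponent M X (max 0 x))"
      by (rule continuous_on_compose2) (auto intro: continuous_on_max)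
    then show ?thesis
      by (rule continuous_on_interior) (simp add: interior_open)
  qed
  then have "continuous_on {0..} (\<lambda>x. laplace_exponent M X (max 0 x))"
    by (simp add: continuous_at_imp_continuous_on)
  then show ?thesis by (rule continuous_on_eq) auto
qed

text \<open>Jensen's inequality for a concave power: y powr \<theta> lies below its tangent at the
  mean c, and this tangent bound is Young's inequality.\<close>

lemma (in prob_space) expectation_powr_le:
  fixes Y :: "'a \<Rightarrow> real"
  assumes Y: "integrable M Y" "integrable M (\<lambda>\<omega>. Y \<omega> powr \<theta>)" "\<And>\<omega>. Y \<omega> > 0"
    and \<theta>: "0 \<le> \<theta>" "\<theta> \<le> 1"
  shows "expectation (\<lambda>\<omega>. Y \<omega> powr \<theta>) \<le> expectation Y powr \<theta>"
proof -
  define c where "c = expectation Y"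
  have "(\<integral>\<omega>. 0 \<partial>M) < c" unfolding c_def
    by (rule integral_less_AE_space[OF _ Y(1)]) (auto simp: emeasure_space_1 Y(3))
  then have c: "c > 0" by simp
  have pt: "y powr \<theta> \<le> c powr (\<theta> - 1) * (\<theta> * y + (1 - \<theta>) * c)" if "y > 0" for y
  proof -
    have "y powr \<theta> * c powr (1 - \<theta>) \<le> \<theta> * y + (1 - \<theta>) * c"
      using Youngs_inequality_0[of \<theta> "1 - \<theta>" y c] that c \<theta> by simp
    then have "c powr (\<theta> - 1) * (y powr \<theta> * c powr (1 - \<theta>)) \<le> c powr (\<theta> - 1) * (\<theta> * y + (1 - \<theta>) * c)"
      by (intro mult_left_mono) auto
    moreover have "c powr (\<theta> - 1) * (y powr \<theta> * c powr (1 - \<theta>)) = y powr \<theta> * c powr ((\<theta> - 1) + (1 - \<theta>))"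
      by (simp only: powr_add mult.assoc mult.left_commute mult.commute)
    ultimately show ?thesis using c by simp
  qed
  have "expectation (\<lambda>\<omega>. Y \<omega> powr \<theta>) \<le> expectation (\<lambda>\<omega>. c powr (\<theta> - 1) * (\<theta> * Y \<omega> + (1 - \<theta>) * c))"
    using Y by (intro integral_mono pt) auto
  also have "\<dots> = c powr (\<theta> - 1) * (\<theta> * c + (1 - \<theta>) * c)"
    using Y by (simp add: c_def prob_space)
  also have "\<dots> = c powr (\<theta> - 1) * c powr 1"
    using c by (simp add: algebra_simps)
  also have "\<dots> = c powr (\<theta> - 1 + 1)" by (rule powr_add[symmetric])
  also have "\<dots> = c powr \<theta>" by simp
  finally show ?thesis by (simp add: c_def)
qed

text \<open>Convexity along the chord from the origin, where the exponent is 0: the logarithm of the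
  power-mean inequality with \<theta> = a / b.\<close>

lemma (in spectrally_positive_levy_process) laplace_exponent_chord:
  assumes "0 \<le> a" "a \<le> b" "0 < b"
  shows "laplace_exponent M X a \<le> a / b * laplace_exponent M X b"
proof -
  have eq: "exp (- b * z) powr (a / b) = exp (- a * z)" for z
    using assms by (simp add: powr_def)
  have "(\<integral>\<omega>. exp (- a * X 1 \<omega>) \<partial>M) \<le> (\<integral>\<omega>. exp (- b * X 1 \<omega>) \<partial>M) powr (a / b)"
    using expectation_powr_le[of "\<lambda>\<omega>. exp (- b * X 1 \<omega>)" "a / b"] integrable_exp_X1[of a] integrable_exp_X1[of b] assms
    unfolding eq by simp
  then have "exp (laplace_exponent M X a) \<le> exp (laplace_exponent M X b) powr (a / b)"
    using assms by (simp add: exp_laplace_exponent)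
  then show ?thesis by (simp add: powr_def)
qed

text \<open>If X 1 \<ge> 0, the \<open>2 ^ m\<close> increments over [0, 1] cannot all be negative.
  By independence that event has probability P(step < 0) ^ (2 ^ m), so a negative step has
  probability 0 at every mesh. Paths are thus monotone on dyadic points, and right-continuity does
  the rest.\<close>

lemma (in levy_process) subordinator_if_X1_nonneg:
  assumes pos: "AE \<omega> in M. 0 \<le> X 1 \<omega>"
  shows "subordinator M X"
proof -
  have step: "measure (step_law m) {..<0} = 0" for m
  proof -
    define p where "p = measure (step_law m) {..<0}"
    interpret \<mu>: prob_space "step_law m" by (rule prob_space_step_law)
    have "AE \<omega> in M. (\<Prod>k<2 ^ m. indicator {..<0} (increment m k \<omega>)) = (0::ennreal)"
      using pos AE_sum_increment[of m]
    proof eventually_elim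
      case (elim \<omega>)
      have "\<exists>k<2 ^ m. increment m k \<omega> \<ge> 0"
      proof (rule ccontr)
        assume "\<not> ?thesis"
        then have "(\<Sum>k<2 ^ m. increment m k \<omega>) < (\<Sum>k<(2::nat) ^ m. 0)"
          by (intro sum_strict_mono) (auto simp: not_le lessThan_empty_iff)
        then show False using elim(1) elim(2)[rule_format, of "2 ^ m"] by simp
      qed
      then obtain k where "k < 2 ^ m" "indicator {..<0} (increment m k \<omega>) = (0::ennreal)" by auto
      then show ?case by (intro prod_zero) auto
    qed
    then have "(\<integral>\<^sup>+\<omega>. (\<Prod>k<2 ^ m. indicator {..<0} (increment m k \<omega>)) \<partial>M) = (\<integral>\<^sup>+\<omega>. 0 \<partial>M)"
      by (rule nn_integral_cong_AE)
    then have "(\<integral>\<^sup>+y. indicator {..<0::real} y \<partial>step_law m) ^ (2 ^ m) = 0"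
      by (subst nn_integral_prod_increment[symmetric]) auto
    then have "emeasure (step_law m) {..<0} = 0" by simp
    then show ?thesis by (simp add: measure_def)
  qed
  have "AE \<omega> in M. 0 \<le> increment m k \<omega>" for m k
  proof -
    interpret \<mu>: prob_space "step_law m" by (rule prob_space_step_law)
    have "{..<0} \<in> null_sets (step_law m)"
      using step[of m] by (auto simp: \<mu>.emeasure_eq_measure intro!: null_setsI)
    then have "AE y in step_law m. y \<notin> {..<0}" by (rule AE_not_in)
    then have "AE y in step_law m. 0 \<le> y" by (simp add: not_less)
    then show ?thesis unfolding distr_increment[of m k, symmetric] by (subst (asm) AE_distr_iff) auto
  qed
  then have "AE \<omega> in M. \<forall>m k. 0 \<le> increment m k \<omega>" by (simp add: AE_all_countable)
  then have "AE \<omega> in M. mono_on {0..} (\<lambda>t. X t \<omega>)"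
    using right_continuous_paths
  proof eventually_elim
    case (elim \<omega>)
    have mono: "X (real i / 2 ^ m) \<omega> \<le> X (real j / 2 ^ m) \<omega>" if "i \<le> j" for i j m
      using that
    proof (induction rule: dec_induct)
      case (step k)
      have "X (real k / 2 ^ m) \<omega> \<le> X (real (Suc k) / 2 ^ m) \<omega>"
        using elim(1)[rule_format, of m k] by (simp only: increment_def)
      then show ?case using step.IH by linarith
    qed simp
    \<comment> \<open>Floor plus 1 instead of the ceiling: the dyadic approximation lies strictly
      above t, as the punctured filter \<open>at_right t\<close> demands, and is monotone in
      t.\<close>
    define g where "g t m = real (nat \<lfloor>t * 2 ^ m\<rfloor> + 1) / 2 ^ m" for t :: real and m :: nat
    have g: "(\<lambda>m. X (g t m) \<omega>) \<longlonglongrightarrow> X t \<omega>" if "t \<ge> 0" for t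
    proof -
      have fl: "real (nat \<lfloor>t * 2 ^ m\<rfloor> + 1) = of_int \<lfloor>t * 2 ^ m\<rfloor> + 1" for m :: nat using that by simp
      have g1: "t < g t m" for m
        unfolding g_def fl by (simp add: pos_less_divide_eq)
      have g2: "g t m \<le> t + 1 / 2 ^ m" for m
      proof -
        have "of_int \<lfloor>t * 2 ^ m\<rfloor> + 1 \<le> t * 2 ^ m + 1" by simp
        then show ?thesis unfolding g_def fl by (simp add: field_simps)
      qed
      have "g t \<longlonglongrightarrow> t"
      proof (rule tendsto_sandwich[of "\<lambda>_. t" _ _ "\<lambda>m. t + 1 / 2 ^ m"])
        show "(\<lambda>m. t + 1 / 2 ^ m) \<longlonglongrightarrow> t" by real_asymp
      qed (use g1 g2 in \<open>auto intro!: always_eventually less_imp_le\<close>)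
      then have "filterlim (g t) (at_right t) sequentially"
        using g1 by (intro filterlim_at_withinI) auto
      with elim(2)[rule_format, OF that] show ?thesis by (rule filterlim_compose)
    qed
    show ?case
    proof (rule mono_onI)
      fix s t :: real assume st: "s \<in> {0..}" "t \<in> {0..}" "s \<le> t"
      show "X s \<omega> \<le> X t \<omega>"
      proof (rule LIMSEQ_le[OF g g])
        have "X (g s m) \<omega> \<le> X (g t m) \<omega>" for m
          unfolding g_def using st(3) by (intro mono add_mono nat_mono floor_mono mult_right_mono) auto
        then show "\<exists>N. \<forall>n\<ge>N. X (g s n) \<omega> \<le> X (g t n) \<omega>" by blast
      qed (use st in auto)
    qed
  qed
  then show ?thesis
    unfolding subordinator_def using levy_process_axioms by blast
qed

text \<open>If X is no subordinator, X 1 lies below some -\<epsilon> with positive probability p, so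
  the Laplace transform at a is at least p * exp (a \<epsilon>).\<close>

lemma (in spectrally_positive_levy_process) laplace_exponent_unbounded:
  assumes "\<not> subordinator M X"
  shows "\<exists>a\<ge>0. q < laplace_exponent M X a"
proof -
  have "\<not> (AE \<omega> in M. 0 \<le> X 1 \<omega>)" using assms subordinator_if_X1_nonneg by blast
  have [measurable]: "X 1 \<in> borel_measurable M" by (rule measurable_process) simp
  have "\<exists>\<epsilon>>0. prob {\<omega> \<in> space M. X 1 \<omega> < - \<epsilon>} > 0"
  proof (rule ccontr)
    assume neg: "\<not> ?thesis"
    have "prob {\<omega> \<in> space M. X 1 \<omega> < - \<epsilon>} = 0" if "\<epsilon> > 0" for \<epsilon>
    proof -
      have "prob {\<omega> \<in> space M. X 1 \<omega> < - \<epsilon>} \<le> 0" using neg that by (meson not_le)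
      then show ?thesis by (simp add: measure_le_0_iff)
    qed
    then have "AE \<omega> in M. \<not> X 1 \<omega> < - \<epsilon>" if "\<epsilon> > 0" for \<epsilon>
      using that by (subst AE_iff_measurable[OF _ refl]) (auto simp: emeasure_eq_measure)
    then have "AE \<omega> in M. \<forall>n::nat. \<not> X 1 \<omega> < - (1 / real (Suc n))"
      by (subst AE_all_countable) simp
    then have "AE \<omega> in M. 0 \<le> X 1 \<omega>"
    proof eventually_elim
      case (elim \<omega>)
      show ?case
      proof (rule ccontr)
        assume "\<not> 0 \<le> X 1 \<omega>"
        then obtain n where "inverse (real (Suc n)) < - X 1 \<omega>" using reals_Archimedean[of "- X 1 \<omega>"] by auto
        then show False using elim[rule_format, of n] by (simp add: inverse_eq_divide)
      qed
    qed
    then show False using \<open>\<not> (AE \<omega> in M. 0 \<le> X 1 \<omega>)\<close> by blast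
  qed
  then obtain \<epsilon> where \<epsilon>: "\<epsilon> > 0" "prob {\<omega> \<in> space M. X 1 \<omega> < - \<epsilon>} > 0" by blast
  define p where "p = prob {\<omega> \<in> space M. X 1 \<omega> < - \<epsilon>}"
  \<comment> \<open>Chosen so that a \<epsilon> + ln p \<ge> q + 1; the maximum with 0 keeps a in
    the domain of the exponent.\<close>
  define a where "a = max 0 ((q + 1 - ln p) / \<epsilon>)"
  have a: "a \<ge> 0" by (simp add: a_def)
  have "q + 1 - ln p \<le> a * \<epsilon>"
  proof -
    have "(q + 1 - ln p) / \<epsilon> \<le> a" by (simp add: a_def)
    then show ?thesis using \<epsilon>(1) by (simp add: pos_divide_le_eq)
  qed
  have "exp (a * \<epsilon>) * p = (\<integral>\<omega>. exp (a * \<epsilon>) * indicator {\<omega> \<in> space M. X 1 \<omega> < - \<epsilon>} \<omega> \<partial>M)"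
    by (simp add: p_def)
  also have "\<dots> \<le> (\<integral>\<omega>. exp (- a * X 1 \<omega>) \<partial>M)"
  proof (rule integral_mono)
    show "integrable M (\<lambda>\<omega>. exp (a * \<epsilon>) * indicator {\<omega> \<in> space M. X 1 \<omega> < - \<epsilon>} \<omega>)"
      by (intro integrable_mult_right) (simp add: integrable_indicator_iff emeasure_eq_measure)
    show "exp (a * \<epsilon>) * indicator {\<omega> \<in> space M. X 1 \<omega> < - \<epsilon>} \<omega> \<le> exp (- a * X 1 \<omega>)" for \<omega>
      using a mult_left_mono[of \<epsilon> "- X 1 \<omega>" a] by (auto simp: indicator_def)
  qed (rule integrable_exp_X1[OF a])
  also have "\<dots> = exp (laplace_exponent M X a)" by (simp only: exp_laplace_exponent[OF a])
  finally have "exp (a * \<epsilon> + ln p) \<le> exp (laplace_exponent M X a)"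
    using \<epsilon>(2) by (simp add: exp_add p_def)
  then have "a * \<epsilon> + ln p \<le> laplace_exponent M X a" by simp
  then show ?thesis using \<open>q + 1 - ln p \<le> a * \<epsilon>\<close> a by (intro exI[of _ a]) auto
qed

text \<open>Existence is the intermediate value theorem. If a < b both had value q, the chord bound
  would give q \<le> (a / b) q, impossible for q > 0; so the supremum is taken over a
  singleton.\<close>

lemma (in spectrally_positive_levy_process) right_inverse_laplace_exponent:
  assumes sub: "\<not> subordinator M X" and q: "q > 0"
  defines "\<psi> \<equiv> right_inverse (laplace_exponent M X) q"
  shows "\<psi> > 0" "laplace_exponent M X \<psi> = q"
    "\<And>a. a \<ge> 0 \<Longrightarrow> laplace_exponent M X a = q \<Longrightarrow> a = \<psi>"
proof -
  define \<phi> where "\<phi> = laplace_exponent M X"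
  obtain b where b: "b \<ge> 0" "q < \<phi> b" using laplace_exponent_unbounded[OF sub] unfolding \<phi>_def by blast
  have "\<exists>a\<ge>0. a \<le> b \<and> \<phi> a = q"
    using b q less_imp_le[of q "\<phi> b"] IVT'[of \<phi> 0 q b] continuous_on_subset[OF continuous_on_laplace_exponent, of "{0..b}"]
    by (auto simp: \<phi>_def laplace_exponent_0)
  then obtain a0 where a0: "a0 \<ge> 0" "\<phi> a0 = q" by blast
  have pos: "a > 0" if "a \<ge> 0" "\<phi> a = q" for a
    using that q laplace_exponent_0 by (cases "a = 0") (auto simp: \<phi>_def)
  have uniq: "\<not> a < b" if "a \<ge> 0" "\<phi> a = q" "\<phi> b = q" for a b
  proof
    assume "a < b"
    then have "q \<le> a / b * q" using laplace_exponent_chord[of a b] that by (simp add: \<phi>_def)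
    moreover have "a / b * q < 1 * q" using \<open>a < b\<close> that q by (intro mult_strict_right_mono) auto
    ultimately show False by simp
  qed
  have *: "a = a0" if "a \<ge> 0" "\<phi> a = q" for a
  proof (rule antisym)
    show "a \<le> a0" using uniq[OF a0 that(2)] by simp
    show "a0 \<le> a" using uniq[OF that a0(2)] by simp
  qed
  have "{a. 0 \<le> a \<and> \<phi> a = q} = {a0}"
  proof (intro equalityI subsetI)
    fix a assume "a \<in> {a0}" then show "a \<in> {a. 0 \<le> a \<and> \<phi> a = q}" using a0 by simp
  qed (simp add: *)
  then have "\<psi> = a0" unfolding \<psi>_def right_inverse_def \<phi>_def[symmetric] by simp
  then show "\<psi> > 0" "laplace_exponent M X \<psi> = q"
    using a0 pos[OF a0] by (simp_all add: \<phi>_def)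
  show "a = \<psi>" if "a \<ge> 0" "laplace_exponent M X a = q" for a
    using *[of a] that \<open>\<psi> = a0\<close> by (simp add: \<phi>_def)
qed

section \<open>The Lindley operator and its resolvent at geometric times\<close>

definition bounded_measurable :: "(real \<Rightarrow> real) \<Rightarrow> bool" where
  "bounded_measurable f \<longleftrightarrow> f \<in> borel_measurable borel \<and> (\<exists>C. \<forall>x. \<bar>f x\<bar> \<le> C)"

lemma bounded_measurableI: "f \<in> borel_measurable borel \<Longrightarrow> (\<And>x. \<bar>f x\<bar> \<le> C) \<Longrightarrow> bounded_measurable f"
  by (auto simp: bounded_measurable_def)

lemma bounded_measurableD: "bounded_measurable f \<Longrightarrow> f \<in> borel_measurable borel"
  by (simp add: bounded_measurable_def)

lemma bounded_measurable_const: "bounded_measurable (\<lambda>_. c)"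
  by (rule bounded_measurableI[of _ "\<bar>c\<bar>"]) auto

lemma bounded_measurable_add:
  assumes "bounded_measurable f" "bounded_measurable g"
  shows "bounded_measurable (\<lambda>x. f x + g x)"
proof -
  obtain C D where "\<And>x. \<bar>f x\<bar> \<le> C" "\<And>x. \<bar>g x\<bar> \<le> D" using assms by (auto simp: bounded_measurable_def)
  then have "\<bar>f x + g x\<bar> \<le> C + D" for x by (meson abs_triangle_ineq add_mono order_trans)
  then show ?thesis using assms[THEN bounded_measurableD]
    by (intro bounded_measurableI[where C = "C + D"]) auto
qed

lemma bounded_measurable_mult:
  assumes "bounded_measurable f" "bounded_measurable g"
  shows "bounded_measurable (\<lambda>x. f x * g x)"
proof -
  obtain C D where *: "\<And>x. \<bar>f x\<bar> \<le> C" "\<And>x. \<bar>g x\<bar> \<le> D" using assms by (auto simp: bounded_measurable_def)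
  then have "0 \<le> C" by (meson abs_ge_zero order_trans)
  then have "\<bar>f x * g x\<bar> \<le> C * D" for x using * by (auto simp: abs_mult intro!: mult_mono)
  then show ?thesis using assms[THEN bounded_measurableD]
    by (intro bounded_measurableI[where C = "C * D"]) auto
qed

lemma bounded_measurable_cmult: "bounded_measurable f \<Longrightarrow> bounded_measurable (\<lambda>x. c * f x)"
  using bounded_measurable_mult[OF bounded_measurable_const] by blast

lemma bounded_measurable_diff:
  "bounded_measurable f \<Longrightarrow> bounded_measurable g \<Longrightarrow> bounded_measurable (\<lambda>x. f x - g x)"
  using bounded_measurable_add[of f "\<lambda>x. - 1 * g x"] bounded_measurable_cmult[of g "- 1"] by simp

lemma bounded_measurable_sum:
  "(\<And>i. i \<in> I \<Longrightarrow> bounded_measurable (f i)) \<Longrightarrow> bounded_measurable (\<lambda>x. \<Sum>i\<in>I. f i x)"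
  by (induction I rule: infinite_finite_induct)
    (auto intro: bounded_measurable_const bounded_measurable_add)

text \<open>The position is clamped before the step and f sees the unreflected result, as in
  \<open>lindley_walk\<close>; the last reflection is left to the test function, for instance
  \<open>reflected_exp\<close>.\<close>

definition lindley_operator :: "real measure \<Rightarrow> (real \<Rightarrow> real) \<Rightarrow> real \<Rightarrow> real" where
  "lindley_operator \<mu> f x = (\<integral>s. f (max 0 x + s) \<partial>\<mu>)"

context real_distribution begin

lemma integrable_bounded_measurable_shift:
  assumes "bounded_measurable f"
  shows "integrable M (\<lambda>s. f (c + s))"
proof -
  obtain C where "\<And>x. \<bar>f x\<bar> \<le> C" and [measurable]: "f \<in> borel_measurable borel"
    using assms by (auto simp: bounded_measurable_def)
  then show ?thesis by (intro integrable_const_bound[where B = C]) auto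
qed

lemma lindley_operator_abs_le:
  assumes "f \<in> borel_measurable borel" "\<And>x. \<bar>f x\<bar> \<le> C"
  shows "\<bar>lindley_operator M f x\<bar> \<le> C"
proof -
  have i: "integrable M (\<lambda>s. f (max 0 x + s))"
    by (rule integrable_bounded_measurable_shift[OF bounded_measurableI[OF assms]])
  have "\<bar>lindley_operator M f x\<bar> \<le> (\<integral>s. \<bar>f (max 0 x + s)\<bar> \<partial>M)"
    unfolding lindley_operator_def by (rule integral_abs_bound)
  also have "\<dots> \<le> (\<integral>s. C \<partial>M)" using i assms by (intro integral_mono) auto
  finally show ?thesis using prob_space by simp
qed

lemma bounded_measurable_lindley_operator:
  assumes "bounded_measurable f"
  shows "bounded_measurable (lindley_operator M f)"
proof -
  obtain C where C: "\<And>x. \<bar>f x\<bar> \<le> C" and [measurable]: "f \<in> borel_measurable borel"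
    using assms by (auto simp: bounded_measurable_def)
  have "(\<lambda>x. \<integral>s. f (max 0 x + s) \<partial>M) \<in> borel_measurable borel"
    by (rule borel_measurable_lebesgue_integral) simp
  then show ?thesis
    by (intro bounded_measurableI[where C = C] lindley_operator_abs_le C)
      (simp_all add: lindley_operator_def[abs_def])
qed

lemma lindley_operator_linear:
  assumes "bounded_measurable f" "bounded_measurable g"
  shows "lindley_operator M (\<lambda>x. c * f x + d * g x) = (\<lambda>x. c * lindley_operator M f x + d * lindley_operator M g x)"
  using integrable_bounded_measurable_shift[OF assms(1)] integrable_bounded_measurable_shift[OF assms(2)]
  by (auto simp: lindley_operator_def fun_eq_iff)

lemma bounded_measurable_lindley_power:
  "bounded_measurable f \<Longrightarrow> bounded_measurable ((lindley_operator M ^^ k) f)"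
  by (induction k) (auto intro: bounded_measurable_lindley_operator)

lemma lindley_power_abs_le:
  assumes "bounded_measurable f" "\<And>x. \<bar>f x\<bar> \<le> C"
  shows "\<bar>(lindley_operator M ^^ k) f x\<bar> \<le> C"
  using assms bounded_measurable_lindley_power[OF assms(1)]
  by (induction k arbitrary: x) (auto intro!: lindley_operator_abs_le dest: bounded_measurableD)

lemma lindley_power_linear:
  assumes "bounded_measurable f" "bounded_measurable g"
  shows "(lindley_operator M ^^ k) (\<lambda>x. c * f x + d * g x)
    = (\<lambda>x. c * (lindley_operator M ^^ k) f x + d * (lindley_operator M ^^ k) g x)"
  by (induction k) (auto simp: lindley_operator_linear bounded_measurable_lindley_power assms)

lemma lindley_power_nonneg:
  assumes "\<And>x. 0 \<le> f x"
  shows "0 \<le> (lindley_operator M ^^ k) f x"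
  using assms by (induction k arbitrary: x) (auto simp: lindley_operator_def intro!: integral_nonneg_AE)

end

section \<open>Exponential times rounded up to the grid, and resolvents\<close>

definition exponential_law :: "real \<Rightarrow> real measure" where
  "exponential_law q = density lborel (\<lambda>t. ennreal (exponential_density q t))"

lemma real_distribution_exponential_law: "q > 0 \<Longrightarrow> real_distribution (exponential_law q)"
  unfolding real_distribution_def real_distribution_axioms_def exponential_law_def
  by (auto intro: prob_space_exponential_density)

definition grid_index :: "real \<Rightarrow> real \<Rightarrow> nat" where
  "grid_index h t = nat \<lceil>t / h\<rceil>"

lemma measurable_grid_index [measurable]: "grid_index h \<in> measurable borel (count_space UNIV)"
  unfolding grid_index_def[abs_def] by measurable

text \<open>The rounded time is geometric on 1, 2, ...: up to h the index is 1, and beyond h the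
  substitution t \<mapsto> h + t costs the factor exp (- q h) and raises the index by 1.\<close>

lemma exponential_law_grid_memoryless:
  fixes F :: "nat \<Rightarrow> real"
  assumes q: "q > 0" and h: "h > 0" and F: "\<And>k. \<bar>F k\<bar> \<le> C"
  shows "(\<integral>t. F (grid_index h t) \<partial>exponential_law q)
    = (1 - exp (- q * h)) * F 1 + exp (- q * h) * (\<integral>t. F (Suc (grid_index h t)) \<partial>exponential_law q)"
proof -
  interpret E: real_distribution "exponential_law q" using q by (rule real_distribution_exponential_law)
  define A where "A = (\<integral>t. exponential_density q t * indicator {..h} t \<partial>lborel)"
  have dens: "(\<integral>t. g t \<partial>exponential_law q) = (\<integral>t. exponential_density q t * g t \<partial>lborel)"
    if "g \<in> borel_measurable borel" for g :: "real \<Rightarrow> real"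
    unfolding exponential_law_def using that q
    by (subst integral_density) (auto simp: exponential_density_def)
  have dens_int: "integrable lborel (\<lambda>t. exponential_density q t * g t)"
    if "g \<in> borel_measurable borel" "\<And>t. \<bar>g t\<bar> \<le> C" for g :: "real \<Rightarrow> real" and C
  proof -
    have "integrable (exponential_law q) g"
      using that by (intro E.integrable_const_bound[where B = C]) auto
    then show ?thesis
      unfolding exponential_law_def using that q
      by (subst (asm) integrable_density) (auto simp: exponential_density_def)
  qed
  have gen: "(\<integral>t. F (grid_index h t) \<partial>exponential_law q)
      = A * F 1 + exp (- q * h) * (\<integral>t. F (Suc (grid_index h t)) \<partial>exponential_law q)"
    if F: "\<And>k. \<bar>F k\<bar> \<le> C" for F :: "nat \<Rightarrow> real" and C
  proof -
    let ?e = "exponential_density q"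
    have Fm: "(\<lambda>t. F (grid_index h t)) \<in> borel_measurable borel" "(\<lambda>t. F (Suc (grid_index h t))) \<in> borel_measurable borel"
      by (auto intro!: measurable_compose[OF measurable_grid_index])
    have eq: "?e t * F (grid_index h t)
        = ?e t * (F (grid_index h t) * indicator {..h} t) + ?e t * (F (grid_index h t) * indicator {h<..} t)" for t
      by (auto simp: indicator_def)
    have "(\<integral>t. F (grid_index h t) \<partial>exponential_law q)
       = (\<integral>t. ?e t * (F (grid_index h t) * indicator {..h} t) \<partial>lborel)
         + (\<integral>t. ?e t * (F (grid_index h t) * indicator {h<..} t) \<partial>lborel)"
      unfolding dens[OF Fm(1)] eq using Fm(1) F
      by (intro Bochner_Integration.integral_add dens_int[of _ C])
        (auto simp: indicator_def intro: order_trans[OF abs_ge_zero])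
    also have "(\<integral>t. ?e t * (F (grid_index h t) * indicator {..h} t) \<partial>lborel) = (\<integral>t. (?e t * indicator {..h} t) * F 1 \<partial>lborel)"
    proof (rule integral_cong_AE)
      show "AE t in lborel. ?e t * (F (grid_index h t) * indicator {..h} t) = (?e t * indicator {..h} t) * F 1"
        \<comment> \<open>At t = 0 the index is 0 instead of 1, which only matters on a null
          set.\<close>
        using AE_lborel_singleton[of 0]
      proof eventually_elim
        case (elim t)
        have "grid_index h t = 1" if "0 < t" "t \<le> h"
        proof -
          have "0 < t / h" "t / h \<le> 1" using that by auto
          then have "\<lceil>t / h\<rceil> = 1" by linarith
          then show ?thesis by (simp add: grid_index_def)
        qed
        then show ?case using elim by (auto simp: indicator_def exponential_density_def)
      qed
    qed (use Fm in \<open>auto\<close>)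
    also have "\<dots> = A * F 1" unfolding A_def by simp
    also have "(\<integral>t. ?e t * (F (grid_index h t) * indicator {h<..} t) \<partial>lborel)
      = (\<integral>t. ?e (h + 1 * t) * (F (grid_index h (h + 1 * t)) * indicator {h<..} (h + 1 * t)) \<partial>lborel)"
      by (subst lborel_integral_real_affine[where c = 1 and t = h]) auto
    also have "\<dots> = (\<integral>t. exp (- q * h) * (?e t * F (Suc (grid_index h t))) \<partial>lborel)"
    proof (rule integral_cong_AE)
      show "AE t in lborel. ?e (h + 1 * t) * (F (grid_index h (h + 1 * t)) * indicator {h<..} (h + 1 * t))
          = exp (- q * h) * (?e t * F (Suc (grid_index h t)))"
        using AE_lborel_singleton[of 0]
      proof eventually_elim
        case (elim t)
        have "grid_index h (h + t) = Suc (grid_index h t)" if "0 < t"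
        proof -
          have "(h + t) / h = t / h + 1" using h by (simp add: field_simps)
          moreover have "0 < t / h" using that h by simp
          then have "0 < \<lceil>t / h\<rceil>" by simp
          ultimately show ?thesis by (simp add: grid_index_def nat_add_distrib)
        qed
        moreover have "exp ((- h - t) * q) = exp (- q * h) * exp (- (t * q))"
          by (simp add: mult_exp_exp algebra_simps)
        ultimately show ?case using elim h by (auto simp: indicator_def exponential_density_def)
      qed
    qed (use Fm in \<open>auto\<close>)
    also have "\<dots> = exp (- q * h) * (\<integral>t. F (Suc (grid_index h t)) \<partial>exponential_law q)"
      by (simp add: dens[OF Fm(2)])
    finally show ?thesis .
  qed
  \<comment> \<open>The identity for the constant function 1 evaluates A without computing an
    integral.\<close>
  from gen[of "\<lambda>_. 1" 1] have "A = 1 - exp (- q * h)"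
    using E.prob_space by simp
  then show ?thesis using gen[of F C, OF F] by (simp only:)
qed

definition grid_resolvent :: "real measure \<Rightarrow> real \<Rightarrow> real \<Rightarrow> (real \<Rightarrow> real) \<Rightarrow> real \<Rightarrow> real" where
  "grid_resolvent \<mu> q h f x = (\<integral>t. (lindley_operator \<mu> ^^ grid_index h t) f x \<partial>exponential_law q)"

definition reflected_exp :: "real \<Rightarrow> real \<Rightarrow> real" where
  "reflected_exp a x = exp (- a * max 0 x)"

text \<open>Comes from \<open>exp (- a * max 0 z) = exp (- a * z) - (exp (a * max 0 (- z)) - 1)\<close>.\<close>

definition reflection_cost :: "real measure \<Rightarrow> real \<Rightarrow> real \<Rightarrow> real" where
  "reflection_cost \<mu> a x = (\<integral>s. exp (a * max 0 (- (max 0 x + s))) - 1 \<partial>\<mu>)"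

lemma bounded_measurable_reflected_exp: "a \<ge> 0 \<Longrightarrow> bounded_measurable (reflected_exp a)"
  by (rule bounded_measurableI[where C = 1]) (auto simp: reflected_exp_def[abs_def])

lemma reflected_exp_bounds: "a \<ge> 0 \<Longrightarrow> 0 \<le> reflected_exp a x \<and> reflected_exp a x \<le> 1"
  by (simp add: reflected_exp_def)

context real_distribution begin

lemma integrable_lindley_power_grid_index:
  assumes f: "bounded_measurable f" and q: "q > 0"
  shows "integrable (exponential_law q) (\<lambda>t. (lindley_operator M ^^ grid_index h t) f x)"
proof -
  interpret E: real_distribution "exponential_law q" using q by (rule real_distribution_exponential_law)
  obtain C where "\<And>x. \<bar>f x\<bar> \<le> C" using f by (auto simp: bounded_measurable_def)
  then show ?thesis
    using lindley_power_abs_le[OF f]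
    by (intro E.integrable_const_bound[where B = C])
      (auto intro!: measurable_compose[OF measurable_grid_index])
qed

lemma grid_resolvent_linear:
  assumes f: "bounded_measurable f" "bounded_measurable g" and q: "q > 0"
  shows "grid_resolvent M q h (\<lambda>x. c * f x + d * g x) x = c * grid_resolvent M q h f x + d * grid_resolvent M q h g x"
  using integrable_lindley_power_grid_index[OF f(1) q] integrable_lindley_power_grid_index[OF f(2) q]
  by (simp add: grid_resolvent_def lindley_power_linear f)

lemma grid_resolvent_nonneg:
  assumes "\<And>x. 0 \<le> f x"
  shows "0 \<le> grid_resolvent M q h f x"
  unfolding grid_resolvent_def by (intro integral_nonneg_AE AE_I2 lindley_power_nonneg assms)

lemma grid_resolvent_abs_le:
  assumes f: "bounded_measurable f" "\<And>x. \<bar>f x\<bar> \<le> C" and q: "q > 0"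
  shows "\<bar>grid_resolvent M q h f x\<bar> \<le> C"
proof -
  interpret E: real_distribution "exponential_law q" using q by (rule real_distribution_exponential_law)
  note i = integrable_lindley_power_grid_index[OF f(1) q, of h x]
  have "\<bar>grid_resolvent M q h f x\<bar> \<le> (\<integral>t. \<bar>(lindley_operator M ^^ grid_index h t) f x\<bar> \<partial>exponential_law q)"
    unfolding grid_resolvent_def by (rule integral_abs_bound)
  also have "\<dots> \<le> (\<integral>t. C \<partial>exponential_law q)"
    using i lindley_power_abs_le[OF f] by (intro integral_mono) auto
  finally show ?thesis using E.prob_space by simp
qed

lemma bounded_measurable_grid_resolvent:
  assumes f: "bounded_measurable f" and q: "q > 0"
  shows "bounded_measurable (grid_resolvent M q h f)"
proof -
  interpret E: real_distribution "exponential_law q" using q by (rule real_distribution_exponential_law)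
  obtain C where C: "\<And>x. \<bar>f x\<bar> \<le> C" using f by (auto simp: bounded_measurable_def)
  have [measurable]: "(lindley_operator M ^^ k) f \<in> borel_measurable borel" for k
    using f by (intro bounded_measurableD bounded_measurable_lindley_power)
  have "(\<lambda>(x, t). (lindley_operator M ^^ grid_index h t) f x) \<in> borel_measurable (borel \<Otimes>\<^sub>M exponential_law q)"
    unfolding split_beta'
    by (rule measurable_compose_countable[where f = "\<lambda>k p. (lindley_operator M ^^ k) f (fst p)" and g = "\<lambda>p. grid_index h (snd p)"])
      measurable
  then show ?thesis
    using grid_resolvent_abs_le[OF f C q] unfolding grid_resolvent_def[abs_def]
    by (intro bounded_measurableI[where C = C] E.borel_measurable_lebesgue_integral) (auto simp: grid_resolvent_def)
qed

lemma grid_resolvent_memoryless: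
  assumes f: "bounded_measurable f" and q: "q > 0" and h: "h > 0"
  shows "grid_resolvent M q h f x
    = (1 - exp (- q * h)) * lindley_operator M f x + exp (- q * h) * grid_resolvent M q h (lindley_operator M f) x"
proof -
  obtain C where C: "\<And>x. \<bar>f x\<bar> \<le> C" using f by (auto simp: bounded_measurable_def)
  show ?thesis
    unfolding grid_resolvent_def
    using exponential_law_grid_memoryless[OF q h, of "\<lambda>k. (lindley_operator M ^^ k) f x" C] lindley_power_abs_le[OF f C]
    by (simp add: funpow_swap1)
qed

lemma integrable_reflection_cost:
  assumes "a \<ge> 0" and exp: "integrable M (\<lambda>s. exp (- a * s))"
  shows "integrable M (\<lambda>s. exp (a * max 0 (- (max 0 x + s))) - 1)"
proof (rule Bochner_Integration.integrable_bound[OF exp])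
  show "AE s in M. norm (exp (a * max 0 (- (max 0 x + s))) - 1) \<le> norm (exp (- a * s))"
  proof (rule AE_I2)
    fix s :: real
    have "exp (a * max 0 (- (max 0 x + s))) - 1 \<le> exp (- a * s)"
    proof (cases "max 0 x + s \<ge> 0")
      case False
      then have "a * max 0 (- (max 0 x + s)) \<le> - a * s"
        using assms(1) mult_left_mono[of "- (max 0 x + s)" "- s" a] by simp
      then have "exp (a * max 0 (- (max 0 x + s))) \<le> exp (- a * s)" by (subst exp_le_cancel_iff)
      then show ?thesis by linarith
    qed simp
    moreover have "1 \<le> exp (a * max 0 (- (max 0 x + s)))" using assms(1) by simp
    ultimately show "norm (exp (a * max 0 (- (max 0 x + s))) - 1) \<le> norm (exp (- a * s))" by simp
  qed
qed simp

lemma lindley_operator_reflected_exp: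
  assumes a: "a \<ge> 0" and exp: "integrable M (\<lambda>s. exp (- a * s))"
  shows "lindley_operator M (reflected_exp a) x
    = (\<integral>s. exp (- a * s) \<partial>M) * reflected_exp a x - reflection_cost M a x"
proof -
  have "reflected_exp a (max 0 x + s)
     = exp (- a * s) * reflected_exp a x - (exp (a * max 0 (- (max 0 x + s))) - 1)" for s
  proof -
    have "exp (- a * max 0 (m + s)) = exp (- a * s) * exp (- a * m) - (exp (a * max 0 (- (m + s))) - 1)" for m
    proof (cases "m + s \<ge> 0")
      case True
      then have "max 0 (m + s) = m + s" "max 0 (- (m + s)) = 0" by auto
      then show ?thesis by (simp add: mult_exp_exp algebra_simps)
    next
      case False
      then have "max 0 (m + s) = 0" "max 0 (- (m + s)) = - (m + s)" by auto
      then show ?thesis by (simp only: mult_exp_exp) (simp add: algebra_simps)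
    qed
    then show ?thesis by (simp add: reflected_exp_def)
  qed
  then show ?thesis
    unfolding lindley_operator_def reflection_cost_def
    using exp integrable_reflection_cost[OF assms] by simp
qed

lemma bounded_measurable_reflection_cost:
  assumes a: "a \<ge> 0" and exp: "integrable M (\<lambda>s. exp (- a * s))"
  shows "bounded_measurable (reflection_cost M a)"
proof -
  have "reflection_cost M a = (\<lambda>x. (\<integral>s. exp (- a * s) \<partial>M) * reflected_exp a x - lindley_operator M (reflected_exp a) x)"
    using lindley_operator_reflected_exp[OF assms] by (simp add: fun_eq_iff)
  then show ?thesis
    using bounded_measurable_reflected_exp[OF a]
    by (simp add: bounded_measurable_diff bounded_measurable_cmult bounded_measurable_lindley_operator)
qed

text \<open>The mean of f after N - 1 Lindley steps, N the geometric index: a cost belongs to a step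
  and depends on the state before that step.\<close>

definition cost_resolvent :: "real \<Rightarrow> real \<Rightarrow> (real \<Rightarrow> real) \<Rightarrow> real \<Rightarrow> real" where
  "cost_resolvent q h f x = (1 - exp (- q * h)) * f x + exp (- q * h) * grid_resolvent M q h f x"

text \<open>The first-step identity, with the resolvent collected on the left. Its factor is not
  divided out, because it is 0 exactly in the case that evaluates the cost term.\<close>

lemma grid_resolvent_reflected_exp:
  assumes a: "a \<ge> 0" and exp: "integrable M (\<lambda>s. exp (- a * s))" and q: "q > 0" and h: "h > 0"
  defines "\<rho> \<equiv> \<integral>s. exp (- a * s) \<partial>M"
  shows "(1 - exp (- q * h) * \<rho>) * grid_resolvent M q h (reflected_exp a) x
    = (1 - exp (- q * h)) * \<rho> * reflected_exp a x - cost_resolvent q h (reflection_cost M a) x"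
proof -
  note E = bounded_measurable_reflected_exp[OF a] and b = bounded_measurable_reflection_cost[OF a exp]
  have L: "lindley_operator M (reflected_exp a) = (\<lambda>x. \<rho> * reflected_exp a x + (- 1) * reflection_cost M a x)"
    using lindley_operator_reflected_exp[OF a exp] by (simp add: fun_eq_iff \<rho>_def)
  show ?thesis
    using grid_resolvent_memoryless[OF E q h, of x]
    unfolding L grid_resolvent_linear[OF E b q] cost_resolvent_def
    by (simp add: algebra_simps)
qed

text \<open>Positivity: the operator is applied to the nonnegative functions c g + d - f and c g + d
  + f, and it fixes constants.\<close>

lemma cost_resolvent_mono_bound:
  assumes f: "bounded_measurable f" and g: "bounded_measurable g" and q: "q > 0" and h: "h > 0"
    and le: "\<And>x. \<bar>f x\<bar> \<le> c * g x + d"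
  shows "\<bar>cost_resolvent q h f x\<bar> \<le> c * cost_resolvent q h g x + d"
proof -
  interpret E: real_distribution "exponential_law q" using q by (rule real_distribution_exponential_law)
  note lin = grid_resolvent_linear[OF _ _ q] and bm = bounded_measurable_add bounded_measurable_cmult bounded_measurable_const f g
  have const: "grid_resolvent M q h (\<lambda>_. d) x = d" for d
  proof -
    have "(lindley_operator M ^^ k) (\<lambda>_. d) = (\<lambda>_. d)" for k
      by (induction k) (auto simp: lindley_operator_def fun_eq_iff prob_space[simplified])
    then show ?thesis using E.prob_space by (simp add: grid_resolvent_def)
  qed
  have main: "s * cost_resolvent q h f x \<le> c * cost_resolvent q h g x + d" if "s \<in> {1, - 1}" for s
  proof -
    define u where "u x = 1 * (c * g x + 1 * d) + (- s) * f x" for x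
    have u0: "0 \<le> u x" for x using le[of x] that by (auto simp: u_def)
    have "grid_resolvent M q h u x = 1 * grid_resolvent M q h (\<lambda>x. c * g x + 1 * d) x + (- s) * grid_resolvent M q h f x"
      unfolding u_def[abs_def] by (intro lin) (simp_all add: bm)
    also have "grid_resolvent M q h (\<lambda>x. c * g x + 1 * d) x = c * grid_resolvent M q h g x + 1 * grid_resolvent M q h (\<lambda>_. d) x"
      by (intro lin) (simp_all add: bm)
    finally have "0 \<le> c * grid_resolvent M q h g x + d - s * grid_resolvent M q h f x"
      using grid_resolvent_nonneg[of u q h x] u0 const by simp
    moreover have "0 \<le> c * g x + d - s * f x" using u0[of x] by (simp add: u_def)
    moreover define r where "r = exp (- q * h)"
    moreover have "0 \<le> r" "r \<le> 1" using q h by (auto simp: r_def)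
    ultimately have "0 \<le> (1 - r) * (c * g x + d - s * f x) + r * (c * grid_resolvent M q h g x + d - s * grid_resolvent M q h f x)"
      by (intro add_nonneg_nonneg mult_nonneg_nonneg) auto
    then show ?thesis unfolding cost_resolvent_def r_def[symmetric] by (simp add: algebra_simps)
  qed
  from main[of 1] main[of "- 1"] show ?thesis by (simp add: abs_le_iff)
qed

lemma cost_resolvent_diff:
  assumes f: "bounded_measurable f" and g: "bounded_measurable g" and q: "q > 0"
  shows "cost_resolvent q h (\<lambda>x. f x - c * g x) x = cost_resolvent q h f x - c * cost_resolvent q h g x"
proof -
  have "grid_resolvent M q h (\<lambda>x. f x - c * g x) x = grid_resolvent M q h f x - c * grid_resolvent M q h g x"
    using grid_resolvent_linear[OF f g q, of h 1 "- c" x] by simp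
  then show ?thesis unfolding cost_resolvent_def by (simp only:) (simp add: algebra_simps)
qed

end

section \<open>Comparison of reflection costs and the limit at one exponential time\<close>

text \<open>Both exp (a z) - 1 and (a / \<psi>) (exp (\<psi> z) - 1) are a z up to O(z^2), so for
  small z their difference is below \<epsilon> \<psi> z. Beyond \<delta> a crude exponential bound
  suffices, because such z carry negligible mass.\<close>

lemma exp_ratio_bound:
  fixes a \<psi> \<epsilon> :: real
  assumes a: "a \<ge> 0" and \<psi>: "\<psi> > 0" and \<epsilon>: "\<epsilon> > 0"
  shows "\<exists>\<delta>>0. \<exists>C\<ge>0. \<forall>z\<ge>0. \<bar>(exp (a * z) - 1) - a / \<psi> * (exp (\<psi> * z) - 1)\<bar>
      \<le> \<epsilon> * (exp (\<psi> * z) - 1) + C * (if z > \<delta> then exp ((a + \<psi>) * z) else 0)"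
proof -
  \<comment> \<open>B - 1 is the coefficient of z^2 left by the two Taylor remainders for z \<le> 1;
    adding 1 makes B positive, and \<delta> is chosen with \<delta> B \<le> \<epsilon>
    \<psi>.\<close>
  define B where "B = a\<^sup>2 * exp a + a * \<psi> * exp \<psi> + 1"
  have B: "B > 0" using a \<psi> by (simp add: B_def add_nonneg_pos)
  define \<delta> where "\<delta> = min 1 (\<epsilon> * \<psi> / B)"
  define C where "C = 1 + a / \<psi>"
  have "\<delta> \<le> \<epsilon> * \<psi> / B" unfolding \<delta>_def by (rule min.cobounded2)
  then have "\<delta> * B \<le> \<epsilon> * \<psi>" using B by (simp only: pos_le_divide_eq)
  moreover have "0 < \<delta>" "\<delta> \<le> 1" using B \<epsilon> \<psi> by (simp_all add: \<delta>_def)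
  ultimately have \<delta>: "0 < \<delta>" "\<delta> \<le> 1" "\<delta> * B \<le> \<epsilon> * \<psi>" by blast+
  have C: "C \<ge> 0" using a \<psi> by (simp add: C_def)
  have "\<bar>(exp (a * z) - 1) - a / \<psi> * (exp (\<psi> * z) - 1)\<bar>
      \<le> \<epsilon> * (exp (\<psi> * z) - 1) + C * (if z > \<delta> then exp ((a + \<psi>) * z) else 0)" if z: "z \<ge> 0" for z
  proof (cases "z > \<delta>")
    case True
    have 1: "0 \<le> exp (a * z) - 1" "exp (a * z) - 1 \<le> exp ((a + \<psi>) * z)"
    proof -
      have "exp (a * z) \<le> exp ((a + \<psi>) * z)" using \<psi> z by (simp add: mult_right_mono)
      then show "exp (a * z) - 1 \<le> exp ((a + \<psi>) * z)" by linarith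
    qed (use a z in simp)
    have 2: "0 \<le> exp (\<psi> * z) - 1" "exp (\<psi> * z) - 1 \<le> exp ((a + \<psi>) * z)"
    proof -
      have "exp (\<psi> * z) \<le> exp ((a + \<psi>) * z)" using a z by (simp add: mult_right_mono)
      then show "exp (\<psi> * z) - 1 \<le> exp ((a + \<psi>) * z)" by linarith
    qed (use \<psi> z in simp)
    have "\<bar>(exp (a * z) - 1) - a / \<psi> * (exp (\<psi> * z) - 1)\<bar> \<le> \<bar>exp (a * z) - 1\<bar> + \<bar>a / \<psi> * (exp (\<psi> * z) - 1)\<bar>"
      by (rule abs_triangle_ineq4)
    also have "\<dots> = (exp (a * z) - 1) + a / \<psi> * (exp (\<psi> * z) - 1)"
      using 1 2 a \<psi> by (simp add: abs_mult)
    also have "\<dots> \<le> exp ((a + \<psi>) * z) + a / \<psi> * exp ((a + \<psi>) * z)"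
      using 1 2 a \<psi> by (intro add_mono mult_left_mono) auto
    also have "\<dots> = C * exp ((a + \<psi>) * z)" by (simp add: C_def algebra_simps)
    also have "\<dots> \<le> \<epsilon> * (exp (\<psi> * z) - 1) + C * exp ((a + \<psi>) * z)" using 2 \<epsilon> by simp
    finally show ?thesis using True by simp
  next
    case False
    then have z1: "z \<le> \<delta>" "z \<le> 1" using \<delta> by auto
    have "\<bar>(exp (a * z) - 1) - a / \<psi> * (exp (\<psi> * z) - 1)\<bar>
        = \<bar>(exp (a * z) - 1 - a * z) - a / \<psi> * (exp (\<psi> * z) - 1 - \<psi> * z)\<bar>"
      using \<psi> by (simp add: field_simps)
    also have "\<dots> \<le> \<bar>exp (a * z) - 1 - a * z\<bar> + \<bar>a / \<psi> * (exp (\<psi> * z) - 1 - \<psi> * z)\<bar>"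
      by (rule abs_triangle_ineq4)
    also have "\<dots> = \<bar>exp (a * z) - 1 - a * z\<bar> + a / \<psi> * \<bar>exp (\<psi> * z) - 1 - \<psi> * z\<bar>"
      using a \<psi> by (simp add: abs_mult)
    also have "\<dots> \<le> (a * z)\<^sup>2 * exp a + a / \<psi> * ((\<psi> * z)\<^sup>2 * exp \<psi>)"
    proof (intro add_mono mult_left_mono)
      have mono: "w\<^sup>2 * exp \<bar>w\<bar> \<le> w\<^sup>2 * exp c" if "\<bar>w\<bar> \<le> c" for w c :: real
        using that by (intro mult_left_mono) auto
      have "\<bar>a * z\<bar> \<le> a" "\<bar>\<psi> * z\<bar> \<le> \<psi>"
        using a \<psi> z z1 by (auto simp: abs_mult mult_left_le)
      then show "\<bar>exp (a * z) - 1 - a * z\<bar> \<le> (a * z)\<^sup>2 * exp a" "\<bar>exp (\<psi> * z) - 1 - \<psi> * z\<bar> \<le> (\<psi> * z)\<^sup>2 * exp \<psi>"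
        using order_trans[OF exp_taylor_bound mono] by blast+
    qed (use a \<psi> in auto)
    also have "\<dots> = z * (z * (B - 1))"
      using \<psi> by (simp add: B_def power2_eq_square field_simps)
    also have "\<dots> \<le> z * (\<delta> * B)"
    proof (intro mult_left_mono mult_mono)
      have "0 \<le> B - 1" using a \<psi> by (simp add: B_def)
      then show "0 \<le> B - 1" .
    qed (use z z1 \<delta> in auto)
    also have "\<dots> \<le> z * (\<epsilon> * \<psi>)" using z \<delta> by (intro mult_left_mono) auto
    also have "\<dots> = \<epsilon> * (\<psi> * z)" by simp
    also have "\<dots> \<le> \<epsilon> * (exp (\<psi> * z) - 1)"
    proof (rule mult_left_mono)
      show "\<psi> * z \<le> exp (\<psi> * z) - 1" using exp_ge_add_one_self[of "\<psi> * z"] by linarith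
    qed (use \<epsilon> in simp)
    finally show ?thesis using False by simp
  qed
  then show ?thesis using \<delta>(1) C by blast
qed

lemma (in levy_process) real_distribution_step_law: "real_distribution (step_law m)"
  unfolding real_distribution_def real_distribution_axioms_def
  using prob_space_step_law by simp

text \<open>The pointwise bound is integrated with z the depth below zero. As max 0 x \<ge> 0, z >
  \<delta> forces s < -\<delta> and z \<le> - s, so the tail integral does not involve x; this is
  the source of uniformity in the starting point.\<close>

lemma (in real_distribution) reflection_cost_compare:
  assumes a: "a \<ge> 0" and \<psi>: "\<psi> > 0" and C: "C \<ge> 0"
    and exp: "\<And>b. b \<ge> 0 \<Longrightarrow> integrable M (\<lambda>s. exp (- b * s))"
    and \<delta>: "\<delta> > 0"
    and ratio: "\<And>z. z \<ge> 0 \<Longrightarrow> \<bar>(exp (a * z) - 1) - a / \<psi> * (exp (\<psi> * z) - 1)\<bar>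
      \<le> \<epsilon> * (exp (\<psi> * z) - 1) + C * (if z > \<delta> then exp ((a + \<psi>) * z) else 0)"
  shows "\<bar>reflection_cost M a x - a / \<psi> * reflection_cost M \<psi> x\<bar>
    \<le> \<epsilon> * reflection_cost M \<psi> x + C * (\<integral>s. exp (- (a + \<psi>) * s) * indicator {..< - \<delta>} s \<partial>M)"
proof -
  define z where "z s = max 0 (- (max 0 x + s))" for s
  have ia: "integrable M (\<lambda>s. exp (a * z s) - 1)" and i\<psi>: "integrable M (\<lambda>s. exp (\<psi> * z s) - 1)"
    unfolding z_def using a \<psi> by (intro integrable_reflection_cost exp; simp)+
  have it: "integrable M (\<lambda>s. exp (- (a + \<psi>) * s) * indicator {..< - \<delta>} s)"
    using a \<psi> by (intro integrable_real_mult_indicator exp) auto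
  have "reflection_cost M a x - a / \<psi> * reflection_cost M \<psi> x
      = (\<integral>s. (exp (a * z s) - 1) - a / \<psi> * (exp (\<psi> * z s) - 1) \<partial>M)"
    unfolding reflection_cost_def z_def[symmetric] using ia i\<psi>
    by (subst Bochner_Integration.integral_diff) (simp_all only: integrable_mult_right integral_mult_right_zero)
  also have "\<bar>\<dots>\<bar> \<le> (\<integral>s. \<bar>(exp (a * z s) - 1) - a / \<psi> * (exp (\<psi> * z s) - 1)\<bar> \<partial>M)"
    by (rule integral_abs_bound)
  also have "\<dots> \<le> (\<integral>s. \<epsilon> * (exp (\<psi> * z s) - 1) + C * (exp (- (a + \<psi>) * s) * indicator {..< - \<delta>} s) \<partial>M)"
  proof (rule integral_mono)
    show "integrable M (\<lambda>s. \<bar>(exp (a * z s) - 1) - a / \<psi> * (exp (\<psi> * z s) - 1)\<bar>)"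
      by (rule integrable_abs[OF Bochner_Integration.integrable_diff[OF ia integrable_mult_right[OF i\<psi>]]])
    show "integrable M (\<lambda>s. \<epsilon> * (exp (\<psi> * z s) - 1) + C * (exp (- (a + \<psi>) * s) * indicator {..< - \<delta>} s))"
      by (rule Bochner_Integration.integrable_add[OF integrable_mult_right[OF i\<psi>] integrable_mult_right[OF it]])
    fix s
    have "(if z s > \<delta> then exp ((a + \<psi>) * z s) else 0) \<le> exp (- (a + \<psi>) * s) * indicator {..< - \<delta>} s"
    proof (cases "z s > \<delta>")
      case True
      then have "s < - \<delta>" "z s \<le> - s" using \<delta> by (auto simp: z_def max_def split: if_splits)
      moreover from this have "(a + \<psi>) * z s \<le> (a + \<psi>) * (- s)" using a \<psi> by (intro mult_left_mono) auto
      then have "exp ((a + \<psi>) * z s) \<le> exp (- (a + \<psi>) * s)" by (simp add: algebra_simps)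
      ultimately show ?thesis by (simp del: minus_add_distrib mult_minus_left exp_le_cancel_iff)
    qed simp
    then have "C * (if z s > \<delta> then exp ((a + \<psi>) * z s) else 0) \<le> C * (exp (- (a + \<psi>) * s) * indicator {..< - \<delta>} s)"
      using C by (intro mult_left_mono)
    then show "\<bar>(exp (a * z s) - 1) - a / \<psi> * (exp (\<psi> * z s) - 1)\<bar>
        \<le> \<epsilon> * (exp (\<psi> * z s) - 1) + C * (exp (- (a + \<psi>) * s) * indicator {..< - \<delta>} s)"
      using ratio[of "z s"] by (simp add: z_def del: mult_minus_left minus_add_distrib)
  qed
  also have "\<dots> = \<epsilon> * reflection_cost M \<psi> x + C * (\<integral>s. exp (- (a + \<psi>) * s) * indicator {..< - \<delta>} s \<partial>M)"
    unfolding reflection_cost_def z_def[symmetric] using it i\<psi>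
    by (subst Bochner_Integration.integral_add) (simp_all only: integrable_mult_right integral_mult_right_zero)
  finally show ?thesis .
qed

context spectrally_positive_levy_process begin

text \<open>The factor \<open>d m\<close> in front of the resolvent is of order 2 ^ (-m) and has the
  sign of D, which may be negative. After division there remain two coefficient errors, a multiple
  of \<epsilon>, and the tail integral over \<open>d m\<close>, all free of x.\<close>

lemma grid_resolvent_step_law_uniform_limit:
  fixes a q \<psi> :: real
  defines "\<phi> \<equiv> laplace_exponent M X"
  assumes a: "a \<ge> 0" and q: "q > 0" and \<psi>: "\<psi> > 0" "\<phi> \<psi> = q" and a_reg: "\<phi> a \<noteq> q" and e: "e > 0"
  shows "eventually (\<lambda>m. \<forall>x. \<bar>grid_resolvent (step_law m) q (1 / 2 ^ m) (reflected_exp a) x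
      - q / (q - \<phi> a) * (reflected_exp a x - a / \<psi> * reflected_exp \<psi> x)\<bar> \<le> e) sequentially"
proof -
  define D where "D = q - \<phi> a"
  have D: "D \<noteq> 0" using a_reg by (simp add: D_def)
  \<comment> \<open>The only error that does not vanish is \<epsilon> * \<bar>q / D\<bar>, which
    this choice makes equal to e / 4.\<close>
  define \<epsilon> where "\<epsilon> = e * \<bar>D\<bar> / (4 * q)"
  have \<epsilon>: "\<epsilon> > 0" using e q D by (simp add: \<epsilon>_def)
  obtain \<delta> C where \<delta>: "\<delta> > 0" and C: "C \<ge> 0" and ratio: "\<And>z. z \<ge> 0 \<Longrightarrow>
      \<bar>(exp (a * z) - 1) - a / \<psi> * (exp (\<psi> * z) - 1)\<bar>
      \<le> \<epsilon> * (exp (\<psi> * z) - 1) + C * (if z > \<delta> then exp ((a + \<psi>) * z) else 0)"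
    using exp_ratio_bound[OF a \<psi>(1) \<epsilon>] by blast
  define r \<rho> \<sigma> where "r m = exp (- q / 2 ^ m)" and "\<rho> m = exp (\<phi> a / 2 ^ m)" and "\<sigma> m = exp (q / 2 ^ m)" for m :: nat
  define \<tau> where "\<tau> m = (\<integral>s. exp (- (a + \<psi>) * s) * indicator {..< - \<delta>} s \<partial>step_law m)" for m
  define d where "d m = 1 - r m * \<rho> m" for m
  have d_eq: "d m = 1 - exp (- D / 2 ^ m)" for m
    by (simp add: d_def r_def \<rho>_def D_def mult_exp_exp field_simps)
  have d0: "d m \<noteq> 0" for m using D by (simp add: d_eq)
  have main: "\<bar>grid_resolvent (step_law m) q (1 / 2 ^ m) (reflected_exp a) x
      - q / (q - \<phi> a) * (reflected_exp a x - a / \<psi> * reflected_exp \<psi> x)\<bar>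
      \<le> \<bar>(1 - r m) * \<rho> m / d m - q / D\<bar> + a / \<psi> * \<bar>(1 - r m) * \<sigma> m / d m - q / D\<bar>
        + (\<epsilon> * \<bar>(1 - r m) * \<sigma> m / d m\<bar> + C * (\<tau> m / \<bar>d m\<bar>))" for m x
  proof -
    interpret \<mu>: real_distribution "step_law m" by (rule real_distribution_step_law)
    let ?h = "1 / 2 ^ m :: real"
    let ?b = "reflection_cost (step_law m)" and ?V = "\<mu>.cost_resolvent q ?h"
    have h: "?h > 0" by simp
    have \<psi>0: "0 \<le> \<psi>" using \<psi> by simp
    note exp = integrable_exp_step_law[of _ m]
    note bm = \<mu>.bounded_measurable_reflection_cost[OF a exp[OF a]] \<mu>.bounded_measurable_reflection_cost[OF \<psi>0 exp[OF \<psi>0]]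
    have r: "exp (- q * ?h) = r m" by (simp add: r_def)
    have r1: "0 \<le> 1 - r m" using q by (simp add: r_def)
    have \<rho>1: "(\<integral>s. exp (- a * s) \<partial>step_law m) = \<rho> m" using integral_exp_step_law[OF a] by (simp only: \<rho>_def \<phi>_def)
    have \<rho>2: "(\<integral>s. exp (- \<psi> * s) \<partial>step_law m) = \<sigma> m" using integral_exp_step_law[OF \<psi>0] \<psi>(2) by (simp only: \<sigma>_def \<phi>_def)
    have Ua: "d m * grid_resolvent (step_law m) q ?h (reflected_exp a) x = (1 - r m) * \<rho> m * reflected_exp a x - ?V (?b a) x"
      using \<mu>.grid_resolvent_reflected_exp[OF a exp[OF a] q h, of x] unfolding r \<rho>1 d_def .
    have "(1 - r m * \<sigma> m) * grid_resolvent (step_law m) q ?h (reflected_exp \<psi>) x = (1 - r m) * \<sigma> m * reflected_exp \<psi> x - ?V (?b \<psi>) x"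
      using \<mu>.grid_resolvent_reflected_exp[OF \<psi>0 exp[OF \<psi>0] q h, of x] unfolding r \<rho>2 .
    moreover have "r m * \<sigma> m = 1" by (simp add: r_def \<sigma>_def mult_exp_exp)
    ultimately have V\<psi>: "?V (?b \<psi>) x = (1 - r m) * \<sigma> m * reflected_exp \<psi> x" by simp
    have "\<bar>?V (\<lambda>x. ?b a x - a / \<psi> * ?b \<psi> x) x\<bar> \<le> \<epsilon> * ?V (?b \<psi>) x + C * \<tau> m"
      unfolding \<tau>_def
      by (rule \<mu>.cost_resolvent_mono_bound[OF _ bm(2) q h])
        (intro bounded_measurable_diff bounded_measurable_cmult bm,
         rule \<mu>.reflection_cost_compare[OF a \<psi>(1) C exp \<delta> ratio])
    then have V: "\<bar>?V (?b a) x - a / \<psi> * ((1 - r m) * \<sigma> m * reflected_exp \<psi> x)\<bar>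
        \<le> \<epsilon> * ((1 - r m) * \<sigma> m * reflected_exp \<psi> x) + C * \<tau> m"
      unfolding \<mu>.cost_resolvent_diff[OF bm q] V\<psi> .
    define w where "w = ?V (?b a) x - a / \<psi> * ((1 - r m) * \<sigma> m * reflected_exp \<psi> x)"
    have E1: "\<bar>reflected_exp a x\<bar> \<le> 1" "\<bar>reflected_exp \<psi> x\<bar> \<le> 1" "0 \<le> reflected_exp \<psi> x"
      using reflected_exp_bounds[OF a, of x] reflected_exp_bounds[OF \<psi>0, of x] by auto
    have w: "\<bar>w\<bar> \<le> \<epsilon> * ((1 - r m) * \<sigma> m) + C * \<tau> m"
    proof -
      have "(1 - r m) * \<sigma> m * reflected_exp \<psi> x \<le> (1 - r m) * \<sigma> m * 1"
        using r1 E1 by (intro mult_left_mono) (auto simp: \<sigma>_def)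
      then have "\<epsilon> * ((1 - r m) * \<sigma> m * reflected_exp \<psi> x) \<le> \<epsilon> * ((1 - r m) * \<sigma> m)"
        using \<epsilon> by simp
      then show ?thesis using V unfolding w_def by linarith
    qed
    have "grid_resolvent (step_law m) q ?h (reflected_exp a) x
        = ((1 - r m) * \<rho> m * reflected_exp a x - a / \<psi> * ((1 - r m) * \<sigma> m * reflected_exp \<psi> x) - w) / d m"
      using Ua d0[of m] by (simp add: w_def field_simps)
    then have "grid_resolvent (step_law m) q ?h (reflected_exp a) x
        - q / (q - \<phi> a) * (reflected_exp a x - a / \<psi> * reflected_exp \<psi> x)
      = ((1 - r m) * \<rho> m / d m - q / D) * reflected_exp a x
        - a / \<psi> * ((1 - r m) * \<sigma> m / d m - q / D) * reflected_exp \<psi> x - w / d m"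
    proof -
      have "(A * u - c * (B * v) - w) / d - Q * (u - c * v) = (A / d - Q) * u - c * (B / d - Q) * v - w / d"
        if "d \<noteq> 0" for A B c d Q u v w :: real
        using that by (simp add: field_simps)
      from this[OF d0] show "grid_resolvent (step_law m) q ?h (reflected_exp a) x
          = ((1 - r m) * \<rho> m * reflected_exp a x - a / \<psi> * ((1 - r m) * \<sigma> m * reflected_exp \<psi> x) - w) / d m
        \<Longrightarrow> ?thesis" unfolding D_def[symmetric] by (simp only:)
    qed
    also have "\<bar>\<dots>\<bar> \<le> \<bar>((1 - r m) * \<rho> m / d m - q / D) * reflected_exp a x\<bar>
        + \<bar>a / \<psi> * ((1 - r m) * \<sigma> m / d m - q / D) * reflected_exp \<psi> x\<bar> + \<bar>w / d m\<bar>"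
    proof -
      have "\<bar>A - B - C\<bar> \<le> \<bar>A\<bar> + \<bar>B\<bar> + \<bar>C\<bar>" for A B C :: real by linarith
      then show ?thesis .
    qed
    also have "\<dots> \<le> \<bar>(1 - r m) * \<rho> m / d m - q / D\<bar> + a / \<psi> * \<bar>(1 - r m) * \<sigma> m / d m - q / D\<bar>
        + (\<epsilon> * ((1 - r m) * \<sigma> m) + C * \<tau> m) / \<bar>d m\<bar>"
    proof (intro add_mono)
      show "\<bar>((1 - r m) * \<rho> m / d m - q / D) * reflected_exp a x\<bar> \<le> \<bar>(1 - r m) * \<rho> m / d m - q / D\<bar>"
        unfolding abs_mult using E1 by (intro mult_left_le) auto
      show "\<bar>a / \<psi> * ((1 - r m) * \<sigma> m / d m - q / D) * reflected_exp \<psi> x\<bar> \<le> a / \<psi> * \<bar>(1 - r m) * \<sigma> m / d m - q / D\<bar>"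
        unfolding abs_mult[of _ "reflected_exp \<psi> x"] using E1 a \<psi>0
        by (intro order_trans[OF mult_left_le]) (auto simp: abs_mult)
      show "\<bar>w / d m\<bar> \<le> (\<epsilon> * ((1 - r m) * \<sigma> m) + C * \<tau> m) / \<bar>d m\<bar>"
        unfolding abs_divide using w by (intro divide_right_mono) auto
    qed
    also have "(\<epsilon> * ((1 - r m) * \<sigma> m) + C * \<tau> m) / \<bar>d m\<bar>
        = \<epsilon> * \<bar>(1 - r m) * \<sigma> m / d m\<bar> + C * (\<tau> m / \<bar>d m\<bar>)"
      using r1 by (simp add: add_divide_distrib abs_mult \<sigma>_def)
    finally show ?thesis by simp
  qed
  have "(\<lambda>m. (1 - r m) * \<rho> m / d m) \<longlonglongrightarrow> q * inverse D"
    unfolding d_eq r_def \<rho>_def using D by real_asymp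
  then have l1: "(\<lambda>m. (1 - r m) * \<rho> m / d m) \<longlonglongrightarrow> q / D" by (simp only: divide_inverse)
  have "(\<lambda>m. (1 - r m) * \<sigma> m / d m) \<longlonglongrightarrow> q * inverse D"
    unfolding d_eq r_def \<sigma>_def using D by real_asymp
  then have l2: "(\<lambda>m. (1 - r m) * \<sigma> m / d m) \<longlonglongrightarrow> q / D" by (simp only: divide_inverse)
  have l3: "(\<lambda>m. \<tau> m / \<bar>d m\<bar>) \<longlonglongrightarrow> 0"
  proof -
    \<comment> \<open>Dividing by \<open>d m\<close> costs a factor 2 ^ m, exactly what
      \<open>step_law_exp_tail\<close> can absorb.\<close>
    have "(\<lambda>m. 2 ^ m * d m) \<longlonglongrightarrow> D" unfolding d_eq by real_asymp
    then have "(\<lambda>m. (2 ^ m * \<tau> m) / \<bar>2 ^ m * d m\<bar>) \<longlonglongrightarrow> 0 / \<bar>D\<bar>"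
      using D unfolding \<tau>_def
      by (intro tendsto_divide step_law_exp_tail[OF \<delta>] tendsto_rabs) (use a \<psi> in auto)
    then show ?thesis by (simp add: abs_mult)
  qed
  have "(\<lambda>m. \<bar>(1 - r m) * \<rho> m / d m - q / D\<bar> + a / \<psi> * \<bar>(1 - r m) * \<sigma> m / d m - q / D\<bar>
        + (\<epsilon> * \<bar>(1 - r m) * \<sigma> m / d m\<bar> + C * (\<tau> m / \<bar>d m\<bar>)))
     \<longlonglongrightarrow> \<bar>q / D - q / D\<bar> + a / \<psi> * \<bar>q / D - q / D\<bar> + (\<epsilon> * \<bar>q / D\<bar> + C * 0)"
    by (intro tendsto_intros l1 l2 l3)
  moreover have "\<bar>q / D - q / D\<bar> + a / \<psi> * \<bar>q / D - q / D\<bar> + (\<epsilon> * \<bar>q / D\<bar> + C * 0) < e"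
    using q D e by (simp add: \<epsilon>_def abs_divide)
  ultimately have "eventually (\<lambda>m. \<bar>(1 - r m) * \<rho> m / d m - q / D\<bar> + a / \<psi> * \<bar>(1 - r m) * \<sigma> m / d m - q / D\<bar>
        + (\<epsilon> * \<bar>(1 - r m) * \<sigma> m / d m\<bar> + C * (\<tau> m / \<bar>d m\<bar>)) < e) sequentially"
    by (rule order_tendstoD(2))
  then show ?thesis
    by eventually_elim (use main in \<open>meson less_imp_le order_trans\<close>)
qed

end

section \<open>Reflected random walks at independent geometric times\<close>

text \<open>An entry (a, c) charges the weight a after c further steps. The noise is shifted by c,
  so the remaining entries see fresh increments and the Markov property becomes a statement about
  shifted sequences.\<close>

fun walk_cost :: "(real \<times> nat) list \<Rightarrow> real \<Rightarrow> (nat \<Rightarrow> real) \<Rightarrow> real" where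
  "walk_cost [] x \<xi> = 1"
| "walk_cost ((a, c) # xs) x \<xi>
    = exp (- a * lindley_walk x \<xi> c) * walk_cost xs (lindley_walk x \<xi> c) (\<lambda>i. \<xi> (i + c))"

primrec walk_transform :: "real measure \<Rightarrow> (real \<times> nat) list \<Rightarrow> real \<Rightarrow> real" where
  "walk_transform \<mu> [] = (\<lambda>x. 1)"
| "walk_transform \<mu> (p # xs)
    = (lindley_operator \<mu> ^^ snd p) (\<lambda>y. reflected_exp (fst p) y * walk_transform \<mu> xs y)"

primrec resolvent_transform :: "real measure \<Rightarrow> real \<Rightarrow> (real \<times> real) list \<Rightarrow> real \<Rightarrow> real" where
  "resolvent_transform \<mu> h [] = (\<lambda>x. 1)"
| "resolvent_transform \<mu> h (p # xs)
    = grid_resolvent \<mu> (snd p) h (\<lambda>y. reflected_exp (fst p) y * resolvent_transform \<mu> h xs y)"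

lemma lindley_walk_max: "lindley_walk (max 0 x) \<xi> k = lindley_walk x \<xi> k"
  by (cases k) simp_all

lemma lindley_walk_add:
  "lindley_walk x \<xi> (j + k) = lindley_walk (lindley_walk x \<xi> j) (\<lambda>i. \<xi> (i + j)) k"
  by (induction j arbitrary: x \<xi>) (simp_all add: lindley_walk_max)

lemma walk_cost_max: "walk_cost xs (max 0 x) \<xi> = walk_cost xs x \<xi>"
  by (cases xs) (auto simp: lindley_walk_max)

lemma walk_cost_Suc:
  "walk_cost ((a, Suc c) # xs) x \<xi> = walk_cost ((a, c) # xs) (max 0 x + \<xi> 0) (\<lambda>i. \<xi> (Suc i))"
  by simp

lemma walk_cost_snoc:
  "walk_cost (xs @ [(a, c)]) x \<xi>
    = walk_cost xs x \<xi> * exp (- a * lindley_walk x \<xi> (sum_list (map snd xs) + c))"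
proof (induction xs arbitrary: x \<xi>)
  case (Cons p xs)
  obtain b k where p: "p = (b, k)" by (cases p)
  show ?case
    using Cons.IH[of "lindley_walk x \<xi> k" "\<lambda>i. \<xi> (i + k)"]
    by (simp add: p lindley_walk_add[of x \<xi> k "sum_list (map snd xs) + c"] add.assoc mult.assoc)
qed simp

lemma walk_cost_upt:
  "walk_cost (map (\<lambda>i. (\<alpha> i, \<kappa> i)) [1..<Suc n]) x \<xi>
    = exp (- (\<Sum>i=1..n. \<alpha> i * lindley_walk x \<xi> (\<Sum>k=1..i. \<kappa> k)))"
proof (induction n)
  case (Suc n)
  have "sum_list (map \<kappa> [1..<Suc n]) = (\<Sum>k=1..n. \<kappa> k)"
    by (subst sum_list_distinct_conv_sum_set) (simp_all only: distinct_upt set_upt atLeastLessThanSuc_atLeastAtMost)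
  moreover have "map (\<lambda>i. (\<alpha> i, \<kappa> i)) [1..<Suc (Suc n)] = map (\<lambda>i. (\<alpha> i, \<kappa> i)) [1..<Suc n] @ [(\<alpha> (Suc n), \<kappa> (Suc n))]"
    by simp
  ultimately show ?case
    by (simp only: walk_cost_snoc Suc) (simp add: comp_def mult_exp_exp)
qed simp

lemma walk_cost_bounds:
  "(\<And>p. p \<in> set xs \<Longrightarrow> 0 \<le> fst p) \<Longrightarrow> 0 \<le> walk_cost xs x \<xi> \<and> walk_cost xs x \<xi> \<le> 1"
proof (induction xs arbitrary: x \<xi>)
  case (Cons p xs)
  obtain a c where p: "p = (a, c)" by (cases p)
  have "0 \<le> a" using Cons.prems[of p] by (simp add: p)
  then have "exp (- a * lindley_walk x \<xi> c) \<le> 1" using lindley_walk_nonneg[of x \<xi> c] by simp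
  then show ?case using Cons by (auto simp: p intro!: mult_nonneg_nonneg mult_le_one)
qed simp

lemma measurable_lindley_walk:
  assumes "x \<in> borel_measurable N" "\<And>i. (\<lambda>w. \<xi> w i) \<in> borel_measurable N"
  shows "(\<lambda>w. lindley_walk (x w) (\<xi> w) k) \<in> borel_measurable N"
  using assms
proof (induction k arbitrary: x \<xi>)
  case (Suc k)
  show ?case unfolding lindley_walk.simps by (intro Suc.IH) (use Suc.prems in measurable)
qed simp

lemma measurable_walk_cost:
  assumes "x \<in> borel_measurable N" "\<And>i. (\<lambda>w. \<xi> w i) \<in> borel_measurable N"
  shows "(\<lambda>w. walk_cost xs (x w) (\<xi> w)) \<in> borel_measurable N"
  using assms
proof (induction xs arbitrary: x \<xi>)
  case (Cons p xs)
  obtain a c where p: "p = (a, c)" by (cases p)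
  have [measurable]: "(\<lambda>w. lindley_walk (x w) (\<xi> w) c) \<in> borel_measurable N"
    by (intro measurable_lindley_walk Cons.prems)
  have [measurable]: "(\<lambda>w. walk_cost xs (lindley_walk (x w) (\<xi> w) c) (\<lambda>i. \<xi> w (i + c))) \<in> borel_measurable N"
    by (intro Cons.IH) (auto intro: Cons.prems)
  show ?case unfolding p walk_cost.simps by measurable
qed simp

lemma measurable_walk_cost_random_index:
  assumes \<xi>: "\<And>i. (\<lambda>w. \<xi> w i) \<in> borel_measurable N"
    and \<kappa>: "\<And>i. i \<in> {1..n} \<Longrightarrow> \<kappa> i \<in> N \<rightarrow>\<^sub>M count_space UNIV"
  shows "(\<lambda>w. walk_cost (map (\<lambda>i. (\<alpha> i, \<kappa> i w)) [1..<Suc n]) x (\<xi> w)) \<in> borel_measurable N"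
proof -
  have [measurable]: "(\<lambda>w. lindley_walk x (\<xi> w) j) \<in> borel_measurable N" for j
    by (intro measurable_lindley_walk \<xi>) auto
  have "(\<lambda>w. lindley_walk x (\<xi> w) (\<Sum>k=1..i. \<kappa> k w)) \<in> borel_measurable N" if "i \<in> {1..n}" for i
  proof (rule measurable_compose_countable[where g = "\<lambda>w. \<Sum>k=1..i. \<kappa> k w" and f = "\<lambda>j w. lindley_walk x (\<xi> w) j"])
    show "(\<lambda>w. \<Sum>k=1..i. \<kappa> k w) \<in> N \<rightarrow>\<^sub>M count_space UNIV"
      using that by (intro measurable_sum_nat \<kappa>) auto
  qed measurable
  then show ?thesis
    unfolding walk_cost_upt
    by (intro borel_measurable_exp[THEN measurable_compose[rotated]] borel_measurable_uminus borel_measurable_sum borel_measurable_times) auto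
qed

context real_distribution begin

lemma sequence_space: "sequence_space M"
  by (intro sequence_space.intro product_prob_spaceI) (rule prob_space_axioms)

text \<open>The parameter w stands for the later exponential times; joint measurability permits
  exchanging them with the steps.\<close>

lemma measurable_lindley_power:
  assumes F: "(\<lambda>(w, x). F w x) \<in> borel_measurable (N \<Otimes>\<^sub>M borel)"
  shows "(\<lambda>(w, x). (lindley_operator M ^^ c) (F w) x) \<in> borel_measurable (N \<Otimes>\<^sub>M borel)"
proof (induction c)
  case (Suc c)
  have "(\<lambda>p. \<integral>s. (lindley_operator M ^^ c) (F (fst p)) (max 0 (snd p) + s) \<partial>M) \<in> borel_measurable (N \<Otimes>\<^sub>M borel)"
  proof (rule borel_measurable_lebesgue_integral)
    have "(\<lambda>p. (fst (fst p), max 0 (snd (fst p)) + snd p)) \<in> ((N \<Otimes>\<^sub>M borel) \<Otimes>\<^sub>M M) \<rightarrow>\<^sub>M (N \<Otimes>\<^sub>M borel)"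
      by measurable
    from measurable_compose[OF this Suc]
    show "(\<lambda>(p, s). (lindley_operator M ^^ c) (F (fst p)) (max 0 (snd p) + s)) \<in> borel_measurable ((N \<Otimes>\<^sub>M borel) \<Otimes>\<^sub>M M)"
      by (simp add: split_beta')
  qed
  then show ?case by (simp add: lindley_operator_def[of M "(lindley_operator M ^^ c) _"] split_beta')
qed (use F in simp)

lemma measurable_walk_transform:
  assumes "\<And>i. i \<in> set is \<Longrightarrow> \<kappa> i \<in> N \<rightarrow>\<^sub>M count_space UNIV"
  shows "(\<lambda>(w, x). walk_transform M (map (\<lambda>i. (\<alpha> i, \<kappa> i w)) is) x) \<in> borel_measurable (N \<Otimes>\<^sub>M borel)"
  using assms
proof (induction "is")
  case (Cons i "is")
  define F where "F w y = reflected_exp (\<alpha> i) y * walk_transform M (map (\<lambda>i. (\<alpha> i, \<kappa> i w)) is) y" for w y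
  have [measurable]: "(\<lambda>p. walk_transform M (map (\<lambda>i. (\<alpha> i, \<kappa> i (fst p))) is) (snd p)) \<in> borel_measurable (N \<Otimes>\<^sub>M borel)"
    using Cons by (simp add: split_beta')
  have "(\<lambda>(w, x). F w x) \<in> borel_measurable (N \<Otimes>\<^sub>M borel)"
    unfolding F_def split_beta' reflected_exp_def by measurable
  note * = measurable_lindley_power[OF this, unfolded split_beta']
  have [measurable]: "\<kappa> i \<in> N \<rightarrow>\<^sub>M count_space UNIV" using Cons.prems by simp
  have "(\<lambda>p. (lindley_operator M ^^ \<kappa> i (fst p)) (F (fst p)) (snd p)) \<in> borel_measurable (N \<Otimes>\<^sub>M borel)"
    by (rule measurable_compose_countable[where g = "\<lambda>p. \<kappa> i (fst p)" and f = "\<lambda>c p. (lindley_operator M ^^ c) (F (fst p)) (snd p)"])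
      (use * in measurable)
  then show ?case by (simp add: F_def[abs_def] split_beta')
qed simp

lemma walk_transform_bounded:
  assumes "\<And>p. p \<in> set xs \<Longrightarrow> 0 \<le> fst p"
  shows "bounded_measurable (walk_transform M xs) \<and> (\<forall>x. \<bar>walk_transform M xs x\<bar> \<le> 1)"
  using assms
proof (induction xs)
  case Nil
  then show ?case by (simp add: bounded_measurable_const)
next
  case (Cons p xs)
  have a: "0 \<le> fst p" using Cons.prems by simp
  have IH: "bounded_measurable (walk_transform M xs)" "\<And>x. \<bar>walk_transform M xs x\<bar> \<le> 1" using Cons by auto
  have bm: "bounded_measurable (\<lambda>y. reflected_exp (fst p) y * walk_transform M xs y)"
    by (intro bounded_measurable_mult bounded_measurable_reflected_exp a IH)
  have "\<bar>reflected_exp (fst p) y * walk_transform M xs y\<bar> \<le> 1" for y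
    using reflected_exp_bounds[OF a, of y] IH(2)[of y] by (auto simp: abs_mult intro: mult_le_one)
  then show ?case
    using bounded_measurable_lindley_power[OF bm] lindley_power_abs_le[OF bm] by simp
qed

lemma resolvent_transform_bounded:
  assumes "\<And>p. p \<in> set xs \<Longrightarrow> 0 \<le> fst p \<and> 0 < snd p"
  shows "bounded_measurable (resolvent_transform M h xs) \<and> (\<forall>x. \<bar>resolvent_transform M h xs x\<bar> \<le> 1)"
  using assms
proof (induction xs)
  case Nil
  then show ?case by (simp add: bounded_measurable_const)
next
  case (Cons p xs)
  have a: "0 \<le> fst p" "0 < snd p" using Cons.prems by auto
  have IH: "bounded_measurable (resolvent_transform M h xs)" "\<And>x. \<bar>resolvent_transform M h xs x\<bar> \<le> 1" using Cons by auto
  have bm: "bounded_measurable (\<lambda>y. reflected_exp (fst p) y * resolvent_transform M h xs y)"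
    by (intro bounded_measurable_mult bounded_measurable_reflected_exp a IH)
  have "\<bar>reflected_exp (fst p) y * resolvent_transform M h xs y\<bar> \<le> 1" for y
    using reflected_exp_bounds[OF a(1), of y] IH(2)[of y] by (auto simp: abs_mult intro: mult_le_one)
  then show ?case
    using bounded_measurable_grid_resolvent[OF bm a(2)] grid_resolvent_abs_le[OF bm _ a(2)] by simp
qed

text \<open>The Markov property: induction over the list and, within its first entry, over the
  number of steps, integrating out one increment at a time.\<close>

lemma integral_walk_cost:
  assumes "\<And>p. p \<in> set xs \<Longrightarrow> 0 \<le> fst p"
  shows "(\<integral>\<xi>. walk_cost xs x \<xi> \<partial>PiM UNIV (\<lambda>_. M)) = walk_transform M xs x"
  using assms
proof (induction xs arbitrary: x)
  interpret sequence_space M by (rule sequence_space)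
  case Nil
  then show ?case using P.prob_space by simp
next
  interpret sequence_space M by (rule sequence_space)
  interpret pair: pair_prob_space M S by unfold_locales
  case (Cons p xs)
  obtain a c where p: "p = (a, c)" by (cases p)
  have a: "0 \<le> a" using Cons.prems[of p] p by simp
  have IH: "(\<integral>\<xi>. walk_cost xs x \<xi> \<partial>S) = walk_transform M xs x" for x using Cons by auto
  have "(\<integral>\<xi>. walk_cost ((a, c) # xs) x \<xi> \<partial>S)
      = (lindley_operator M ^^ c) (\<lambda>y. reflected_exp a y * walk_transform M xs y) x"
  proof (induction c arbitrary: x)
    case 0
    then show ?case by (simp add: reflected_exp_def walk_cost_max IH)
  next
    case (Suc c)
    define G where "G = walk_cost ((a, c) # xs)"
    define H where "H \<xi> = G (max 0 x + \<xi> 0) (\<lambda>i. \<xi> (Suc i))" for \<xi>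
    have Gb: "0 \<le> G y \<xi> \<and> G y \<xi> \<le> 1" for y \<xi>
      unfolding G_def
    proof (rule walk_cost_bounds)
      fix p' assume "p' \<in> set ((a, c) # xs)"
      then show "0 \<le> fst p'" using a Cons.prems[of p'] by auto
    qed
    have Hm: "H \<in> borel_measurable S" unfolding H_def G_def
      by (intro measurable_walk_cost) measurable
    have cn: "(\<lambda>(s, \<omega>). case_nat s \<omega>) \<in> M \<Otimes>\<^sub>M S \<rightarrow>\<^sub>M S" by measurable
    have "(\<integral>\<xi>. walk_cost ((a, Suc c) # xs) x \<xi> \<partial>S) = (\<integral>\<xi>. H \<xi> \<partial>S)"
      unfolding walk_cost_Suc H_def G_def ..
    \<comment> \<open>An i.i.d. sequence has the law of one independent draw put in front of such a
      sequence.\<close>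
    also have "\<dots> = (\<integral>\<xi>. H \<xi> \<partial>distr (M \<Otimes>\<^sub>M S) S (\<lambda>(s, \<omega>). case_nat s \<omega>))" by (simp only: PiM_iter)
    also have "\<dots> = (\<integral>p. H ((\<lambda>(s, \<omega>). case_nat s \<omega>) p) \<partial>(M \<Otimes>\<^sub>M S))"
      by (rule integral_distr[OF cn Hm])
    also have "\<dots> = (\<integral>p. G (max 0 x + fst p) (snd p) \<partial>(M \<Otimes>\<^sub>M S))"
      by (simp add: H_def split_beta')
    also have "\<dots> = (\<integral>s. \<integral>\<omega>. G (max 0 x + s) \<omega> \<partial>S \<partial>M)"
    proof (subst pair.integral_fst'[symmetric])
      have "(\<lambda>p. G (max 0 x + fst p) (snd p)) \<in> borel_measurable (M \<Otimes>\<^sub>M S)"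
        unfolding G_def by (intro measurable_walk_cost) measurable
      then show "integrable (M \<Otimes>\<^sub>M S) (\<lambda>p. G (max 0 x + fst p) (snd p))"
        using Gb by (intro pair.P.integrable_const_bound[where B = 1]) auto
    qed simp
    also have "\<dots> = (\<integral>s. (lindley_operator M ^^ c) (\<lambda>y. reflected_exp a y * walk_transform M xs y) (max 0 x + s) \<partial>M)"
      unfolding G_def Suc ..
    finally show ?case by (simp add: lindley_operator_def[of M "(lindley_operator M ^^ c) _"])
  qed
  then show ?case by (simp add: p)
qed

lemma integral_lindley_power:
  assumes "prob_space N" and F: "(\<lambda>(w, x). F w x) \<in> borel_measurable (N \<Otimes>\<^sub>M borel)" and b: "\<And>w x. \<bar>F w x\<bar> \<le> C"
  shows "(\<integral>w. (lindley_operator M ^^ c) (F w) x \<partial>N) = (lindley_operator M ^^ c) (\<lambda>x. \<integral>w. F w x \<partial>N) x"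
proof (induction c arbitrary: x)
  case (Suc c)
  interpret N: prob_space N by fact
  interpret pair: pair_prob_space N M by unfold_locales
  have bm: "bounded_measurable (F w)" if "w \<in> space N" for w
    using measurable_Pair2[OF F that] b by (intro bounded_measurableI) auto
  have "(\<lambda>(w, s). (lindley_operator M ^^ c) (F w) (max 0 x + s)) \<in> borel_measurable (N \<Otimes>\<^sub>M M)"
  proof -
    have "(\<lambda>p. (fst p, max 0 x + snd p)) \<in> (N \<Otimes>\<^sub>M M) \<rightarrow>\<^sub>M (N \<Otimes>\<^sub>M borel)" by measurable
    from measurable_compose[OF this measurable_lindley_power[OF F]] show ?thesis by (simp add: split_beta')
  qed
  then have int: "integrable (N \<Otimes>\<^sub>M M) (\<lambda>(w, s). (lindley_operator M ^^ c) (F w) (max 0 x + s))"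
    using lindley_power_abs_le[OF bm b]
    by (intro pair.P.integrable_const_bound[where B = C] AE_I2) (auto simp: space_pair_measure)
  have "(\<integral>w. (lindley_operator M ^^ Suc c) (F w) x \<partial>N)
     = (\<integral>w. \<integral>s. (lindley_operator M ^^ c) (F w) (max 0 x + s) \<partial>M \<partial>N)"
    by (simp add: lindley_operator_def[of M "(lindley_operator M ^^ c) _"])
  also have "\<dots> = (\<integral>s. \<integral>w. (lindley_operator M ^^ c) (F w) (max 0 x + s) \<partial>N \<partial>M)"
    by (rule pair.Fubini_integral[OF int, symmetric])
  also have "\<dots> = (lindley_operator M ^^ Suc c) (\<lambda>x. \<integral>w. F w x \<partial>N) x"
    by (simp add: Suc lindley_operator_def[of M "(lindley_operator M ^^ c) _"])
  finally show ?case .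
qed simp

text \<open>The later times enter only through the function to which the first operator power is
  applied. Fubini moves their integral inside that power, and integrating the first time then turns
  the power into \<open>grid_resolvent\<close>.\<close>

lemma integral_walk_transform:
  assumes "distinct is" "\<And>i. i \<in> set is \<Longrightarrow> 0 \<le> \<alpha> i" "\<And>i. i \<in> set is \<Longrightarrow> 0 < q i"
  shows "(\<integral>t. walk_transform M (map (\<lambda>i. (\<alpha> i, grid_index h (t i))) is) x \<partial>PiM (set is) (\<lambda>i. exponential_law (q i)))
    = resolvent_transform M h (map (\<lambda>i. (\<alpha> i, q i)) is) x"
  using assms
proof (induction "is" arbitrary: x)
  case Nil
  interpret T: prob_space "PiM {} (\<lambda>i. exponential_law (q i))"
    by (rule prob_space_PiM) simp
  show ?case using T.prob_space by simp
next
  case (Cons i "is")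
  \<comment> \<open>The family is completed by rate 1 outside the list, since the product space asks
    for a probability measure at every index.\<close>
  define E where "E j = (if j \<in> set (i # is) then exponential_law (q j) else exponential_law 1)" for j
  have rd: "real_distribution (E j)" for j
    using Cons.prems(3) by (auto simp: E_def intro: real_distribution_exponential_law)
  have pE: "prob_space (E j)" for j using rd real_distribution_def by blast
  have [measurable_cong, simp]: "sets (E j) = sets borel" for j
    using rd[of j] by (simp add: real_distribution_def real_distribution_axioms_def)
  interpret E: product_prob_space E by (rule product_prob_spaceI) (rule pE)
  interpret Ei: prob_space "E i" by (rule pE)
  interpret T: prob_space "PiM (set is) E" by (rule prob_space_PiM) (rule pE)
  interpret T': prob_space "PiM (insert i (set is)) E" by (rule prob_space_PiM) (rule pE)
  interpret pair: pair_prob_space "PiM (set is) E" "E i" by unfold_locales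
  have a: "0 \<le> \<alpha> i" and i: "i \<notin> set is" using Cons.prems by auto
  define \<Phi> where "\<Phi> t y = walk_transform M (map (\<lambda>i. (\<alpha> i, grid_index h (t i))) is) y" for t y
  define F where "F t y = reflected_exp (\<alpha> i) y * \<Phi> t y" for t y
  have \<Phi>b: "\<bar>\<Phi> t y\<bar> \<le> 1" for t y
    unfolding \<Phi>_def using Cons.prems by (intro walk_transform_bounded[THEN conjunct2, rule_format]) auto
  have Fb: "\<bar>F t y\<bar> \<le> 1" for t y
    using reflected_exp_bounds[OF a, of y] \<Phi>b[of t y] by (auto simp: F_def abs_mult intro: mult_le_one)
  have \<Phi>m: "(\<lambda>(t, y). \<Phi> t y) \<in> borel_measurable (PiM (set is) E \<Otimes>\<^sub>M borel)"
    unfolding \<Phi>_def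
  proof (rule measurable_walk_transform)
    fix j assume "j \<in> set is"
    then have "(\<lambda>t. t j) \<in> PiM (set is) E \<rightarrow>\<^sub>M borel"
      using measurable_component_singleton[of j "set is" E] by (simp cong: measurable_cong_sets)
    then show "(\<lambda>t. grid_index h (t j)) \<in> PiM (set is) E \<rightarrow>\<^sub>M count_space UNIV"
      by (rule measurable_compose[OF _ measurable_grid_index])
  qed
  then have Fm: "(\<lambda>(t, y). F t y) \<in> borel_measurable (PiM (set is) E \<Otimes>\<^sub>M borel)"
    unfolding F_def split_beta' reflected_exp_def by measurable
  have Fbm: "bounded_measurable (F t)" if "t \<in> space (PiM (set is) E)" for t
    using measurable_Pair2[OF Fm that] Fb by (intro bounded_measurableI) auto
  have IH: "(\<integral>t. \<Phi> t y \<partial>PiM (set is) E) = resolvent_transform M h (map (\<lambda>i. (\<alpha> i, q i)) is) y" for y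
  proof -
    have "PiM (set is) E = PiM (set is) (\<lambda>i. exponential_law (q i))" by (intro PiM_cong) (auto simp: E_def)
    then show ?thesis using Cons by (simp add: \<Phi>_def)
  qed
  have upd: "walk_transform M (map (\<lambda>j. (\<alpha> j, grid_index h ((t(i := y)) j))) (i # is)) x
      = (lindley_operator M ^^ grid_index h y) (F t) x" for t y
  proof -
    have "map (\<lambda>j. (\<alpha> j, grid_index h ((t(i := y)) j))) is = map (\<lambda>j. (\<alpha> j, grid_index h (t j))) is"
      using i by (intro map_cong) auto
    then show ?thesis by (simp add: F_def[abs_def] \<Phi>_def del: map_eq_conv)
  qed
  have "PiM (set (i # is)) (\<lambda>i. exponential_law (q i)) = PiM (insert i (set is)) E"
    by (intro PiM_cong) (auto simp: E_def)
  then have "(\<integral>t. walk_transform M (map (\<lambda>i. (\<alpha> i, grid_index h (t i))) (i # is)) x \<partial>PiM (set (i # is)) (\<lambda>i. exponential_law (q i)))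
    = (\<integral>t. walk_transform M (map (\<lambda>i. (\<alpha> i, grid_index h (t i))) (i # is)) x \<partial>PiM (insert i (set is)) E)"
    by simp
  also have "\<dots> = (\<integral>t. \<integral>y. walk_transform M (map (\<lambda>j. (\<alpha> j, grid_index h ((t(i := y)) j))) (i # is)) x \<partial>E i \<partial>PiM (set is) E)"
  proof (rule E.product_integral_insert)
    have "(\<lambda>(t, y). walk_transform M (map (\<lambda>i. (\<alpha> i, grid_index h (t i))) (i # is)) y)
        \<in> borel_measurable (PiM (insert i (set is)) E \<Otimes>\<^sub>M borel)"
    proof (rule measurable_walk_transform)
      fix j assume "j \<in> set (i # is)"
      then have "(\<lambda>t. t j) \<in> PiM (insert i (set is)) E \<rightarrow>\<^sub>M borel"
        using measurable_component_singleton[of j "insert i (set is)" E] by (simp cong: measurable_cong_sets)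
      then show "(\<lambda>t. grid_index h (t j)) \<in> PiM (insert i (set is)) E \<rightarrow>\<^sub>M count_space UNIV"
        by (rule measurable_compose[OF _ measurable_grid_index])
    qed
    from measurable_Pair1[OF this, of x]
    have "(\<lambda>t. walk_transform M (map (\<lambda>i. (\<alpha> i, grid_index h (t i))) (i # is)) x) \<in> borel_measurable (PiM (insert i (set is)) E)"
      by simp
    moreover have "\<bar>walk_transform M (map (\<lambda>i. (\<alpha> i, grid_index h (t i))) (i # is)) x\<bar> \<le> 1" for t
      using Cons.prems by (intro walk_transform_bounded[THEN conjunct2, rule_format]) auto
    ultimately show "integrable (PiM (insert i (set is)) E) (\<lambda>t. walk_transform M (map (\<lambda>i. (\<alpha> i, grid_index h (t i))) (i # is)) x)"
      by (intro T'.integrable_const_bound[where B = 1]) auto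
  qed (use i in auto)
  also have "\<dots> = (\<integral>t. \<integral>y. (lindley_operator M ^^ grid_index h y) (F t) x \<partial>E i \<partial>PiM (set is) E)"
    unfolding upd ..
  also have "\<dots> = (\<integral>y. \<integral>t. (lindley_operator M ^^ grid_index h y) (F t) x \<partial>PiM (set is) E \<partial>E i)"
  proof (rule pair.Fubini_integral[symmetric])
    have [measurable]: "(\<lambda>p. (lindley_operator M ^^ c) (F (fst p)) x) \<in> borel_measurable (PiM (set is) E \<Otimes>\<^sub>M E i)" for c
      using measurable_compose[OF measurable_fst measurable_Pair1[OF measurable_lindley_power[OF Fm, of c], of x]] by simp
    have "(\<lambda>p. (lindley_operator M ^^ grid_index h (snd p)) (F (fst p)) x) \<in> borel_measurable (PiM (set is) E \<Otimes>\<^sub>M E i)"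
      by (rule measurable_compose_countable[where g = "\<lambda>p. grid_index h (snd p)" and f = "\<lambda>c p. (lindley_operator M ^^ c) (F (fst p)) x"])
        measurable
    then show "integrable (PiM (set is) E \<Otimes>\<^sub>M E i) (\<lambda>(t, y). (lindley_operator M ^^ grid_index h y) (F t) x)"
      using lindley_power_abs_le[OF Fbm Fb]
      by (intro pair.P.integrable_const_bound[where B = 1] AE_I2) (auto simp: space_pair_measure split_beta')
  qed
  also have "\<dots> = (\<integral>y. (lindley_operator M ^^ grid_index h y) (\<lambda>y. \<integral>t. F t y \<partial>PiM (set is) E) x \<partial>E i)"
    by (subst integral_lindley_power[OF T.prob_space_axioms Fm Fb]) simp
  also have "(\<lambda>y. \<integral>t. F t y \<partial>PiM (set is) E) = (\<lambda>y. reflected_exp (\<alpha> i) y * resolvent_transform M h (map (\<lambda>i. (\<alpha> i, q i)) is) y)"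
    by (simp add: F_def IH)
  finally show ?case by (simp add: grid_resolvent_def E_def)
qed

end

section \<open>Joint law of the exponential times and the increments\<close>

lemma (in prob_space) distributed_exponential_imp_distr:
  assumes "distributed M lborel Y (exponential_density q)"
  shows "Y \<in> borel_measurable M" "distr M borel Y = exponential_law q"
proof -
  show "Y \<in> borel_measurable M" using distributed_measurable[OF assms] by simp
  have "distr M borel Y = distr M lborel Y" by (rule distr_cong) simp_all
  then show "distr M borel Y = exponential_law q"
    using distributed_distr_eq_density[OF assms] by (simp add: exponential_law_def)
qed

text \<open>Turns independence of two families of events into a product law, checked on
  rectangles.\<close>

lemma (in prob_space) distr_pair_indep_set:
  assumes indep: "indep_set \<A> \<B>"
    and F: "F \<in> M \<rightarrow>\<^sub>M S" "\<And>A. A \<in> sets S \<Longrightarrow> F -` A \<inter> space M \<in> \<A>"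
    and G: "G \<in> M \<rightarrow>\<^sub>M R" "\<And>B. B \<in> sets R \<Longrightarrow> G -` B \<inter> space M \<in> \<B>"
  shows "distr M S F \<Otimes>\<^sub>M distr M R G = distr M (S \<Otimes>\<^sub>M R) (\<lambda>\<omega>. (F \<omega>, G \<omega>))"
proof -
  interpret F: prob_space "distr M S F" by (rule prob_space_distr[OF F(1)])
  interpret G: prob_space "distr M R G" by (rule prob_space_distr[OF G(1)])
  have FG: "(\<lambda>\<omega>. (F \<omega>, G \<omega>)) \<in> M \<rightarrow>\<^sub>M S \<Otimes>\<^sub>M R" using F(1) G(1) by (rule measurable_Pair)
  show ?thesis
  proof (rule pair_measure_eqI)
    fix A B assume A: "A \<in> sets (distr M S F)" and B: "B \<in> sets (distr M R G)"
    then have "prob ((F -` A \<inter> space M) \<inter> (G -` B \<inter> space M)) = prob (F -` A \<inter> space M) * prob (G -` B \<inter> space M)"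
      by (intro indep_setD[OF indep] F(2) G(2)) simp_all
    moreover have "(\<lambda>\<omega>. (F \<omega>, G \<omega>)) -` (A \<times> B) \<inter> space M = (F -` A \<inter> space M) \<inter> (G -` B \<inter> space M)" by auto
    ultimately show "emeasure (distr M S F) A * emeasure (distr M R G) B
        = emeasure (distr M (S \<Otimes>\<^sub>M R) (\<lambda>\<omega>. (F \<omega>, G \<omega>))) (A \<times> B)"
      using A B F(1) G(1) FG
      by (simp add: emeasure_distr emeasure_eq_measure ennreal_mult'[symmetric])
  qed (simp_all add: F.sigma_finite_measure_axioms G.sigma_finite_measure_axioms cong: sets_pair_measure_cong)
qed

lemma (in levy_process) expectation_walk_cost:
  fixes T :: "nat \<Rightarrow> 'w \<Rightarrow> real" and n :: nat and q \<alpha> :: "nat \<Rightarrow> real"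
  assumes q_pos: "\<And>i. i \<in> {1..n} \<Longrightarrow> 0 < q i"
    and T_exponential: "\<And>i. i \<in> {1..n} \<Longrightarrow> distributed M lborel (T i) (exponential_density (q i))"
    and T_independent: "indep_vars (\<lambda>_. borel) T {1..n}"
    and T_independent_of_X:
      "indep_set
         (sets (vimage_algebra (space M) (\<lambda>\<omega>. \<lambda>i\<in>{1..n}. T i \<omega>) (PiM {1..n} (\<lambda>_. borel))))
         (sets (vimage_algebra (space M) (\<lambda>\<omega>. \<lambda>t\<in>{0..}. X t \<omega>) (PiM {0..} (\<lambda>_. borel))))"
    and \<alpha>: "\<And>i. i \<in> {1..n} \<Longrightarrow> 0 \<le> \<alpha> i"
  shows "(\<integral>\<omega>. walk_cost (map (\<lambda>i. (\<alpha> i, grid_index h (T i \<omega>))) [1..<Suc n]) x (\<lambda>k. increment m k \<omega>) \<partial>M)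
    = resolvent_transform (step_law m) h (map (\<lambda>i. (\<alpha> i, q i)) [1..<Suc n]) x"
\<comment> \<open>Characterising independence by a product law requires a nonempty index
  set.\<close>
proof (cases "n = 0")
  case True
  then show ?thesis by (simp add: prob_space)
next
  case False
  define PT where "PT = PiM {1..n} (\<lambda>_. borel :: real measure)"
  define PX where "PX = PiM {0::real..} (\<lambda>_. borel :: real measure)"
  define PS where "PS = PiM (UNIV :: nat set) (\<lambda>_. borel :: real measure)"
  define TT where "TT \<omega> = (\<lambda>i\<in>{1..n}. T i \<omega>)" for \<omega>
  define XX where "XX \<omega> = (\<lambda>t\<in>{0..}. X t \<omega>)" for \<omega>
  \<comment> \<open>The increments are a measurable function of the whole path, so they inherit its
    independence from the times.\<close>
  define inc where "inc f k = f (real (Suc k) / 2 ^ m) - f (real k / 2 ^ m)" for f :: "real \<Rightarrow> real" and k :: nat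
  have Tm [measurable]: "T i \<in> borel_measurable M" if "i \<in> {1..n}" for i
    using distributed_exponential_imp_distr(1)[OF T_exponential[OF that]] .
  have TTm: "TT \<in> M \<rightarrow>\<^sub>M PT" unfolding TT_def[abs_def] PT_def by (intro measurable_restrict Tm)
  have XXm: "XX \<in> M \<rightarrow>\<^sub>M PX" unfolding XX_def[abs_def] PX_def by (intro measurable_restrict measurable_process) auto
  have incm: "inc \<in> PX \<rightarrow>\<^sub>M PS" unfolding inc_def[abs_def] PS_def PX_def
  proof (rule measurable_PiM_single')
    fix k :: nat
    have [measurable]: "(\<lambda>f. f t) \<in> PiM {0::real..} (\<lambda>_. borel :: real measure) \<rightarrow>\<^sub>M borel" if "t \<ge> 0" for t
      using that by (intro measurable_component_singleton) auto
    show "(\<lambda>f. f (real (Suc k) / 2 ^ m) - f (real k / 2 ^ m)) \<in> PiM {0::real..} (\<lambda>_. borel :: real measure) \<rightarrow>\<^sub>M borel"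
      by (intro borel_measurable_diff) measurable
  qed auto
  have incXX: "inc (XX \<omega>) = (\<lambda>k. increment m k \<omega>)" for \<omega>
    by (simp add: inc_def XX_def increment_def fun_eq_iff)
  have "distr M PT TT \<Otimes>\<^sub>M distr M PS (inc \<circ> XX) = distr M (PT \<Otimes>\<^sub>M PS) (\<lambda>\<omega>. (TT \<omega>, (inc \<circ> XX) \<omega>))"
  proof (rule distr_pair_indep_set[OF T_independent_of_X])
    show "inc \<circ> XX \<in> M \<rightarrow>\<^sub>M PS" using XXm incm by (rule measurable_comp)
    show "TT -` A \<inter> space M \<in> sets (vimage_algebra (space M) (\<lambda>\<omega>. \<lambda>i\<in>{1..n}. T i \<omega>) (PiM {1..n} (\<lambda>_. borel)))"
      if "A \<in> sets PT" for A
      using that unfolding TT_def[abs_def] PT_def by (rule in_vimage_algebra)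
    show "(inc \<circ> XX) -` B \<inter> space M \<in> sets (vimage_algebra (space M) (\<lambda>\<omega>. \<lambda>t\<in>{0..}. X t \<omega>) (PiM {0..} (\<lambda>_. borel)))"
      if "B \<in> sets PS" for B
    proof -
      have "(inc \<circ> XX) -` B \<inter> space M = XX -` (inc -` B \<inter> space PX) \<inter> space M"
        using measurable_space[OF XXm] by auto
      moreover have "inc -` B \<inter> space PX \<in> sets PX" using incm that by (rule measurable_sets)
      ultimately show ?thesis
        unfolding XX_def[abs_def] PX_def by (simp only: in_vimage_algebra)
    qed
  qed (rule TTm)
  moreover have "distr M PT TT = PiM {1..n} (\<lambda>i. exponential_law (q i))"
  proof -
    have "distr M PT TT = PiM {1..n} (\<lambda>i. distr M borel (T i))"
      using T_independent False unfolding PT_def TT_def[abs_def]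
      by (subst (asm) indep_vars_iff_distr_eq_PiM') auto
    also have "\<dots> = PiM {1..n} (\<lambda>i. exponential_law (q i))"
      by (intro PiM_cong refl distributed_exponential_imp_distr(2) T_exponential)
    finally show ?thesis .
  qed
  moreover have "distr M PS (inc \<circ> XX) = PiM UNIV (\<lambda>_. step_law m)"
  proof -
    have "distr M PS (inc \<circ> XX) = distr M PS (\<lambda>\<omega>. \<lambda>k\<in>UNIV. increment m k \<omega>)"
      by (simp add: comp_def incXX restrict_def)
    also have "\<dots> = PiM UNIV (\<lambda>k. distr M borel (increment m k))"
      using indep_vars_increment[of m] unfolding PS_def
      by (subst (asm) indep_vars_iff_distr_eq_PiM') auto
    finally show ?thesis by (simp add: distr_increment)
  qed
  ultimately have law: "distr M (PT \<Otimes>\<^sub>M PS) (\<lambda>\<omega>. (TT \<omega>, inc (XX \<omega>)))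
      = PiM {1..n} (\<lambda>i. exponential_law (q i)) \<Otimes>\<^sub>M PiM UNIV (\<lambda>_. step_law m)" by (simp add: comp_def)
  define G where "G p = walk_cost (map (\<lambda>i. (\<alpha> i, grid_index h (fst p i))) [1..<Suc n]) x (snd p)"
    for p :: "(nat \<Rightarrow> real) \<times> (nat \<Rightarrow> real)"
  have Gm: "G \<in> borel_measurable (PT \<Otimes>\<^sub>M PS)"
  proof -
    have "(\<lambda>p. grid_index h (fst p k)) \<in> PT \<Otimes>\<^sub>M PS \<rightarrow>\<^sub>M count_space UNIV" if "k \<in> {1..n}" for k
    proof -
      have "(\<lambda>t. t k) \<in> PT \<rightarrow>\<^sub>M borel" unfolding PT_def using that by (rule measurable_component_singleton)
      then show ?thesis by (intro measurable_compose[OF _ measurable_grid_index] measurable_compose[OF measurable_fst])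
    qed
    then show ?thesis
      unfolding G_def[abs_def] by (intro measurable_walk_cost_random_index) (auto simp: PS_def)
  qed
  interpret \<mu>: real_distribution "step_law m" by (rule real_distribution_step_law)
  interpret S: prob_space "PiM (UNIV :: nat set) (\<lambda>_. step_law m)"
    by (intro prob_space_PiM prob_space_step_law)
  interpret E: prob_space "PiM {1..n} (\<lambda>i. exponential_law (q i))"
    by (intro prob_space_PiM real_distribution.axioms(1) real_distribution_exponential_law q_pos)
  interpret pair: pair_prob_space "PiM {1..n} (\<lambda>i. exponential_law (q i))" "PiM (UNIV :: nat set) (\<lambda>_. step_law m)"
    by unfold_locales
  have Gb: "0 \<le> G p \<and> G p \<le> 1" for p
    unfolding G_def using \<alpha> by (intro walk_cost_bounds) auto
  have s1: "sets (PiM {1..n} (\<lambda>i. exponential_law (q i))) = sets PT"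
    unfolding PT_def by (intro sets_PiM_cong) (auto simp: exponential_law_def)
  have s2: "sets (PiM UNIV (\<lambda>_. step_law m)) = sets PS"
    unfolding PS_def by (intro sets_PiM_cong) auto
  have Gm': "G \<in> borel_measurable (PiM {1..n} (\<lambda>i. exponential_law (q i)) \<Otimes>\<^sub>M PiM UNIV (\<lambda>_. step_law m))"
    using Gm measurable_cong_sets[OF sets_pair_measure_cong[OF s1 s2] refl] by blast
  have pairm: "(\<lambda>\<omega>. (TT \<omega>, inc (XX \<omega>))) \<in> M \<rightarrow>\<^sub>M PT \<Otimes>\<^sub>M PS"
    using TTm measurable_compose[OF XXm incm] by (rule measurable_Pair)
  have "(\<integral>\<omega>. walk_cost (map (\<lambda>i. (\<alpha> i, grid_index h (T i \<omega>))) [1..<Suc n]) x (\<lambda>k. increment m k \<omega>) \<partial>M)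
      = (\<integral>\<omega>. G (TT \<omega>, inc (XX \<omega>)) \<partial>M)"
  proof (rule Bochner_Integration.integral_cong[OF refl])
    fix \<omega>
    have "map (\<lambda>i. (\<alpha> i, grid_index h (T i \<omega>))) [1..<Suc n] = map (\<lambda>i. (\<alpha> i, grid_index h (TT \<omega> i))) [1..<Suc n]"
      by (rule map_cong) (auto simp: TT_def)
    then show "walk_cost (map (\<lambda>i. (\<alpha> i, grid_index h (T i \<omega>))) [1..<Suc n]) x (\<lambda>k. increment m k \<omega>) = G (TT \<omega>, inc (XX \<omega>))"
      by (simp only: G_def incXX fst_conv snd_conv)
  qed
  also have "\<dots> = (\<integral>p. G p \<partial>distr M (PT \<Otimes>\<^sub>M PS) (\<lambda>\<omega>. (TT \<omega>, inc (XX \<omega>))))"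
    by (rule integral_distr[OF pairm Gm, symmetric])
  also have "\<dots> = (\<integral>t. \<integral>\<xi>. G (t, \<xi>) \<partial>PiM UNIV (\<lambda>_. step_law m) \<partial>PiM {1..n} (\<lambda>i. exponential_law (q i)))"
    unfolding law using Gm' Gb
    by (intro pair.integral_fst'[symmetric] pair.P.integrable_const_bound[where B = 1]) auto
  also have "\<dots> = (\<integral>t. walk_transform (step_law m) (map (\<lambda>i. (\<alpha> i, grid_index h (t i))) [1..<Suc n]) x
      \<partial>PiM (set [1..<Suc n]) (\<lambda>i. exponential_law (q i)))"
  proof -
    have "(\<integral>\<xi>. G (t, \<xi>) \<partial>PiM UNIV (\<lambda>_. step_law m))
      = walk_transform (step_law m) (map (\<lambda>i. (\<alpha> i, grid_index h (t i))) [1..<Suc n]) x" for t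
      unfolding G_def fst_conv snd_conv using \<alpha> by (intro \<mu>.integral_walk_cost) auto
    moreover have "set [1..<Suc n] = {1..n}" by auto
    ultimately show ?thesis by (simp only:)
  qed
  also have "\<dots> = resolvent_transform (step_law m) h (map (\<lambda>i. (\<alpha> i, q i)) [1..<Suc n]) x"
    using \<alpha> q_pos by (intro \<mu>.integral_walk_transform) auto
  finally show ?thesis .
qed

section \<open>Binary encoding of the iterated formula\<close>

text \<open>The ceiling of (P + 1) / 2 ^ i is P div 2 ^ i plus 1, and bit i is the parity of P div 2
  ^ i.\<close>

lemma odd_ceiling_iff_not_bit:
  fixes P i :: nat
  shows "odd \<lceil>real (P + 1) / 2 ^ i\<rceil> \<longleftrightarrow> \<not> bit P i"
proof -
  define d r where "d = P div 2 ^ i" and "r = P mod 2 ^ i"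
  have "P = 2 ^ i * d + r" by (simp add: d_def r_def)
  then have P: "real (P + 1) = 2 ^ i * real d + (real r + 1)" by simp
  have "r < 2 ^ i" by (simp add: r_def)
  then have "Suc r \<le> 2 ^ i" by simp
  then have "real (Suc r) \<le> 2 ^ i" by (metis of_nat_le_iff of_nat_numeral of_nat_power)
  then have "\<lceil>real (P + 1) / 2 ^ i\<rceil> = int d + 1"
    unfolding P by (intro ceiling_unique) (simp_all add: field_simps)
  then show ?thesis by (simp add: bit_iff_odd d_def)
qed

lemma sum_nat_split_parity:
  fixes f :: "nat \<Rightarrow> 'b::comm_monoid_add"
  shows "(\<Sum>u<2 * m. f u) = (\<Sum>v<m. f (2 * v) + f (2 * v + 1))"
  by (induction m) (auto simp: algebra_simps)

text \<open>Each P \<ge> 1 is uniquely 2 ^ (l - 1) times an odd number 2 j - 1, with l - 1 the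
  position of its lowest set bit. So the double sum of the formula is one sum over nonzero bit
  patterns; in the induction, odd P give l = 1 and even P are halved.\<close>

lemma sum_odd_part_decomposition:
  fixes F :: "nat \<Rightarrow> 'b::comm_monoid_add"
  shows "(\<Sum>P\<in>{1..<2 ^ n}. F P) = (\<Sum>l=1..n. \<Sum>j=1..2 ^ (n - l). F (2 ^ l * j - 2 ^ (l - 1)))"
proof (induction n arbitrary: F)
  case (Suc n)
  have shift: "(\<Sum>v<(2::nat) ^ n. G (Suc v)) = (\<Sum>j=1..2 ^ n. G j)" for G :: "nat \<Rightarrow> 'b"
    by (rule sum.reindex_bij_witness[of _ "\<lambda>j. j - 1" Suc]) auto
  have "(\<Sum>P\<in>{1..<2 ^ Suc n}. F P) = (\<Sum>v\<in>{1..<2 ^ n}. F (2 * v)) + (\<Sum>v<2 ^ n. F (2 * v + 1))"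
  proof -
    have "{1..<(2::nat) ^ Suc n} = (\<lambda>v. 2 * v) ` {1..<2 ^ n} \<union> (\<lambda>v. 2 * v + 1) ` {..<2 ^ n}"
    proof (intro equalityI subsetI)
      fix P :: nat assume P: "P \<in> {1..<2 ^ Suc n}"
      show "P \<in> (\<lambda>v. 2 * v) ` {1..<2 ^ n} \<union> (\<lambda>v. 2 * v + 1) ` {..<2 ^ n}"
      proof (cases "even P")
        case True
        then obtain v where "P = 2 * v" by blast
        then show ?thesis using P by auto
      next
        case False
        then obtain v where "P = 2 * v + 1" by (auto elim: oddE)
        then show ?thesis using P by auto
      qed
    qed auto
    moreover have "(\<lambda>v. 2 * v) ` {1..<2 ^ n} \<inter> (\<lambda>v. 2 * v + 1) ` {..<(2::nat) ^ n} = {}" by (auto, presburger)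
    ultimately show ?thesis
      by (simp add: sum.union_disjoint sum.reindex inj_on_def del: power_Suc)
  qed
  moreover have "(\<Sum>v<(2::nat) ^ n. F (2 * v + 1)) = (\<Sum>j=1..2 ^ n. F (2 * j - 1))"
    using shift[of "\<lambda>j. F (2 * j - 1)"] by simp
  moreover have "(\<Sum>v\<in>{1..<2 ^ n}. F (2 * v)) = (\<Sum>l=1..n. \<Sum>j=1..2 ^ (n - l). F (2 ^ Suc l * j - 2 ^ l))"
  proof -
    have "2 * (2 ^ l * j - 2 ^ (l - 1)) = 2 ^ Suc l * j - 2 ^ l" if "l \<in> {1..n}" for l j :: nat
      using that by (cases l) (simp_all add: diff_mult_distrib2 mult.assoc)
    then show ?thesis unfolding Suc by simp
  qed
  moreover have "(\<Sum>l=1..Suc n. \<Sum>j=1..2 ^ (Suc n - l). F (2 ^ l * j - 2 ^ (l - 1)))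
      = (\<Sum>j=1..2 ^ n. F (2 * j - 1)) + (\<Sum>l=1..n. \<Sum>j=1..2 ^ (n - l). F (2 ^ Suc l * j - 2 ^ l))"
    by (simp add: sum.atLeast_Suc_atMost sum.shift_bounds_cl_Suc_ivl del: sum.cl_ivl_Suc)
  ultimately show ?case by (simp add: add.commute)
qed simp

lemma odd_part_decomposition:
  fixes P n :: nat
  assumes "0 < P" "P < 2 ^ n"
  shows "\<exists>l\<in>{1..n}. \<exists>j\<in>{1..2 ^ (n - l)}. P = 2 ^ l * j - 2 ^ (l - 1)"
  using assms
proof (induction n arbitrary: P)
  case (Suc n)
  show ?case
  proof (cases "even P")
    case True
    then obtain v where v: "P = 2 * v" by blast
    then obtain l j where lj: "l \<in> {1..n}" "j \<in> {1..2 ^ (n - l)}" "v = 2 ^ l * j - 2 ^ (l - 1)"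
      using Suc.IH[of v] Suc.prems by auto
    have "P = 2 ^ Suc l * j - 2 ^ (Suc l - 1)"
      using lj v by (cases l) (simp_all add: diff_mult_distrib2 mult.assoc)
    then show ?thesis using lj by (intro bexI[of _ "Suc l"] bexI[of _ j]) auto
  next
    case False
    then obtain v where v: "P = 2 * v + 1" by (auto elim: oddE)
    then have "P = 2 ^ 1 * Suc v - 2 ^ (1 - 1)" "v < 2 ^ n" using Suc.prems by auto
    then show ?thesis by (intro bexI[of _ 1] bexI[of _ "Suc v"]) auto
  qed
qed simp

lemma reflected_exp_mult: "reflected_exp a x * reflected_exp b x = reflected_exp (a + b) x"
  by (simp add: reflected_exp_def mult_exp_exp algebra_simps)

text \<open>The coefficients in the binary encoding \<open>P = p - 1\<close>: bit \<open>i - 1\<close> of \<open>P\<close> tells whether at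
  the \<open>i\<close>-th exponential time the term with exponent \<open>\<psi> (q i)\<close> is chosen.\<close>

context
  fixes \<phi> \<psi> :: "real \<Rightarrow> real" and q \<alpha> :: "nat \<Rightarrow> real" and n :: nat
begin

definition binary_exponent :: "nat \<Rightarrow> nat \<Rightarrow> real" where
  "binary_exponent i P = d_coeff \<psi> q \<alpha> n i (P + 1)"

definition binary_coeff :: "nat \<Rightarrow> nat \<Rightarrow> real" where
  "binary_coeff k P = (\<Prod>i\<in>{k<..n}. (if bit P (i - 1) then - ((\<alpha> i + binary_exponent i P) / \<psi> (q i)) else 1)
      * (q i / (q i - \<phi> (\<alpha> i + binary_exponent i P))))"

text \<open>The prospective limit of \<open>resolvent_transform\<close> over the times k + 1, ...,
  n. In the multiples of 2 ^ k the bits of the earlier times are 0.\<close>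

definition tail_transform :: "nat \<Rightarrow> real \<Rightarrow> real" where
  "tail_transform k x = (\<Sum>u<2 ^ (n - k). binary_coeff k (2 ^ k * u) * reflected_exp (binary_exponent k (2 ^ k * u)) x)"

lemma binary_exponent_rec:
  "i < n \<Longrightarrow> binary_exponent i P = (if bit P i then \<psi> (q (Suc i)) else \<alpha> (Suc i) + binary_exponent (Suc i) P)"
  unfolding binary_exponent_def by (subst d_coeff.simps) (simp only: odd_ceiling_iff_not_bit, simp)

lemma binary_exponent_n [simp]: "binary_exponent n P = 0"
  unfolding binary_exponent_def by (subst d_coeff.simps) simp

text \<open>The recursion from n down to i reads only the bits from i upwards.\<close>

lemma binary_exponent_cong:
  assumes "i \<le> n" "P div 2 ^ i = P' div 2 ^ i"
  shows "binary_exponent i P = binary_exponent i P'"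
  using assms
proof (induction i rule: inc_induct)
  case (step i)
  have "P div 2 ^ Suc i = P' div 2 ^ Suc i"
    using step.prems by (metis div_mult2_eq power_Suc2)
  moreover have "bit P i = bit P' i" using step.prems by (simp add: bit_iff_odd)
  ultimately show ?case using step by (simp add: binary_exponent_rec del: power_Suc)
qed simp

lemma binary_exponent_0: "i \<le> n \<Longrightarrow> binary_exponent i 0 = (\<Sum>k\<in>{i<..n}. \<alpha> k)"
proof (induction i rule: inc_induct)
  case (step i)
  have "{i<..n} = insert (Suc i) {Suc i<..n}" using step.hyps by auto
  then show ?case using step by (simp add: binary_exponent_rec)
qed simp

lemma binary_exponent_nonneg:
  assumes "\<And>i. i \<in> {1..n} \<Longrightarrow> 0 \<le> \<alpha> i" "\<And>i. i \<in> {1..n} \<Longrightarrow> 0 \<le> \<psi> (q i)" "i \<le> n"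
  shows "0 \<le> binary_exponent i P"
  using assms(3)
proof (induction i rule: inc_induct)
  case (step i)
  then show ?case using assms(1)[of "Suc i"] assms(2)[of "Suc i"] by (simp only: binary_exponent_rec) auto
qed simp

text \<open>The recursion is reset at the lowest set bit, and every earlier time merely adds its
  \<alpha>. Hence the exponent of x in the formula depends on l but not on j.\<close>

lemma binary_exponent_lowest_bit:
  assumes "l < n" "bit P l" "\<And>k. k < l \<Longrightarrow> \<not> bit P k" "i \<le> l"
  shows "binary_exponent i P = (\<Sum>k\<in>{i<..l}. \<alpha> k) + \<psi> (q (Suc l))"
  using assms(4)
proof (induction i rule: inc_induct)
  case base
  then show ?case using assms by (simp only: binary_exponent_rec) auto
next
  case (step i)
  have "{i<..l} = insert (Suc i) {Suc i<..l}" using step.hyps by auto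
  then show ?case using step assms by (simp only: binary_exponent_rec[of i P]) auto
qed

lemma tail_transform_n [simp]: "tail_transform n x = 1"
  by (simp add: tail_transform_def binary_coeff_def reflected_exp_def)

text \<open>The patterns 2 ^ k * (2 v) and 2 ^ k * (2 v + 1) differ only in bit k and share
  everything decided at later times. Their two terms form the one-time limit started from the
  exponent \<open>a v\<close>.\<close>

lemma tail_transform_Suc:
  assumes k: "k < n"
  defines "a \<equiv> \<lambda>v. \<alpha> (Suc k) + binary_exponent (Suc k) (2 ^ Suc k * v)"
  shows "tail_transform k x = (\<Sum>v<2 ^ (n - Suc k). binary_coeff (Suc k) (2 ^ Suc k * v)
     * (q (Suc k) / (q (Suc k) - \<phi> (a v)) * (reflected_exp (a v) x - a v / \<psi> (q (Suc k)) * reflected_exp (\<psi> (q (Suc k))) x)))"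
proof -
  define f where "f u = binary_coeff k (2 ^ k * u) * reflected_exp (binary_exponent k (2 ^ k * u)) x" for u
  have e: "2 ^ (n - k) = 2 * (2::nat) ^ (n - Suc k)" using k by (metis Suc_diff_Suc power_Suc)
  have I: "{k<..n} = insert (Suc k) {Suc k<..n}" using k by auto
  have coeff: "binary_coeff k P = (if bit P k then - (a v / \<psi> (q (Suc k))) else 1) * (q (Suc k) / (q (Suc k) - \<phi> (a v)))
        * binary_coeff (Suc k) (2 ^ Suc k * v)"
    if P: "P div 2 ^ Suc k = v" for P v
  proof -
    have div: "P div 2 ^ i = (2 ^ Suc k * v) div 2 ^ i" if i: "Suc k \<le> i" for i
    proof -
      have "(2::nat) ^ i = 2 ^ Suc k * 2 ^ (i - Suc k)" using i by (metis le_add_diff_inverse power_add)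
      then show ?thesis using P by (simp only: div_mult2_eq) simp
    qed
    have be: "binary_exponent i P = binary_exponent i (2 ^ Suc k * v)" if "i \<in> {k<..n}" for i
      using that by (intro binary_exponent_cong div) auto
    have bits: "bit P (i - 1) = bit (2 ^ Suc k * v) (i - 1)" if "i \<in> {Suc k<..n}" for i
    proof -
      have "Suc k \<le> i - 1" using that by auto
      from div[OF this] show ?thesis by (simp only: bit_iff_odd)
    qed
    have "binary_coeff k P = (if bit P k then - (a v / \<psi> (q (Suc k))) else 1) * (q (Suc k) / (q (Suc k) - \<phi> (a v)))
      * (\<Prod>i\<in>{Suc k<..n}. (if bit P (i - 1) then - ((\<alpha> i + binary_exponent i P) / \<psi> (q i)) else 1)
      * (q i / (q i - \<phi> (\<alpha> i + binary_exponent i P))))"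
      unfolding binary_coeff_def I using be[of "Suc k"] k
      by (subst prod.insert) (auto simp del: power_Suc simp add: a_def)
    also have "(\<Prod>i\<in>{Suc k<..n}. (if bit P (i - 1) then - ((\<alpha> i + binary_exponent i P) / \<psi> (q i)) else 1)
      * (q i / (q i - \<phi> (\<alpha> i + binary_exponent i P)))) = binary_coeff (Suc k) (2 ^ Suc k * v)"
      unfolding binary_coeff_def
    proof (rule prod.cong[OF refl])
      fix i assume i: "i \<in> {Suc k<..n}"
      then have "binary_exponent i P = binary_exponent i (2 ^ Suc k * v)" by (intro be) auto
      then show "(if bit P (i - 1) then - ((\<alpha> i + binary_exponent i P) / \<psi> (q i)) else 1) * (q i / (q i - \<phi> (\<alpha> i + binary_exponent i P)))
        = (if bit (2 ^ Suc k * v) (i - 1) then - ((\<alpha> i + binary_exponent i (2 ^ Suc k * v)) / \<psi> (q i)) else 1)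
          * (q i / (q i - \<phi> (\<alpha> i + binary_exponent i (2 ^ Suc k * v))))"
        unfolding bits[OF i] by (simp only:)
    qed
    finally show ?thesis .
  qed
  have "f (2 * v) + f (2 * v + 1) = binary_coeff (Suc k) (2 ^ Suc k * v)
     * (q (Suc k) / (q (Suc k) - \<phi> (a v)) * (reflected_exp (a v) x - a v / \<psi> (q (Suc k)) * reflected_exp (\<psi> (q (Suc k))) x))" for v
  proof -
    have b0: "\<not> bit (2 ^ k * (2 * v)) k" and b1: "bit (2 ^ k * (2 * v + 1)) k" by (simp_all add: bit_iff_odd)
    have d0: "2 ^ k * (2 * v) div 2 ^ Suc k = v" by simp
    have d1: "2 ^ k * (2 * v + 1) div 2 ^ Suc k = v" by (simp add: div_mult2_eq power_Suc2 del: power_Suc)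
    have P0: "2 ^ k * (2 * v) = 2 ^ Suc k * v" by simp
    have x0: "binary_exponent k (2 ^ k * (2 * v)) = a v"
      using b0 by (simp only: binary_exponent_rec[OF k] a_def P0) simp
    have x1: "binary_exponent k (2 ^ k * (2 * v + 1)) = \<psi> (q (Suc k))"
      using b1 by (simp only: binary_exponent_rec[OF k]) simp
    show ?thesis
      unfolding f_def x0 x1 coeff[OF d0] coeff[OF d1] using b0 b1 by (simp add: algebra_simps)
  qed
  then show ?thesis
    unfolding tail_transform_def e sum_nat_split_parity f_def[symmetric] by (rule sum.cong[OF refl])
qed

text \<open>The separately listed denominators with plain sums of \<alpha> are the case P = 0, and
  the pairs (l, j) run through 0 < P < 2 ^ n.\<close>

lemma regular_params_iff:
  assumes \<alpha>: "\<And>i. i \<in> {1..n} \<Longrightarrow> 0 \<le> \<alpha> i"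
  shows "\<alpha> \<in> regular_params \<phi> \<psi> q n \<longleftrightarrow>
    (\<forall>P<2 ^ n. \<forall>i\<in>{1..n}. q i - \<phi> (\<alpha> i + binary_exponent i P) \<noteq> 0)
    \<and> (\<forall>l\<in>{1..n}. \<forall>j\<in>{1..2 ^ (n - l)}. \<forall>i\<in>{l..n}. binary_exponent (i - 1) (2 ^ l * j - 2 ^ (l - 1)) \<noteq> 0)"
    (is "_ \<longleftrightarrow> ?A \<and> ?B")
proof -
  have zero: "(\<Sum>k=i..n. \<alpha> k) = \<alpha> i + binary_exponent i 0" if "i \<in> {1..n}" for i
  proof -
    have "{i..n} = insert i {i<..n}" using that by auto
    then show ?thesis using that by (simp add: binary_exponent_0)
  qed
  have lt: "2 ^ l * j - 2 ^ (l - 1) < 2 ^ n" if "l \<in> {1..n}" "j \<in> {1..2 ^ (n - l)}" for l j :: nat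
  proof -
    have "2 ^ l * j \<le> 2 ^ l * 2 ^ (n - l)" using that by (intro mult_left_mono) auto
    also have "\<dots> = (2::nat) ^ n" using that by (simp add: power_add[symmetric])
    finally have "2 ^ l * j \<le> (2::nat) ^ n" .
    moreover have "2 ^ l * j - 2 ^ (l - 1) < 2 ^ l * j" using that by (intro diff_less) auto
    ultimately show ?thesis by linarith
  qed
  have "?A \<longleftrightarrow> (\<forall>i\<in>{1..n}. q i - \<phi> (\<alpha> i + binary_exponent i 0) \<noteq> 0)
     \<and> (\<forall>l\<in>{1..n}. \<forall>j\<in>{1..2 ^ (n - l)}. \<forall>i\<in>{1..n}. q i - \<phi> (\<alpha> i + binary_exponent i (2 ^ l * j - 2 ^ (l - 1))) \<noteq> 0)"
  proof (intro iffI conjI)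
    assume r: "(\<forall>i\<in>{1..n}. q i - \<phi> (\<alpha> i + binary_exponent i 0) \<noteq> 0)
     \<and> (\<forall>l\<in>{1..n}. \<forall>j\<in>{1..2 ^ (n - l)}. \<forall>i\<in>{1..n}. q i - \<phi> (\<alpha> i + binary_exponent i (2 ^ l * j - 2 ^ (l - 1))) \<noteq> 0)"
    show ?A
    proof (intro allI impI)
      fix P :: nat assume P: "P < 2 ^ n"
      show "\<forall>i\<in>{1..n}. q i - \<phi> (\<alpha> i + binary_exponent i P) \<noteq> 0"
      proof (cases "P = 0")
        case True then show ?thesis using r by blast
      next
        case False
        then obtain l j where "l\<in>{1..n}" "j\<in>{1..2 ^ (n - l)}" "P = 2 ^ l * j - 2 ^ (l - 1)"
          using odd_part_decomposition[of P n] P by blast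
        then show ?thesis using r by blast
      qed
    qed
  next
    assume ?A
    then show "\<forall>i\<in>{1..n}. q i - \<phi> (\<alpha> i + binary_exponent i 0) \<noteq> 0" by simp
    show "\<forall>l\<in>{1..n}. \<forall>j\<in>{1..2 ^ (n - l)}. \<forall>i\<in>{1..n}. q i - \<phi> (\<alpha> i + binary_exponent i (2 ^ l * j - 2 ^ (l - 1))) \<noteq> 0"
      using \<open>?A\<close> lt by blast
  qed
  moreover have "\<alpha> \<in> regular_params \<phi> \<psi> q n \<longleftrightarrow> (\<forall>i\<in>{1..n}. q i - \<phi> (\<alpha> i + binary_exponent i 0) \<noteq> 0)
     \<and> (\<forall>l\<in>{1..n}. \<forall>j\<in>{1..2 ^ (n - l)}. (\<forall>i\<in>{1..n}. q i - \<phi> (\<alpha> i + binary_exponent i (2 ^ l * j - 2 ^ (l - 1))) \<noteq> 0)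
        \<and> (\<forall>i\<in>{l..n}. binary_exponent (i - 1) (2 ^ l * j - 2 ^ (l - 1)) \<noteq> 0))"
  proof -
    have "(\<forall>i\<in>{1..n}. q i - \<phi> (\<Sum>k=i..n. \<alpha> k) \<noteq> 0) \<longleftrightarrow> (\<forall>i\<in>{1..n}. q i - \<phi> (\<alpha> i + binary_exponent i 0) \<noteq> 0)"
      using zero by (intro ball_cong refl) (simp only:)
    then show ?thesis
      unfolding regular_params_def Let_def mem_Collect_eq binary_exponent_def[symmetric] using \<alpha> by blast
  qed
  ultimately show ?thesis by blast
qed

text \<open>P = 0 yields the product term. For P > 0 the minus signs of the set bits collect to
  \<open>sign_coeff\<close>, and the quotients by \<psi> (q i) at set bits become the second product
  of \<open>L_coeff\<close>.\<close>

lemma tail_transform_0: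
  assumes \<alpha>: "\<And>i. i \<in> {1..n} \<Longrightarrow> 0 \<le> \<alpha> i" and reg: "\<alpha> \<in> regular_params \<phi> \<psi> q n" and x: "0 \<le> x"
  shows "tail_transform 0 x = transform_formula \<phi> \<psi> q n \<alpha> x"
proof -
  define F where "F P = binary_coeff 0 P * reflected_exp (binary_exponent 0 P) x" for P
  have re: "reflected_exp a x = exp (- a * x)" for a using x by (simp add: reflected_exp_def)
  have "{..<(2::nat) ^ n} = insert 0 {1..<2 ^ n}" by auto
  then have "tail_transform 0 x = F 0 + (\<Sum>P\<in>{1..<2 ^ n}. F P)"
    by (simp add: tail_transform_def F_def)
  also have "F 0 = (\<Prod>i=1..n. q i / (q i - \<phi> (\<Sum>k=i..n. \<alpha> k))) * exp (- (\<Sum>k=1..n. \<alpha> k) * x)"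
  proof -
    have "(\<Sum>k=i..n. \<alpha> k) = \<alpha> i + binary_exponent i 0" if "i \<in> {1..n}" for i
    proof -
      have "{i..n} = insert i {i<..n}" using that by auto
      then show ?thesis using that by (simp add: binary_exponent_0)
    qed
    moreover have "{0<..n} = {1..n}" by auto
    ultimately show ?thesis
      by (simp only: F_def re binary_coeff_def binary_exponent_0[of 0]) simp
  qed
  also have "(\<Sum>P\<in>{1..<2 ^ n}. F P) = (\<Sum>l=1..n. \<Sum>j=1..2 ^ (n - l). F (2 ^ l * j - 2 ^ (l - 1)))"
    by (rule sum_odd_part_decomposition)
  also have "\<dots> = (\<Sum>l=1..n. \<Sum>j=1..2 ^ (n - l).
          L_coeff \<phi> \<psi> q \<alpha> n (2 ^ l * j - 2 ^ (l - 1) + 1) l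
          * exp (- ((\<Sum>k=1..<l. \<alpha> k) + \<psi> (q l)) * x))"
  proof (intro sum.cong refl)
    fix l j :: nat assume l: "l \<in> {1..n}" and j: "j \<in> {1..2 ^ (n - l)}"
    define P :: nat where "P = 2 ^ l * j - 2 ^ (l - 1)"
    obtain m where m: "l = Suc m" "m < n" using l by (cases l) auto
    obtain i where i: "j = Suc i" using j by (cases j) auto
    have P: "P = 2 ^ m * (2 * i + 1)" by (simp add: P_def m i algebra_simps)
    have bm: "bit P m" by (simp add: P bit_iff_odd)
    have bk: "\<not> bit P k" if "k < m" for k
    proof -
      have "(2::nat) ^ m = 2 ^ k * (2 * 2 ^ (m - Suc k))"
        using that by (metis Suc_diff_Suc add_diff_inverse_nat less_imp_le_nat not_less power_Suc power_add)
      then have "P = 2 ^ k * (2 * (2 ^ (m - Suc k) * (2 * i + 1)))" unfolding P by (simp only: mult.assoc)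
      then show ?thesis by (simp add: bit_iff_odd)
    qed
    have e0: "binary_exponent 0 P = (\<Sum>k=1..<l. \<alpha> k) + \<psi> (q l)"
    proof -
      have "{0<..m} = {1..<l}" by (auto simp: m)
      then show ?thesis using binary_exponent_lowest_bit[of m P 0] bm bk m by simp
    qed
    have nz: "binary_exponent (i - 1) P \<noteq> 0" if "i \<in> {l..n}" for i
      using iffD1[OF regular_params_iff[OF \<alpha>] reg] l j that unfolding P_def by blast
    have "binary_coeff 0 P = L_coeff \<phi> \<psi> q \<alpha> n (P + 1) l"
    proof -
      define r where "r i = (if bit P (i - 1) then (\<alpha> i + binary_exponent i P) / \<psi> (q i) else 1)" for i
      have "sign_coeff n (P + 1) = (\<Prod>k\<in>{k. k < n \<and> bit P k}. - 1)"
        by (simp add: sign_coeff_def)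
      also have "\<dots> = (\<Prod>k<n. if bit P k then - 1 else 1)"
        by (subst prod.inter_filter[symmetric]) (auto intro!: arg_cong[where f = "prod _"])
      also have "\<dots> = (\<Prod>i=1..n. if bit P (i - 1) then - 1 else 1)"
        by (rule prod.reindex_bij_witness[of _ "\<lambda>i. i - 1" Suc]) auto
      finally have s: "sign_coeff n (P + 1) = (\<Prod>i=1..n. if bit P (i - 1) then - 1 else 1)" .
      have "(\<Prod>i=l..n. (\<alpha> i + binary_exponent i P) / binary_exponent (i - 1) P) = (\<Prod>i=l..n. r i)"
      \<comment> \<open>If bit i - 1 is clear, numerator and denominator agree; the quotient is 1
        because regularity excludes a zero denominator, where division would return 0.\<close>
      proof (rule prod.cong[OF refl])
        fix i assume il: "i \<in> {l..n}"
        then obtain i' where i': "i = Suc i'" "i' < n" using l by (cases i) auto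
        show "(\<alpha> i + binary_exponent i P) / binary_exponent (i - 1) P = r i"
          using binary_exponent_rec[OF i'(2), of P] nz[OF il] by (auto simp: r_def i' split: if_splits)
      qed
      also have "\<dots> = (\<Prod>i=1..n. r i)"
      proof (rule prod.mono_neutral_left)
        \<comment> \<open>Bits below the lowest set bit l - 1 are clear, so the product may start at
          l.\<close>
        show "\<forall>i\<in>{1..n} - {l..n}. r i = 1" using bk m by (auto simp: r_def)
      qed (use l in auto)
      finally have rr: "(\<Prod>i=l..n. (\<alpha> i + binary_exponent i P) / binary_exponent (i - 1) P) = (\<Prod>i=1..n. r i)" .
      have "{0<..n} = {1..n}" by auto
      then show ?thesis
        unfolding L_coeff_def binary_exponent_def[symmetric] rr s binary_coeff_def prod.distrib[symmetric]
        by (intro prod.cong) (auto simp: r_def simp del: minus_add_distrib)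
    qed
    then show "F (2 ^ l * j - 2 ^ (l - 1)) = L_coeff \<phi> \<psi> q \<alpha> n (2 ^ l * j - 2 ^ (l - 1) + 1) l
          * exp (- ((\<Sum>k=1..<l. \<alpha> k) + \<psi> (q l)) * x)"
      unfolding P_def[symmetric] F_def re e0 by simp
  qed
  finally show ?thesis by (simp add: transform_formula_def)
qed

end

section \<open>Limit of the iterated resolvents\<close>

lemma (in real_distribution) grid_resolvent_sum:
  assumes "finite I" "\<And>i. i \<in> I \<Longrightarrow> bounded_measurable (f i)" "q > 0"
  shows "grid_resolvent M q h (\<lambda>x. \<Sum>i\<in>I. c i * f i x) x = (\<Sum>i\<in>I. c i * grid_resolvent M q h (f i) x)"
  using assms(1,2)
proof (induction I rule: finite_induct)
  case empty
  have "grid_resolvent M q h (\<lambda>x. 0 * 1 + 0 * 1) x = 0 * grid_resolvent M q h (\<lambda>_. 1) x + 0 * grid_resolvent M q h (\<lambda>_. 1) x"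
    by (intro grid_resolvent_linear bounded_measurable_const assms(3))
  then show ?case by simp
next
  case (insert i I)
  have bm: "bounded_measurable (\<lambda>x. \<Sum>i\<in>I. c i * f i x)"
    by (intro bounded_measurable_sum bounded_measurable_cmult insert.prems) auto
  have "grid_resolvent M q h (\<lambda>x. c i * f i x + 1 * (\<Sum>i\<in>I. c i * f i x)) x
      = c i * grid_resolvent M q h (f i) x + 1 * grid_resolvent M q h (\<lambda>x. \<Sum>i\<in>I. c i * f i x) x"
    by (intro grid_resolvent_linear bm insert.prems assms(3)) auto
  then show ?case using insert by simp
qed

text \<open>Backward from the last time: the inherited error passes through the resolvent without
  growing in sup norm, and the limit function is a finite combination of exponentials, to each of
  which the one-time limit applies.\<close>

lemma (in spectrally_positive_levy_process) resolvent_transform_uniform_limit: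
  fixes q \<alpha> :: "nat \<Rightarrow> real" and n :: nat
  defines "\<phi> \<equiv> laplace_exponent M X" and "\<psi> \<equiv> right_inverse (laplace_exponent M X)"
  assumes sub: "\<not> subordinator M X"
    and q: "\<And>i. i \<in> {1..n} \<Longrightarrow> 0 < q i" and \<alpha>: "\<And>i. i \<in> {1..n} \<Longrightarrow> 0 \<le> \<alpha> i"
    and reg: "\<alpha> \<in> regular_params \<phi> \<psi> q n" and k: "k \<le> n"
  shows "\<forall>e>0. eventually (\<lambda>m. \<forall>x. \<bar>resolvent_transform (step_law m) (1 / 2 ^ m) (map (\<lambda>i. (\<alpha> i, q i)) [Suc k..<Suc n]) x
      - tail_transform \<phi> \<psi> q \<alpha> n k x\<bar> \<le> e) sequentially"
  using k
proof (induction k rule: inc_induct)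
  case base
  then show ?case by simp
next
  case (step k)
  define a where "a v = \<alpha> (Suc k) + binary_exponent \<psi> q \<alpha> n (Suc k) (2 ^ Suc k * v)" for v
  define c where "c v = binary_coeff \<phi> \<psi> q \<alpha> n (Suc k) (2 ^ Suc k * v)" for v
  define R where "R v x = q (Suc k) / (q (Suc k) - \<phi> (a v)) * (reflected_exp (a v) x - a v / \<psi> (q (Suc k)) * reflected_exp (\<psi> (q (Suc k))) x)" for v x
  define N :: nat where "N = 2 ^ (n - Suc k)"
  define B where "B m = resolvent_transform (step_law m) (1 / 2 ^ m) (map (\<lambda>i. (\<alpha> i, q i)) [Suc (Suc k)..<Suc n])" for m
  define g where "g = tail_transform \<phi> \<psi> q \<alpha> n (Suc k)"
  have Sk: "Suc k \<in> {1..n}" using step.hyps by auto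
  have \<psi>0: "0 < \<psi> (q i)" "\<phi> (\<psi> (q i)) = q i" if "i \<in> {1..n}" for i
    using right_inverse_laplace_exponent(1,2)[OF sub q[OF that]] by (simp_all add: \<psi>_def \<phi>_def)
  have q0: "q (Suc k) > 0" by (rule q[OF Sk])
  have a0: "0 \<le> a v" for v
    unfolding a_def using \<alpha>[OF Sk] step.hyps \<psi>0 less_imp_le
    by (intro add_nonneg_nonneg binary_exponent_nonneg \<alpha>) auto
  have areg: "\<phi> (a v) \<noteq> q (Suc k)" if v: "v < N" for v
  proof -
    have "2 ^ Suc k * v < 2 ^ Suc k * N" using v by simp
    also have "\<dots> = 2 ^ n" using step.hyps by (simp only: N_def power_add[symmetric]) simp
    finally show ?thesis
      using iffD1[OF regular_params_iff[OF \<alpha>] reg] Sk unfolding a_def by (metis diff_self)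
  qed
  have gk: "tail_transform \<phi> \<psi> q \<alpha> n k x = (\<Sum>v<N. c v * R v x)" for x
    using tail_transform_Suc[OF step.hyps(2), of \<phi> \<psi> q \<alpha> x] unfolding N_def c_def R_def a_def .
  have Eg: "reflected_exp (\<alpha> (Suc k)) y * g y = (\<Sum>v<N. c v * reflected_exp (a v) y)" for y
    by (simp add: g_def tail_transform_def N_def c_def a_def sum_distrib_left reflected_exp_mult[symmetric] mult.left_commute)
  have res: "resolvent_transform (step_law m) (1 / 2 ^ m) (map (\<lambda>i. (\<alpha> i, q i)) [Suc k..<Suc n])
      = grid_resolvent (step_law m) (q (Suc k)) (1 / 2 ^ m) (\<lambda>y. reflected_exp (\<alpha> (Suc k)) y * B m y)" for m
    using step.hyps by (simp add: upt_conv_Cons B_def del: upt_Suc)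
  show ?case
  proof (intro allI impI)
    fix e :: real assume e: "e > 0"
    \<comment> \<open>C dominates the sum of the absolute coefficients, with 1 added for positivity,
      so accuracy d for every exponential costs at most e / 2 in total.\<close>
    define C where "C = (\<Sum>v<N. \<bar>c v\<bar>) + 1"
    have C: "C > 0" unfolding C_def by (intro add_nonneg_pos sum_nonneg) auto
    define d where "d = e / (2 * C)"
    have d: "d > 0" using e C by (simp add: d_def)
    have ev1: "eventually (\<lambda>m. \<forall>x. \<bar>B m x - g x\<bar> \<le> e / 2) sequentially"
      using step.IH e unfolding B_def g_def by (meson half_gt_zero)
    have ev2: "eventually (\<lambda>m. \<forall>v\<in>{..<N}. \<forall>x. \<bar>grid_resolvent (step_law m) (q (Suc k)) (1 / 2 ^ m) (reflected_exp (a v)) x - R v x\<bar> \<le> d) sequentially"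
    proof (intro eventually_ball_finite ballI)
      fix v assume "v \<in> {..<N}"
      then have "\<phi> (a v) \<noteq> q (Suc k)" using areg by simp
      then show "eventually (\<lambda>m. \<forall>x. \<bar>grid_resolvent (step_law m) (q (Suc k)) (1 / 2 ^ m) (reflected_exp (a v)) x - R v x\<bar> \<le> d) sequentially"
        unfolding R_def \<phi>_def
        by (intro grid_resolvent_step_law_uniform_limit a0 q0 d \<psi>0[OF Sk] \<psi>0[OF Sk, unfolded \<phi>_def])
    qed simp
    show "eventually (\<lambda>m. \<forall>x. \<bar>resolvent_transform (step_law m) (1 / 2 ^ m) (map (\<lambda>i. (\<alpha> i, q i)) [Suc k..<Suc n]) x
      - tail_transform \<phi> \<psi> q \<alpha> n k x\<bar> \<le> e) sequentially"
      using ev1 ev2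
    proof eventually_elim
      case (elim m)
      interpret \<mu>: real_distribution "step_law m" by (rule real_distribution_step_law)
      let ?U = "grid_resolvent (step_law m) (q (Suc k)) (1 / 2 ^ m)"
      show ?case
      proof
        fix x
        have bmB: "bounded_measurable (B m)"
          unfolding B_def using \<alpha> q by (intro conjunct1[OF \<mu>.resolvent_transform_bounded]) auto
        have bmE: "bounded_measurable (reflected_exp (a v))" for v by (intro bounded_measurable_reflected_exp a0)
        have bmE': "bounded_measurable (reflected_exp (\<alpha> (Suc k)))" by (intro bounded_measurable_reflected_exp \<alpha> Sk)
        have bmg: "bounded_measurable g" unfolding g_def tail_transform_def
          by (intro bounded_measurable_sum bounded_measurable_cmult bounded_measurable_reflected_exp
              binary_exponent_nonneg \<alpha> less_imp_le[OF \<psi>0(1)]) (use step.hyps in auto)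
        define D where "D y = reflected_exp (\<alpha> (Suc k)) y * (B m y - g y)" for y
        have bmD: "bounded_measurable D" unfolding D_def by (intro bounded_measurable_mult bounded_measurable_diff bmE' bmB bmg)
        have Dle: "\<bar>D y\<bar> \<le> e / 2" for y
        proof -
          have "\<bar>reflected_exp (\<alpha> (Suc k)) y\<bar> * \<bar>B m y - g y\<bar> \<le> 1 * (e / 2)"
            using reflected_exp_bounds[OF \<alpha>[OF Sk], of y] elim(1) by (intro mult_mono) auto
          then show ?thesis by (simp add: D_def abs_mult)
        qed
        have "(\<lambda>y. reflected_exp (\<alpha> (Suc k)) y * B m y) = (\<lambda>y. 1 * D y + 1 * (\<Sum>v<N. c v * reflected_exp (a v) y))"
          unfolding Eg[symmetric] by (simp add: D_def algebra_simps)
        then have "?U (\<lambda>y. reflected_exp (\<alpha> (Suc k)) y * B m y) x = 1 * ?U D x + 1 * ?U (\<lambda>y. \<Sum>v<N. c v * reflected_exp (a v) y) x"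
          by (simp only:) (intro \<mu>.grid_resolvent_linear bmD q0 bounded_measurable_sum bounded_measurable_cmult bmE)
        also have "?U (\<lambda>y. \<Sum>v<N. c v * reflected_exp (a v) y) x = (\<Sum>v<N. c v * ?U (reflected_exp (a v)) x)"
          by (intro \<mu>.grid_resolvent_sum bmE q0) simp
        finally have eq: "?U (\<lambda>y. reflected_exp (\<alpha> (Suc k)) y * B m y) x - tail_transform \<phi> \<psi> q \<alpha> n k x
            = ?U D x + (\<Sum>v<N. c v * (?U (reflected_exp (a v)) x - R v x))"
          by (simp add: gk sum_subtractf algebra_simps)
        have "\<bar>?U D x + (\<Sum>v<N. c v * (?U (reflected_exp (a v)) x - R v x))\<bar> \<le> \<bar>?U D x\<bar> + (\<Sum>v<N. \<bar>c v * (?U (reflected_exp (a v)) x - R v x)\<bar>)"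
          by (rule order_trans[OF abs_triangle_ineq add_left_mono[OF sum_abs]])
        also have "\<dots> \<le> e / 2 + (\<Sum>v<N. \<bar>c v\<bar> * d)"
        proof (intro add_mono sum_mono)
          show "\<bar>?U D x\<bar> \<le> e / 2" by (intro \<mu>.grid_resolvent_abs_le bmD Dle q0)
          fix v assume "v \<in> {..<N}"
          then show "\<bar>c v * (?U (reflected_exp (a v)) x - R v x)\<bar> \<le> \<bar>c v\<bar> * d"
            unfolding abs_mult using elim(2) by (intro mult_left_mono) auto
        qed
        also have "(\<Sum>v<N. \<bar>c v\<bar> * d) \<le> C * d" using d by (simp add: C_def sum_distrib_right[symmetric])
        also have "C * d = e / 2" using C by (simp add: d_def)
        finally show "\<bar>resolvent_transform (step_law m) (1 / 2 ^ m) (map (\<lambda>i. (\<alpha> i, q i)) [Suc k..<Suc n]) x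
            - tail_transform \<phi> \<psi> q \<alpha> n k x\<bar> \<le> e"
          unfolding res eq by simp
      qed
    qed
  qed
qed

section \<open>Passage to continuous time\<close>

lemma borel_measurable_completion_AE_eq:
  fixes f g :: "'a \<Rightarrow> real"
  assumes g: "g \<in> borel_measurable M" and eq: "AE x in M. f x = g x"
  shows "f \<in> borel_measurable (completion M)"
proof (rule measurableI)
  fix A :: "real set" assume A: "A \<in> sets borel"
  have "g -` A \<inter> space (completion M) \<in> sets (completion M)"
    using measurable_sets[OF measurable_completion[OF g] A] .
  moreover have "AE x in completion M. x \<in> g -` A \<inter> space (completion M) \<longleftrightarrow> x \<in> f -` A \<inter> space (completion M)"
    using AE_completion[OF eq] by eventually_elim auto
  ultimately show "f -` A \<inter> space (completion M) \<in> sets (completion M)"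
    by (intro completion.in_sets_AE[of "g -` A \<inter> space (completion M)" "f -` A \<inter> space (completion M)"]) auto
qed simp

lemma grid_index_bounds:
  assumes "0 \<le> t"
  shows "t \<le> real (grid_index (1 / 2 ^ m) t) / 2 ^ m" "real (grid_index (1 / 2 ^ m) t) / 2 ^ m \<le> t + 1 / 2 ^ m"
proof -
  have eq: "real (grid_index (1 / 2 ^ m) t) = of_int \<lceil>t * 2 ^ m\<rceil>"
    using assms by (simp add: grid_index_def)
  have "t * 2 ^ m \<le> of_int \<lceil>t * 2 ^ m\<rceil>" "of_int \<lceil>t * 2 ^ m\<rceil> \<le> t * 2 ^ m + 1" by linarith+
  then show "t \<le> real (grid_index (1 / 2 ^ m) t) / 2 ^ m" "real (grid_index (1 / 2 ^ m) t) / 2 ^ m \<le> t + 1 / 2 ^ m"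
    unfolding eq by (simp_all add: field_simps)
qed

context levy_process begin

lemma workload_nonneg:
  assumes "bounded ((\<lambda>s. X s \<omega>) ` {0..t})" "0 \<le> t"
  shows "0 \<le> workload X x t \<omega>"
proof -
  obtain B where "\<forall>y\<in>(\<lambda>s. X s \<omega>) ` {0..t}. norm y \<le> B" using assms(1) bounded_iff by blast
  then have "bdd_above ((\<lambda>s. - X s \<omega>) ` {0..t})" by (intro bdd_aboveI2[of _ _ B]) force
  then have "- X t \<omega> \<le> (SUP s\<in>{0..t}. - X s \<omega>)" using assms(2) by (intro cSUP_upper) auto
  then show ?thesis unfolding workload_def by linarith
qed

lemma walk_cost_tendsto_workload:
  fixes T :: "nat \<Rightarrow> 'w \<Rightarrow> real"
  assumes right: "\<And>t. t \<ge> 0 \<Longrightarrow> ((\<lambda>s. X s \<omega>) \<longlongrightarrow> X t \<omega>) (at_right t)"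
    and bdd: "\<And>t. bounded ((\<lambda>s. X s \<omega>) ` {0..t})" and X0: "X 0 \<omega> = 0"
    and T: "\<And>i. i \<in> {1..n} \<Longrightarrow> 0 \<le> T i \<omega>" and x: "0 \<le> x"
  shows "(\<lambda>m. walk_cost (map (\<lambda>i. (\<alpha> i, grid_index (1 / 2 ^ m) (T i \<omega>))) [1..<Suc n]) x (\<lambda>k. increment m k \<omega>))
    \<longlonglongrightarrow> exp (- (\<Sum>i=1..n. \<alpha> i * workload X x (\<Sum>k=1..i. T k \<omega>) \<omega>))"
proof -
  have "(\<lambda>m. lindley_walk x (\<lambda>k. increment m k \<omega>) (\<Sum>k=1..i. grid_index (1 / 2 ^ m) (T k \<omega>)))
      \<longlonglongrightarrow> workload X x (\<Sum>k=1..i. T k \<omega>) \<omega>" if i: "i \<in> {1..n}" for i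
  proof -
    define j where "j m = (\<Sum>k=1..i. grid_index (1 / 2 ^ m) (T k \<omega>))" for m :: nat
    define t where "t = (\<Sum>k=1..i. T k \<omega>)"
    have T': "0 \<le> T k \<omega>" if "k \<in> {1..i}" for k using T[of k] that i by auto
    have j: "real (j m) / 2 ^ m = (\<Sum>k=1..i. real (grid_index (1 / 2 ^ m) (T k \<omega>)) / 2 ^ m)" for m
      by (simp add: j_def sum_divide_distrib)
    have j1: "t \<le> real (j m) / 2 ^ m" for m
      unfolding j t_def by (intro sum_mono grid_index_bounds T')
    \<comment> \<open>The exponential times are rounded up one by one, so their errors add up to at
      most i mesh widths.\<close>
    have j2: "real (j m) / 2 ^ m \<le> t + real i * (1 / 2 ^ m)" for m
    proof -
      have "real (j m) / 2 ^ m \<le> (\<Sum>k=1..i. T k \<omega> + 1 / 2 ^ m)"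
        unfolding j by (intro sum_mono grid_index_bounds T')
      then show ?thesis by (simp add: t_def sum.distrib)
    qed
    have jlim: "(\<lambda>m. real (j m) / 2 ^ m) \<longlonglongrightarrow> t"
    proof (rule tendsto_sandwich[of "\<lambda>_. t" _ _ "\<lambda>m. t + real i * (1 / 2 ^ m)"])
      show "(\<lambda>m. t + real i * (1 / 2 ^ m)) \<longlonglongrightarrow> t" by real_asymp
    qed (use j1 j2 in auto)
    have t0: "0 \<le> t" unfolding t_def by (intro sum_nonneg T')
    have "(\<lambda>m. X (real (j m) / 2 ^ m) \<omega> + max x (MAX i\<in>{..j m}. - X (real i / 2 ^ m) \<omega>))
        \<longlonglongrightarrow> X t \<omega> + max x (SUP s\<in>{0..t}. - X s \<omega>)"
      by (rule workload_grid_approximation[OF right bdd t0 j1 jlim])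
    moreover have "lindley_walk x (\<lambda>k. increment m k \<omega>) (j m)
        = X (real (j m) / 2 ^ m) \<omega> + max x (MAX i\<in>{..j m}. - X (real i / 2 ^ m) \<omega>)" for m
      using lindley_walk_increments[of "\<lambda>k. X (real k / 2 ^ m) \<omega>" x "j m"] X0 x by (simp add: increment_def)
    ultimately show ?thesis by (simp add: workload_def j_def t_def)
  qed
  then show ?thesis
    unfolding walk_cost_upt by (intro tendsto_intros)
qed

context
  fixes T :: "nat \<Rightarrow> 'w \<Rightarrow> real" and n :: nat and q :: "nat \<Rightarrow> real" and x :: real
  assumes T_exponential: "\<And>i. i \<in> {1..n} \<Longrightarrow> distributed M lborel (T i) (exponential_density (q i))"
    and x: "0 \<le> x"
begin

lemma AE_good_paths:
  "AE \<omega> in M. (\<forall>t\<ge>0. ((\<lambda>s. X s \<omega>) \<longlongrightarrow> X t \<omega>) (at_right t))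
    \<and> (\<forall>t. bounded ((\<lambda>s. X s \<omega>) ` {0..t})) \<and> X 0 \<omega> = 0 \<and> (\<forall>i\<in>{1..n}. 0 \<le> T i \<omega>)"
proof -
  have "AE \<omega> in M. 0 \<le> T i \<omega>" if i: "i \<in> {1..n}" for i
  proof -
    have "AE t in density lborel (\<lambda>t. ennreal (exponential_density (q i) t)). 0 \<le> t"
      by (subst AE_density) (auto simp: exponential_density_def)
    then have "AE t in distr M lborel (T i). 0 \<le> t"
      unfolding distributed_distr_eq_density[OF T_exponential[OF i]] .
    then show ?thesis
      using distributed_measurable[OF T_exponential[OF i]] by (subst (asm) AE_distr_iff) auto
  qed
  then have "AE \<omega> in M. \<forall>i\<in>{1..n}. 0 \<le> T i \<omega>" by (intro AE_finite_allI) auto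
  then show ?thesis
    using right_continuous_paths left_limits start_zero
  proof eventually_elim
    case (elim \<omega>)
    then show ?case
      using cadlag_bounded_on_interval[of "\<lambda>s. X s \<omega>"] by blast
  qed
qed

lemma AE_walk_cost_tendsto:
  "AE \<omega> in M. (\<lambda>m. walk_cost (map (\<lambda>i. (\<alpha> i, grid_index (1 / 2 ^ m) (T i \<omega>))) [1..<Suc n]) x (\<lambda>k. increment m k \<omega>))
    \<longlonglongrightarrow> exp (- (\<Sum>i=1..n. \<alpha> i * workload X x (\<Sum>k=1..i. T k \<omega>) \<omega>))"
  using AE_good_paths
  by eventually_elim (intro walk_cost_tendsto_workload x; blast)

lemma measurable_walk_cost_step:
  "(\<lambda>\<omega>. walk_cost (map (\<lambda>i. (\<alpha> i, grid_index h (T i \<omega>))) [1..<Suc n]) x (\<lambda>k. increment m k \<omega>)) \<in> borel_measurable M"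
  by (intro measurable_walk_cost_random_index measurable_compose[OF _ measurable_grid_index]
      distributed_exponential_imp_distr(1)[OF T_exponential]) auto

text \<open>The integrand is almost surely the limit of measurable sampled costs, hence almost
  everywhere equal to a measurable function, which is enough for the completion.\<close>

lemma borel_measurable_workload_cost:
  "(\<lambda>\<omega>. exp (- (\<Sum>i=1..n. \<alpha> i * workload X x (\<Sum>k=1..i. T k \<omega>) \<omega>))) \<in> borel_measurable (completion M)"
proof (rule borel_measurable_completion_AE_eq)
  let ?W = "\<lambda>m \<omega>. walk_cost (map (\<lambda>i. (\<alpha> i, grid_index (1 / 2 ^ m) (T i \<omega>))) [1..<Suc n]) x (\<lambda>k. increment m k \<omega>)"
  show "(\<lambda>\<omega>. lim (\<lambda>m. ?W m \<omega>)) \<in> borel_measurable M"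
    by (intro borel_measurable_lim_metric measurable_walk_cost_step)
  show "AE \<omega> in M. exp (- (\<Sum>i=1..n. \<alpha> i * workload X x (\<Sum>k=1..i. T k \<omega>) \<omega>)) = lim (\<lambda>m. ?W m \<omega>)"
    using AE_walk_cost_tendsto by eventually_elim (rule limI[symmetric])
qed

lemma expectation_walk_cost_tendsto_joint_transform:
  assumes \<alpha>: "\<And>i. i \<in> {1..n} \<Longrightarrow> 0 \<le> \<alpha> i"
  shows "(\<lambda>m. \<integral>\<omega>. walk_cost (map (\<lambda>i. (\<alpha> i, grid_index (1 / 2 ^ m) (T i \<omega>))) [1..<Suc n]) x (\<lambda>k. increment m k \<omega>) \<partial>M)
    \<longlonglongrightarrow> joint_transform M X T n \<alpha> x"
proof -
  let ?W = "\<lambda>m \<omega>. walk_cost (map (\<lambda>i. (\<alpha> i, grid_index (1 / 2 ^ m) (T i \<omega>))) [1..<Suc n]) x (\<lambda>k. increment m k \<omega>)"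
  have Wm: "?W m \<in> borel_measurable M" for m
    by (rule measurable_walk_cost_step)
  have "(\<lambda>m. \<integral>\<omega>. ?W m \<omega> \<partial>completion M) \<longlonglongrightarrow> joint_transform M X T n \<alpha> x"
    unfolding joint_transform_def
  proof (rule integral_dominated_convergence[where w = "\<lambda>_. 1"])
    show "(\<lambda>\<omega>. exp (- (\<Sum>i=1..n. \<alpha> i * workload X x (\<Sum>k=1..i. T k \<omega>) \<omega>))) \<in> borel_measurable (completion M)"
      by (rule borel_measurable_workload_cost)
    show "?W m \<in> borel_measurable (completion M)" for m by (intro measurable_completion Wm)
    show "integrable (completion M) (\<lambda>_. 1 :: real)" by (subst integrable_completion) auto
    show "AE \<omega> in completion M. (\<lambda>m. ?W m \<omega>) \<longlonglongrightarrow> exp (- (\<Sum>i=1..n. \<alpha> i * workload X x (\<Sum>k=1..i. T k \<omega>) \<omega>))"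
      by (intro AE_completion AE_walk_cost_tendsto)
    show "AE \<omega> in completion M. norm (?W m \<omega>) \<le> 1" for m
    proof (rule AE_I2)
      fix \<omega>
      have "0 \<le> ?W m \<omega> \<and> ?W m \<omega> \<le> 1" using \<alpha> by (intro walk_cost_bounds) auto
      then show "norm (?W m \<omega>) \<le> 1" by simp
    qed
  qed
  then show ?thesis by (simp only: integral_completion[OF Wm])
qed

text \<open>The workload is nonnegative on good paths, so 1 dominates. This continuity supplies the
  value at irregular parameters.\<close>

lemma joint_transform_sequentially_continuous:
  assumes \<beta>: "\<And>m i. i \<in> {1..n} \<Longrightarrow> 0 \<le> \<beta> m i" and lim: "\<And>i. i \<in> {1..n} \<Longrightarrow> (\<lambda>m. \<beta> m i) \<longlonglongrightarrow> \<alpha> i"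
  shows "(\<lambda>m. joint_transform M X T n (\<beta> m) x) \<longlonglongrightarrow> joint_transform M X T n \<alpha> x"
  unfolding joint_transform_def
proof (rule integral_dominated_convergence[where w = "\<lambda>_. 1"])
  show "(\<lambda>\<omega>. exp (- (\<Sum>i=1..n. \<alpha> i * workload X x (\<Sum>k=1..i. T k \<omega>) \<omega>))) \<in> borel_measurable (completion M)"
    by (rule borel_measurable_workload_cost)
  show "(\<lambda>\<omega>. exp (- (\<Sum>i=1..n. \<beta> m i * workload X x (\<Sum>k=1..i. T k \<omega>) \<omega>))) \<in> borel_measurable (completion M)" for m
    by (rule borel_measurable_workload_cost)
  show "integrable (completion M) (\<lambda>_. 1 :: real)" by (subst integrable_completion) auto
  show "AE \<omega> in completion M. (\<lambda>m. exp (- (\<Sum>i=1..n. \<beta> m i * workload X x (\<Sum>k=1..i. T k \<omega>) \<omega>)))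
      \<longlonglongrightarrow> exp (- (\<Sum>i=1..n. \<alpha> i * workload X x (\<Sum>k=1..i. T k \<omega>) \<omega>))"
    by (intro AE_I2 tendsto_intros lim)
  show "AE \<omega> in completion M. norm (exp (- (\<Sum>i=1..n. \<beta> m i * workload X x (\<Sum>k=1..i. T k \<omega>) \<omega>))) \<le> 1" for m
    using AE_completion[OF AE_good_paths]
  proof eventually_elim
    case (elim \<omega>)
    have "0 \<le> \<beta> m i * workload X x (\<Sum>k=1..i. T k \<omega>) \<omega>" if i: "i \<in> {1..n}" for i
    proof (intro mult_nonneg_nonneg \<beta>[OF i] workload_nonneg)
      show "0 \<le> (\<Sum>k=1..i. T k \<omega>)" using elim i by (intro sum_nonneg) auto
    qed (use elim in blast)
    then have "0 \<le> (\<Sum>i=1..n. \<beta> m i * workload X x (\<Sum>k=1..i. T k \<omega>) \<omega>)" by (rule sum_nonneg)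
    then show ?case by simp
  qed
qed

end

end

section \<open>Accumulation of regular parameters\<close>

text \<open>Every level adds \<epsilon> or resets to a constant. The slope is therefore nonnegative,
  and after adding one more \<epsilon> it is at least 1.\<close>

lemma binary_exponent_affine:
  assumes "i \<le> n"
  shows "\<exists>A B. 0 \<le> B \<and> (\<forall>\<epsilon>. binary_exponent \<psi> q (\<lambda>k. \<alpha> k + \<epsilon>) n i P = A + B * \<epsilon>)"
  using assms
proof (induction i rule: inc_induct)
  case base
  show ?case by (intro exI[of _ 0]) simp
next
  case (step i)
  then obtain A B where AB: "0 \<le> B" "\<And>\<epsilon>. binary_exponent \<psi> q (\<lambda>k. \<alpha> k + \<epsilon>) n (Suc i) P = A + B * \<epsilon>" by auto
  show ?case
  proof (cases "bit P i")
    case True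
    then show ?thesis using step.hyps by (intro exI[of _ "\<psi> (q (Suc i))"] exI[of _ 0]) (simp add: binary_exponent_rec)
  next
    case False
    then show ?thesis using step.hyps AB
      by (intro exI[of _ "\<alpha> (Suc i) + A"] exI[of _ "1 + B"]) (simp add: binary_exponent_rec algebra_simps)
  qed
qed

text \<open>Along the diagonal \<open>\<alpha> + \<epsilon> (1, 1, \<dots>)\<close> each of the finitely many denominators
  is a nonconstant function that vanishes for at most one \<open>\<epsilon>\<close>.\<close>

lemma finite_irregular_diagonal:
  fixes \<phi> \<psi> :: "real \<Rightarrow> real"
  assumes \<alpha>: "\<And>i. i \<in> {1..n} \<Longrightarrow> 0 \<le> \<alpha> i"
    and \<psi>0: "\<And>i. i \<in> {1..n} \<Longrightarrow> 0 < \<psi> (q i)"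
    and uniq: "\<And>i a. i \<in> {1..n} \<Longrightarrow> 0 \<le> a \<Longrightarrow> \<phi> a = q i \<Longrightarrow> a = \<psi> (q i)"
  shows "finite {\<epsilon>. 0 < \<epsilon> \<and> (\<lambda>k. \<alpha> k + \<epsilon>) \<notin> regular_params \<phi> \<psi> q n}"
proof (rule finite_subset)
  let ?b = "\<lambda>\<epsilon>. binary_exponent \<psi> q (\<lambda>k. \<alpha> k + \<epsilon>) n"
  let ?F = "\<Union>P\<in>{..<2 ^ n}. \<Union>i\<in>{1..n}. {\<epsilon>. \<alpha> i + \<epsilon> + ?b \<epsilon> i P = \<psi> (q i)}"
  show "finite ?F"
  proof (intro finite_UN_I)
    fix P i :: nat assume "i \<in> {1..n}"
    then obtain A B where AB: "0 \<le> B" "\<And>\<epsilon>. ?b \<epsilon> i P = A + B * \<epsilon>"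
      using binary_exponent_affine[of i n \<psi> q \<alpha> P] by auto
    \<comment> \<open>The slope 1 + B is positive, so the equation has just this root.\<close>
    have "{\<epsilon>. \<alpha> i + \<epsilon> + ?b \<epsilon> i P = \<psi> (q i)} \<subseteq> {(\<psi> (q i) - \<alpha> i - A) / (1 + B)}"
      using AB by (auto simp: field_simps)
    then show "finite {\<epsilon>. \<alpha> i + \<epsilon> + ?b \<epsilon> i P = \<psi> (q i)}" by (rule finite_subset) simp
  qed auto
  show "{\<epsilon>. 0 < \<epsilon> \<and> (\<lambda>k. \<alpha> k + \<epsilon>) \<notin> regular_params \<phi> \<psi> q n} \<subseteq> ?F"
  proof
    fix \<epsilon> assume "\<epsilon> \<in> {\<epsilon>. 0 < \<epsilon> \<and> (\<lambda>k. \<alpha> k + \<epsilon>) \<notin> regular_params \<phi> \<psi> q n}"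
    then have \<epsilon>: "0 < \<epsilon>" and irreg: "(\<lambda>k. \<alpha> k + \<epsilon>) \<notin> regular_params \<phi> \<psi> q n" by auto
    have nn: "0 \<le> \<alpha> i + \<epsilon>" if "i \<in> {1..n}" for i using \<alpha>[OF that] \<epsilon> by simp
    have b0: "0 \<le> ?b \<epsilon> i P" if "i \<le> n" for i P
      using that by (intro binary_exponent_nonneg nn less_imp_le[OF \<psi>0])
    \<comment> \<open>These denominators are either \<psi> (q i) or at least \<epsilon>, so only
      those with \<phi> can fail.\<close>
    have "?b \<epsilon> (i - 1) P \<noteq> 0" if i: "i \<in> {1..n}" for i P
    proof -
      obtain i' where i': "i = Suc i'" "i' < n" using i by (cases i) auto
      have "0 < \<alpha> i + \<epsilon> + ?b \<epsilon> i P" using \<alpha>[OF i] \<epsilon> b0[of i P] i by auto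
      then show ?thesis
        using binary_exponent_rec[OF i'(2), of \<psi> q "\<lambda>k. \<alpha> k + \<epsilon>" P] \<psi>0[OF i] by (auto simp: i')
    qed
    then have "\<forall>l\<in>{1..n}. \<forall>j\<in>{1..2 ^ (n - l)}. \<forall>i\<in>{l..n}. ?b \<epsilon> (i - 1) (2 ^ l * j - 2 ^ (l - 1)) \<noteq> 0"
      by simp
    then have "\<not> (\<forall>P<2 ^ n. \<forall>i\<in>{1..n}. q i - \<phi> (\<alpha> i + \<epsilon> + ?b \<epsilon> i P) \<noteq> 0)"
      using irreg regular_params_iff[of n "\<lambda>k. \<alpha> k + \<epsilon>" \<phi> \<psi> q, OF nn] by blast
    then obtain P i where Pi: "P < 2 ^ n" "i \<in> {1..n}" "\<phi> (\<alpha> i + \<epsilon> + ?b \<epsilon> i P) = q i" by auto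
    have "\<alpha> i + \<epsilon> + ?b \<epsilon> i P = \<psi> (q i)"
      using nn[OF Pi(2)] b0[of i P] Pi(2) by (intro uniq Pi) auto
    then show "\<epsilon> \<in> ?F" using Pi by (intro UN_I[of P] UN_I[of i]) auto
  qed
qed

text \<open>Each interval (0, 1 / (m + 1)) is infinite while only finitely many \<epsilon> are bad,
  so regular points on the diagonal approach \<alpha>; positive \<epsilon> keeps them different from
  \<alpha>.\<close>

lemma regular_params_islimpt:
  fixes \<phi> \<psi> :: "real \<Rightarrow> real"
  assumes "\<And>i. i \<in> {1..n} \<Longrightarrow> 0 \<le> \<alpha> i"
    and "\<And>i. i \<in> {1..n} \<Longrightarrow> 0 < \<psi> (q i)"
    and "\<And>i a. i \<in> {1..n} \<Longrightarrow> 0 \<le> a \<Longrightarrow> \<phi> a = q i \<Longrightarrow> a = \<psi> (q i)"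
  shows "\<alpha> islimpt regular_params \<phi> \<psi> q n"
proof -
  let ?bad = "{\<epsilon>. 0 < \<epsilon> \<and> (\<lambda>k. \<alpha> k + \<epsilon>) \<notin> regular_params \<phi> \<psi> q n}"
  have "\<exists>\<epsilon>. 0 < \<epsilon> \<and> \<epsilon> < 1 / real (Suc m) \<and> (\<lambda>k. \<alpha> k + \<epsilon>) \<in> regular_params \<phi> \<psi> q n" for m
  proof -
    have "infinite {0<..<1 / real (Suc m)}" by (simp add: infinite_Ioo)
    then have "\<not> {0<..<1 / real (Suc m)} \<subseteq> ?bad"
      using finite_irregular_diagonal[of n \<alpha> \<psi> q \<phi>, OF assms] finite_subset by blast
    then show ?thesis by auto
  qed
  then obtain \<epsilon> where \<epsilon>: "\<And>m. 0 < \<epsilon> m" "\<And>m. \<epsilon> m < 1 / real (Suc m)"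
      "\<And>m. (\<lambda>k. \<alpha> k + \<epsilon> m) \<in> regular_params \<phi> \<psi> q n" by metis
  have "\<epsilon> \<longlonglongrightarrow> 0"
  proof (rule tendsto_sandwich[of "\<lambda>_. 0" _ _ "\<lambda>m. 1 / real (Suc m)"])
    show "(\<lambda>m. 1 / real (Suc m)) \<longlonglongrightarrow> 0" by real_asymp
    have "0 \<le> \<epsilon> m" "\<epsilon> m \<le> 1 / real (Suc m)" for m
      using \<epsilon>(1,2)[of m] by (simp_all only: less_imp_le)
    then show "eventually (\<lambda>m. 0 \<le> \<epsilon> m) sequentially" "eventually (\<lambda>m. \<epsilon> m \<le> 1 / real (Suc m)) sequentially"
      by (simp_all only: eventually_True)
  qed simp
  then have "(\<lambda>m. \<alpha> k + \<epsilon> m) \<longlonglongrightarrow> \<alpha> k + 0" for k by (intro tendsto_intros)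
  then have "(\<lambda>m k. \<alpha> k + \<epsilon> m) \<longlonglongrightarrow> \<alpha>"
    \<comment> \<open>The topology on functions is the product topology, so coordinatewise
      convergence suffices.\<close>
    by (simp add: limitin_canonical_iff[symmetric] euclidean_product_topology[symmetric] limitin_componentwise
        del: limitin_canonical_iff)
  moreover have "(\<lambda>k. \<alpha> k + \<epsilon> m) \<noteq> \<alpha>" for m
    using \<epsilon>(1)[of m] by (auto simp: fun_eq_iff)
  ultimately show ?thesis
    unfolding islimpt_sequential using \<epsilon>(3) by (intro exI[of _ "\<lambda>m k. \<alpha> k + \<epsilon> m"]) auto
qed

theorem theorem3p1:
  fixes M :: "'w measure" and X :: "real \<Rightarrow> 'w \<Rightarrow> real" and T :: "nat \<Rightarrow> 'w \<Rightarrow> real"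
    and n :: nat and q \<alpha> :: "nat \<Rightarrow> real" and x :: real and \<phi> \<psi> :: "real \<Rightarrow> real"
  assumes X: "spectrally_positive_levy_process M X"
    and not_subordinator: "\<not> subordinator M X"
    and phi: "\<phi> = laplace_exponent M X"
    and psi: "\<psi> = right_inverse \<phi>"
    and q_pos: "\<And>i. i \<in> {1..n} \<Longrightarrow> 0 < q i"
    and q_distinct: "inj_on q {1..n}"
    and T_exponential: "\<And>i. i \<in> {1..n} \<Longrightarrow> distributed M lborel (T i) (exponential_density (q i))"
    and T_independent: "prob_space.indep_vars M (\<lambda>_. borel) T {1..n}"
    and T_independent_of_X:
      "prob_space.indep_set M
         (sets (vimage_algebra (space M) (\<lambda>\<omega>. \<lambda>i\<in>{1..n}. T i \<omega>) (PiM {1..n} (\<lambda>_. borel))))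
         (sets (vimage_algebra (space M) (\<lambda>\<omega>. \<lambda>t\<in>{0..}. X t \<omega>) (PiM {0..} (\<lambda>_. borel))))"
    and alpha_nonneg: "\<And>i. i \<in> {1..n} \<Longrightarrow> 0 \<le> \<alpha> i"
    and x_nonneg: "0 \<le> x"
  shows "(\<alpha> \<in> regular_params \<phi> \<psi> q n \<longrightarrow>
            joint_transform M X T n \<alpha> x = transform_formula \<phi> \<psi> q n \<alpha> x)
       \<and> at \<alpha> within regular_params \<phi> \<psi> q n \<noteq> bot
       \<and> ((\<lambda>\<beta>. transform_formula \<phi> \<psi> q n \<beta> x) \<longlongrightarrow> joint_transform M X T n \<alpha> x)
            (at \<alpha> within regular_params \<phi> \<psi> q n)"
proof -
  interpret spectrally_positive_levy_process M X by (rule X)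
  have \<psi>: "0 < \<psi> (q i)" "\<And>a. 0 \<le> a \<Longrightarrow> \<phi> a = q i \<Longrightarrow> a = \<psi> (q i)" if "i \<in> {1..n}" for i
    using right_inverse_laplace_exponent(1,3)[OF not_subordinator q_pos[OF that]] by (simp_all add: phi psi)
  have formula: "joint_transform M X T n \<beta> x = transform_formula \<phi> \<psi> q n \<beta> x"
    if \<beta>: "\<beta> \<in> regular_params \<phi> \<psi> q n" for \<beta>
  proof -
    have \<beta>0: "0 \<le> \<beta> i" if "i \<in> {1..n}" for i using \<beta> that by (simp add: regular_params_def)
    let ?A = "\<lambda>m. resolvent_transform (step_law m) (1 / 2 ^ m) (map (\<lambda>i. (\<beta> i, q i)) [1..<Suc n]) x"
    let ?W = "\<lambda>m \<omega>. walk_cost (map (\<lambda>i. (\<beta> i, grid_index (1 / 2 ^ m) (T i \<omega>))) [1..<Suc n]) x (\<lambda>k. increment m k \<omega>)"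
    have "(\<integral>\<omega>. ?W m \<omega> \<partial>M) = ?A m" for m
      using q_pos T_exponential T_independent T_independent_of_X \<beta>0 by (rule expectation_walk_cost)
    moreover have "(\<lambda>m. \<integral>\<omega>. ?W m \<omega> \<partial>M) \<longlonglongrightarrow> joint_transform M X T n \<beta> x"
      using T_exponential x_nonneg \<beta>0 by (rule expectation_walk_cost_tendsto_joint_transform)
    ultimately have "?A \<longlonglongrightarrow> joint_transform M X T n \<beta> x" by (simp only:)
    moreover have "?A \<longlonglongrightarrow> tail_transform \<phi> \<psi> q \<beta> n 0 x"
    proof (rule LIMSEQ_I)
      fix e :: real assume "e > 0"
      have "\<forall>e>0. eventually (\<lambda>m. \<forall>x. \<bar>resolvent_transform (step_law m) (1 / 2 ^ m) (map (\<lambda>i. (\<beta> i, q i)) [Suc 0..<Suc n]) x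
          - tail_transform \<phi> \<psi> q \<beta> n 0 x\<bar> \<le> e) sequentially"
        using not_subordinator q_pos \<beta>0 \<beta> le0[of n] unfolding phi psi
        by (rule resolvent_transform_uniform_limit)
      moreover have "0 < e / 2" using \<open>e > 0\<close> by simp
      ultimately have "eventually (\<lambda>m. \<forall>y. \<bar>resolvent_transform (step_law m) (1 / 2 ^ m) (map (\<lambda>i. (\<beta> i, q i)) [Suc 0..<Suc n]) y
          - tail_transform \<phi> \<psi> q \<beta> n 0 y\<bar> \<le> e / 2) sequentially" by blast
      then have "eventually (\<lambda>m. norm (?A m - tail_transform \<phi> \<psi> q \<beta> n 0 x) < e) sequentially"
      proof eventually_elim
        case (elim m)
        then have "\<bar>?A m - tail_transform \<phi> \<psi> q \<beta> n 0 x\<bar> \<le> e / 2" by (simp only: One_nat_def)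
        then show ?case using \<open>e > 0\<close> by (simp only: real_norm_def)
      qed
      then show "\<exists>N. \<forall>m\<ge>N. norm (?A m - tail_transform \<phi> \<psi> q \<beta> n 0 x) < e"
        by (simp only: eventually_sequentially)
    qed
    ultimately have "joint_transform M X T n \<beta> x = tail_transform \<phi> \<psi> q \<beta> n 0 x" by (rule LIMSEQ_unique)
    then show ?thesis using tail_transform_0[OF \<beta>0 \<beta> x_nonneg] by simp
  qed
  \<comment> \<open>On regular parameters the formula is the joint transform, so its limit at
    \<alpha> is sequential continuity of the latter.\<close>
  have "((\<lambda>\<beta>. transform_formula \<phi> \<psi> q n \<beta> x) \<longlongrightarrow> joint_transform M X T n \<alpha> x) (at \<alpha> within regular_params \<phi> \<psi> q n)"
    unfolding tendsto_at_iff_sequentially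
  proof (intro allI impI)
    fix \<beta> :: "nat \<Rightarrow> nat \<Rightarrow> real"
    assume "\<forall>m. \<beta> m \<in> regular_params \<phi> \<psi> q n - {\<alpha>}" and lim: "\<beta> \<longlonglongrightarrow> \<alpha>"
    then have \<beta>: "\<beta> m \<in> regular_params \<phi> \<psi> q n" for m by blast
    have coordinates: "(\<lambda>m. \<beta> m i) \<longlonglongrightarrow> \<alpha> i" for i
      using lim continuous_on_product_coordinates[of i]
      by (intro continuous_on_tendsto_compose[of UNIV "\<lambda>f. f i" \<beta> \<alpha> sequentially]) auto
    have "0 \<le> \<beta> m i" if "i \<in> {1..n}" for m i
      using \<beta>[of m] that by (simp add: regular_params_def)
    with T_exponential x_nonneg have "(\<lambda>m. joint_transform M X T n (\<beta> m) x) \<longlonglongrightarrow> joint_transform M X T n \<alpha> x"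
      using coordinates by (rule joint_transform_sequentially_continuous)
    then show "((\<lambda>\<beta>. transform_formula \<phi> \<psi> q n \<beta> x) \<circ> \<beta>) \<longlonglongrightarrow> joint_transform M X T n \<alpha> x"
      by (simp add: comp_def formula[OF \<beta>])
  qed
  \<comment> \<open>Along a trivial filter every value would be a limit; nontriviality makes the
    limit determine the joint transform.\<close>
  moreover have "at \<alpha> within regular_params \<phi> \<psi> q n \<noteq> bot"
  proof -
    have "\<alpha> islimpt regular_params \<phi> \<psi> q n"
      using alpha_nonneg \<psi> by (rule regular_params_islimpt)
    then show ?thesis
      using trivial_limit_within[of \<alpha> "regular_params \<phi> \<psi> q n"] by blast
  qed
  ultimately show ?thesis using formula by blast
qed

end
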